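(* Let $n$ be a positive integer, let $p=\lceil\frac{n+1}{2}\rceil$ and $q=\lfloor\frac{n+1}{2}\rfloor$, and set $P=\binom p2$, $Q=\binom q2$, and $N=\binom n2$. Then $$\hat F_{w_n}=s_{\delta_p}s_{\delta_q}\qquad\text{and}\qquad \hat F^{\mathrm{FPF}}_{w_{2n}}=(s_{\delta_n})^2.$$ Consequently, $|\hat{\mathcal R}(w_n)|=\binom{P+Q}{P}f^{\delta_p}f^{\delta_q}$ and $|\hat{\mathcal R}_{\mathrm{FPF}}(w_{2n})|=\binom{2N}{N}(f^{\delta_n})^2$.
   Context: $w_n=[n,n-1,\dots,2,1]\in S_n$ is the longest permutation, $s_i=(i,i+1)$, $\delta_n$ is the partition $(n-1,n-2,\dots,2,1)$, $s_\lambda$ is the Schur function of $\lambda$, and $f^\lambda$ is the number of standard Young tableaux of shape $\lambda$. For an involution $y$ in a symmetric group and an index $i$, set $y\rtimes s_i = ys_i$ if $ys_i=s_iy$ and $y\rtimes s_i=s_iys_i$ otherwise. An involution word for an involution $z$ is a sequence of positive integers $(a_1,\dots,a_k)$ of shortest possible length such that $z=(\cdots((1\rtimes s_{a_1})\rtimes s_{a_2})\rtimes\cdots)\rtimes s_{a_k}$; $\hat{\mathcal R}(z)$ is the set of these. For involutions $y,z$, $\hat{\mathcal R}(y,z)$ is the set of sequences which, when appended to involution words of $y$, produce involution words of $z$ (this does not depend on the chosen involution word of $y$). For an involution $z\in S_{2n}$, $\hat{\mathcal R}_{\mathrm{FPF}}(z)=\hat{\mathcal R}(v_n,z)$, where $v_n=(1,2)(3,4)\cdots(2n-1,2n)$.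 For a sequence $a=(a_1,\dots,a_k)$ of positive integers, $C(a)$ is the set of sequences of positive integers $I=(i_1\le i_2\le\dots\le i_k)$ with $i_j<i_{j+1}$ whenever $a_j<a_{j+1}$, and $x_I=x_{i_1}\cdots x_{i_k}$. The involution Stanley symmetric functions are the power series $$\hat F_{y,z}=\sum_{a\in\hat{\mathcal R}(y,z)}\ \sum_{I\in C(a)}x_I,\qquad \hat F_y=\hat F_{1,y},\qquad \hat F^{\mathrm{FPF}}_z=\hat F_{v_n,z}\ \text{ for fixed-point-free involutions } z\in S_{2n}.$$ *)

theory Defs
  imports Complex_Main "HOL-Library.Multiset" "HOL-Library.FuncSet"
    "HOL-Combinatorics.Permutations"
begin

section \<open>Integral formal power series in countably many variables\<close>

text \<open>
  A monomial in the variables $x_0, x_1, x_2, \ldots$ is encoded as the multiset of the indices of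
  its variables; multiplication of monomials is addition of multisets.  All series below only
  involve variables with positive index.
\<close>

typedef mseries = "UNIV :: (nat multiset \<Rightarrow> int) set"
  morphisms mcoeff MSeries
  by simp

setup_lifting type_definition_mseries

lemma mseries_eqI: "(\<And>M. mcoeff f M = mcoeff g M) \<Longrightarrow> f = g"
  by (simp add: mcoeff_inject [symmetric] fun_eq_iff)

definition msplits :: "nat multiset \<Rightarrow> (nat multiset \<times> nat multiset) set" where
  "msplits M = {(A, B). A + B = M}"

lemma finite_msubsets: "finite {A. A \<subseteq># (M :: 'a multiset)}"
proof (rule finite_subset)
  show "{A. A \<subseteq># M} \<subseteq> mset ` {xs. set xs \<subseteq> set_mset M \<and> length xs \<le> size M}"
  proof
    fix A assume "A \<in> {A. A \<subseteq># M}"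
    then have A: "A \<subseteq># M" by simp
    obtain xs where xs: "mset xs = A" using ex_mset by blast
    have "set xs \<subseteq> set_mset M" using A xs set_mset_mono by fastforce
    moreover have "length xs \<le> size M" using A xs size_mset_mono by fastforce
    ultimately show "A \<in> mset ` {xs. set xs \<subseteq> set_mset M \<and> length xs \<le> size M}"
      using xs by blast
  qed
  show "finite (mset ` {xs. set xs \<subseteq> set_mset M \<and> length xs \<le> size M})"
    by (intro finite_imageI finite_lists_length_le) simp
qed

lemma finite_msplits [simp]: "finite (msplits M)"
proof (rule finite_subset)
  show "msplits M \<subseteq> {A. A \<subseteq># M} \<times> {A. A \<subseteq># M}"
    by (auto simp: msplits_def)
  show "finite ({A. A \<subseteq># M} \<times> {A. A \<subseteq># M})"
    by (simp add: finite_msubsets)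
qed

instantiation mseries :: comm_ring_1
begin

lift_definition zero_mseries :: mseries is "\<lambda>_. 0" .
lift_definition one_mseries :: mseries is "\<lambda>M. if M = {#} then 1 else 0" .
lift_definition plus_mseries :: "mseries \<Rightarrow> mseries \<Rightarrow> mseries" is "\<lambda>f g M. f M + g M" .
lift_definition minus_mseries :: "mseries \<Rightarrow> mseries \<Rightarrow> mseries" is "\<lambda>f g M. f M - g M" .
lift_definition uminus_mseries :: "mseries \<Rightarrow> mseries" is "\<lambda>f M. - f M" .
lift_definition times_mseries :: "mseries \<Rightarrow> mseries \<Rightarrow> mseries"
  is "\<lambda>f g M. \<Sum>(A, B)\<in>msplits M. f A * g B" .

lemmas mcoeff_simps =
  zero_mseries.rep_eq one_mseries.rep_eq plus_mseries.rep_eq minus_mseries.rep_eq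
  uminus_mseries.rep_eq

instance
proof
  fix a b c :: mseries
  show "a + b + c = a + (b + c)" by (rule mseries_eqI) (simp add: mcoeff_simps)
  show "a + b = b + a" by (rule mseries_eqI) (simp add: mcoeff_simps)
  show "0 + a = a" by (rule mseries_eqI) (simp add: mcoeff_simps)
  show "- a + a = 0" by (rule mseries_eqI) (simp add: mcoeff_simps)
  show "a - b = a + - b" by (rule mseries_eqI) (simp add: mcoeff_simps)
  show "(0 :: mseries) \<noteq> 1"
  proof
    assume "(0 :: mseries) = 1"
    then have "mcoeff 0 {#} = mcoeff 1 {#}" by simp
    then show False by (simp add: mcoeff_simps)
  qed
  show "(a + b) * c = a * c + b * c"
    by (rule mseries_eqI)
      (simp add: times_mseries.rep_eq mcoeff_simps sum.distrib distrib_right case_prod_unfold)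
  show "a * b = b * a"
  proof (rule mseries_eqI)
    fix M
    show "mcoeff (a * b) M = mcoeff (b * a) M"
      unfolding times_mseries.rep_eq
      by (rule sum.reindex_bij_witness [where i = prod.swap and j = prod.swap])
        (auto simp: msplits_def add.commute)
  qed
  show "1 * a = a"
  proof (rule mseries_eqI)
    fix M
    have "mcoeff (1 * a) M = (\<Sum>x\<in>msplits M. mcoeff 1 (fst x) * mcoeff a (snd x))"
      by (simp add: times_mseries.rep_eq case_prod_unfold)
    also have "\<dots> = (\<Sum>x\<in>{({#}, M)}. mcoeff 1 (fst x) * mcoeff a (snd x))"
    proof (rule sum.mono_neutral_right)
      show "{({#}, M)} \<subseteq> msplits M" by (simp add: msplits_def)
      show "\<forall>x\<in>msplits M - {({#}, M)}. mcoeff 1 (fst x) * mcoeff a (snd x) = 0"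
        by (auto simp: msplits_def mcoeff_simps)
    qed simp
    finally show "mcoeff (1 * a) M = mcoeff a M" by (simp add: mcoeff_simps)
  qed
  show "a * b * c = a * (b * c)"
  proof (rule mseries_eqI)
    fix M
    have "mcoeff (a * b * c) M = (\<Sum>x\<in>msplits M. \<Sum>y\<in>msplits (fst x).
        mcoeff a (fst y) * mcoeff b (snd y) * mcoeff c (snd x))"
      by (simp add: times_mseries.rep_eq case_prod_unfold sum_distrib_right)
    also have "\<dots> = (\<Sum>z\<in>(SIGMA x:msplits M. msplits (fst x)).
        mcoeff a (fst (snd z)) * mcoeff b (snd (snd z)) * mcoeff c (snd (fst z)))"
      by (subst sum.Sigma) (simp_all add: case_prod_unfold)
    also have "\<dots> = (\<Sum>z\<in>(SIGMA x:msplits M. msplits (snd x)).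
        mcoeff a (fst (fst z)) * (mcoeff b (fst (snd z)) * mcoeff c (snd (snd z))))"
      by (rule sum.reindex_bij_witness
          [where i = "\<lambda>z. ((fst (fst z) + fst (snd z), snd (snd z)), (fst (fst z), fst (snd z)))"
            and j = "\<lambda>z. ((fst (snd z), snd (snd z) + snd (fst z)), (snd (snd z), snd (fst z)))"])
        (auto simp: msplits_def add.assoc mult.assoc)
    also have "\<dots> = (\<Sum>x\<in>msplits M. \<Sum>y\<in>msplits (snd x).
        mcoeff a (fst x) * (mcoeff b (fst y) * mcoeff c (snd y)))"
      by (subst sum.Sigma) (simp_all add: case_prod_unfold)
    also have "\<dots> = mcoeff (a * (b * c)) M"
      by (simp add: times_mseries.rep_eq case_prod_unfold sum_distrib_left)
    finally show "mcoeff (a * b * c) M = mcoeff (a * (b * c)) M" .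
  qed
qed

end

text \<open>
  The sum of the monomials \<open>wt t\<close> over the possibly infinite set \<open>X\<close>.  It is only meaningful
  when every monomial is the weight of finitely many elements of \<open>X\<close>, as is the case below.
\<close>

definition weight_series :: "'b set \<Rightarrow> ('b \<Rightarrow> nat multiset) \<Rightarrow> mseries" where
  "weight_series X wt = MSeries (\<lambda>M. int (card {t \<in> X. wt t = M}))"


section \<open>Involution words\<close>

text \<open>
  Permutations are functions on \<^typ>\<open>nat\<close> fixing \<open>0\<close> and all but finitely many numbers, so that
  every $S_n$ is the set of functions \<open>\<pi>\<close> with \<open>\<pi> permutes {1..n}\<close>.
\<close>

definition simple_refl :: "nat \<Rightarrow> nat \<Rightarrow> nat" where
  "simple_refl i = transpose i (i + 1)"

definition inv_act :: "(nat \<Rightarrow> nat) \<Rightarrow> nat \<Rightarrow> (nat \<Rightarrow> nat)" where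
  "inv_act y i =
    (if y \<circ> simple_refl i = simple_refl i \<circ> y then y \<circ> simple_refl i
     else simple_refl i \<circ> y \<circ> simple_refl i)"

definition inv_expressions :: "(nat \<Rightarrow> nat) \<Rightarrow> nat list set" where
  "inv_expressions z = {a. set a \<subseteq> {1..} \<and> foldl inv_act id a = z}"

definition inv_words :: "(nat \<Rightarrow> nat) \<Rightarrow> nat list set" where
  "inv_words z = {a \<in> inv_expressions z. \<forall>b \<in> inv_expressions z. length a \<le> length b}"

definition rel_inv_words :: "(nat \<Rightarrow> nat) \<Rightarrow> (nat \<Rightarrow> nat) \<Rightarrow> nat list set" where
  "rel_inv_words y z = {b. \<exists>a \<in> inv_words y. a @ b \<in> inv_words z}"

lemma rel_inv_words_independent:
  assumes "a \<in> inv_words y"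
  shows "b \<in> rel_inv_words y z \<longleftrightarrow> a @ b \<in> inv_words z"
proof -
  have "a' @ b \<in> inv_words z \<longleftrightarrow> a @ b \<in> inv_words z" if "a' \<in> inv_words y" for a'
  proof -
    have "length a' = length a"
      using that assms by (simp add: inv_words_def le_antisym)
    moreover have "a' @ b \<in> inv_expressions z \<longleftrightarrow> a @ b \<in> inv_expressions z"
      using that assms by (simp add: inv_words_def inv_expressions_def)
    ultimately show ?thesis
      by (simp add: inv_words_def)
  qed
  then show ?thesis
    using assms unfolding rel_inv_words_def by blast
qed

lemma inv_words_id: "inv_words id = {[]}"
proof -
  have "[] \<in> inv_expressions id" by (simp add: inv_expressions_def)
  then have "length a = 0" if "a \<in> inv_words id" for a
    using that unfolding inv_words_def by fastforce
  moreover have "[] \<in> inv_words id"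
    using \<open>[] \<in> inv_expressions id\<close> by (simp add: inv_words_def)
  ultimately show ?thesis by blast
qed

lemma rel_inv_words_id: "rel_inv_words id z = inv_words z"
  by (simp add: rel_inv_words_def inv_words_id)

text \<open>The permutation $v_n = (1,2)(3,4)\cdots(2n-1,2n)$.\<close>

definition fpf_min :: "nat \<Rightarrow> nat \<Rightarrow> nat" where
  "fpf_min n i = (if i \<in> {1..2 * n} then (if odd i then i + 1 else i - 1) else i)"

text \<open>The first argument \<open>n\<close> indicates that \<open>z\<close> is regarded as an element of $S_{2n}$.\<close>

definition fpf_inv_words :: "nat \<Rightarrow> (nat \<Rightarrow> nat) \<Rightarrow> nat list set" where
  "fpf_inv_words n z = rel_inv_words (fpf_min n) z"

text \<open>The longest permutation $w_n = [n, n-1, \ldots, 2, 1]$.\<close>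

definition longest_perm :: "nat \<Rightarrow> nat \<Rightarrow> nat" where
  "longest_perm n i = (if i \<in> {1..n} then n + 1 - i else i)"


section \<open>Involution Stanley symmetric functions\<close>

definition compatible_seqs :: "nat list \<Rightarrow> nat list set" where
  "compatible_seqs a =
    {I. length I = length a \<and> set I \<subseteq> {1..} \<and> sorted I \<and>
        (\<forall>j. Suc j < length a \<longrightarrow> a ! j < a ! Suc j \<longrightarrow> I ! j < I ! Suc j)}"

definition rel_inv_stanley :: "(nat \<Rightarrow> nat) \<Rightarrow> (nat \<Rightarrow> nat) \<Rightarrow> mseries" where
  "rel_inv_stanley y z = (\<Sum>a\<in>rel_inv_words y z. weight_series (compatible_seqs a) mset)"

definition inv_stanley :: "(nat \<Rightarrow> nat) \<Rightarrow> mseries" where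
  "inv_stanley y = rel_inv_stanley id y"

definition fpf_inv_stanley :: "nat \<Rightarrow> (nat \<Rightarrow> nat) \<Rightarrow> mseries" where
  "fpf_inv_stanley n z = rel_inv_stanley (fpf_min n) z"


section \<open>Tableaux and Schur functions\<close>

text \<open>
  A partition is the list of its parts in weakly decreasing order.  Cells are pairs (row, column),
  counted from \<open>0\<close>.
\<close>

definition diagram :: "nat list \<Rightarrow> (nat \<times> nat) set" where
  "diagram lam = {(r, c). r < length lam \<and> c < lam ! r}"

text \<open>Fillings are undefined outside of the diagram, so that tableaux can be counted.\<close>

definition ssyt :: "nat list \<Rightarrow> (nat \<times> nat \<Rightarrow> nat) set" where
  "ssyt lam = {T \<in> diagram lam \<rightarrow>\<^sub>E {1..}.
    (\<forall>r c c'. (r, c) \<in> diagram lam \<longrightarrow> (r, c') \<in> diagram lam \<longrightarrow> c < c' \<longrightarrow> T (r, c) \<le> T (r, c')) \<and>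
    (\<forall>r r' c. (r, c) \<in> diagram lam \<longrightarrow> (r', c) \<in> diagram lam \<longrightarrow> r < r' \<longrightarrow> T (r, c) < T (r', c))}"

definition syt :: "nat list \<Rightarrow> (nat \<times> nat \<Rightarrow> nat) set" where
  "syt lam = {T \<in> extensional (diagram lam).
    bij_betw T (diagram lam) {1..sum_list lam} \<and>
    (\<forall>r c c'. (r, c) \<in> diagram lam \<longrightarrow> (r, c') \<in> diagram lam \<longrightarrow> c < c' \<longrightarrow> T (r, c) < T (r, c')) \<and>
    (\<forall>r r' c. (r, c) \<in> diagram lam \<longrightarrow> (r', c) \<in> diagram lam \<longrightarrow> r < r' \<longrightarrow> T (r, c) < T (r', c))}"

definition schur :: "nat list \<Rightarrow> mseries" where
  "schur lam = weight_series (ssyt lam) (\<lambda>T. image_mset T (mset_set (diagram lam)))"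

definition num_syt :: "nat list \<Rightarrow> nat" where
  "num_syt lam = card (syt lam)"

text \<open>The staircase partition $\delta_n = (n-1, n-2, \ldots, 2, 1)$.\<close>

definition staircase :: "nat \<Rightarrow> nat list" where
  "staircase n = rev [1..<n]"

end

theory Submission
  imports Defs "HOL-Computational_Algebra.Polynomial"
begin

text \<open>
  All series are compared through their values at generic positive real points.  The descents of
  involutions in the involution weak order give operators $u_i$ on functions of involutions which
  satisfy the nil-Coxeter relations, and with $h_i(x) = 1 + x u_i$ the involution Stanley function
  is a matrix coefficient of $A(x_1) \cdots A(x_m)$, where $A = B_1$ and
  $B_k(x) = h_{N-1}(x) \cdots h_k(x)$.  By the Yang-Baxter equation $B_k(a) B_k(b)$ is the isobaric
  divided difference of $B_k(a) B_{k+1}(b)$, so this product is the isobaric symmetrization of the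
  staircase product $B_1(x_1) B_2(x_2) \cdots$.  Since the identity and the fixed-point-free
  involution $v_n$ are invariant under reflecting rows, the staircase product can be
  evaluated two rows at a time, and its coefficient at the longest element is a product of
  linear factors.  They split into a symmetric part and the Cauchy product
  $\prod_{i+j \le q} (x_i + y_j)$.  The latter is the same kind of coefficient for ordinary
  permutations; the Nakayama automorphism of the nil-Coxeter algebra turns its symmetrization
  into the Stanley function of $w_q$, which can then be pulled out, and what remains is
  the Stanley function of $w_p$ (or of $w_n$).  The same computation for 0-1-sequences, which encode
  partitions, identifies the Stanley function of $w_q$ with the Schur function of $\delta_q$.  The
  numbers of words are the coefficients of squarefree monomials.
\<close>

section \<open>The nil-Coxeter relations and the Yang-Baxter equation\<close>

text \<open>Two points carry the argument. First, a row that can be reversed next to the start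
  vector \<open>e\<close> travels through the remaining staircase, which spends one variable but two
  generators. Hence only the variables of the first half ever label a reversed row: pairs inside
  this half give a factor symmetric in it, mixed pairs give the Cauchy product, and the sizes of the
  two halves become the two staircases. For v_n the isolated factor x_i of each step is missing,
  which lowers the first staircase by one and makes the two equal. Second, the result has to be
  symmetric in all variables, whereas the factor from the first half is symmetric only there. The
  Cauchy product can be symmetrized inside the two groups of variables without disturbing that
  factor, and the Nakayama automorphism shows that the outcome is symmetric in all variables, so it
  leaves the full symmetrization as a constant. The divisions by x_i - x_j and a passage to the
  squares x_i^2 are the reason for working at points with distinct positive coordinates.\<close>

definition lin_op :: "(('s \<Rightarrow> real) \<Rightarrow> 's \<Rightarrow> real) \<Rightarrow> bool" where
  "lin_op f \<longleftrightarrow> (\<forall>a b p q. f (\<lambda>z. a * p z + b * q z) = (\<lambda>z. a * f p z + b * f q z))"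

lemma lin_opD: "lin_op f \<Longrightarrow> f (\<lambda>z. a * p z + b * q z) = (\<lambda>z. a * f p z + b * f q z)"
  by (simp add: lin_op_def)

lemma lin_op_comp: "lin_op f \<Longrightarrow> lin_op g \<Longrightarrow> lin_op (\<lambda>v. f (g v))"
  by (simp add: lin_op_def)

lemma lin_op_id: "lin_op (\<lambda>v. v)"
  by (simp add: lin_op_def)

text \<open>The row calculus is needed for two actions, on involutions and on integer sequences
  (permutations and 0-1-sequences alike); only these relations enter it.\<close>

locale nil_coxeter =
  fixes u :: "nat \<Rightarrow> ('s \<Rightarrow> real) \<Rightarrow> 's \<Rightarrow> real"
  assumes u_lin: "lin_op (u i)"
    and u_nil: "u i (u i v) = (\<lambda>z. 0)"
    and u_comm: "Suc i < j \<Longrightarrow> u i (u j v) = u j (u i v)"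
    and u_braid: "u i (u (Suc i) (u i v)) = u (Suc i) (u i (u (Suc i) v))"
begin

definition h :: "nat \<Rightarrow> real \<Rightarrow> ('s \<Rightarrow> real) \<Rightarrow> 's \<Rightarrow> real" where
  "h i x v = (\<lambda>z. v z + x * u i v z)"

lemma u_add: "u i (\<lambda>z. p z + q z) = (\<lambda>z. u i p z + u i q z)"
  using lin_opD[OF u_lin, of i 1 p 1 q] by simp

lemma u_scale: "u i (\<lambda>z. a * p z) = (\<lambda>z. a * u i p z)"
  using lin_opD[OF u_lin, of i a p 0 p] by simp

lemma u_zero: "u i (\<lambda>z. 0) = (\<lambda>z. 0)"
  using u_scale[of i 0 "\<lambda>z. 0"] by simp

lemma h_lin: "lin_op (h i x)"
  by (simp add: lin_op_def h_def u_add u_scale fun_eq_iff algebra_simps)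

lemma h_0 [simp]: "h i 0 v = v"
  by (simp add: h_def)

lemma h_h: "h i a (h i b v) = h i (a + b) v"
  by (simp add: h_def u_add u_scale u_nil fun_eq_iff algebra_simps)

lemma h_inv [simp]: "h i a (h i (- a) v) = v" "h i (- a) (h i a v) = v"
  by (simp_all add: h_h)

lemma h_comm: "Suc i < j \<Longrightarrow> h i a (h j b v) = h j b (h i a v)"
  using u_comm[of i j v] by (simp add: h_def u_add u_scale fun_eq_iff algebra_simps)

text \<open>Both sides expand alike: the nil relation removes the quadratic term with coefficient
  \<open>a * b\<close>, and the cubic terms agree by the braid relation.\<close>

lemma yang_baxter:
  "h i b (h (Suc i) (a + b) (h i a v)) = h (Suc i) a (h i (a + b) (h (Suc i) b v))"
  by (simp add: h_def u_add u_scale u_nil u_braid fun_eq_iff algebra_simps)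

text \<open>The operators act from the right on the paper's side: \<open>B c k x\<close> is the product
  $h_{k+c-1}(x) \cdots h_{k+1}(x) h_k(x)$ with the leftmost factor applied first, \<open>C c k x\<close> is the
  product of the same factors in the opposite order.\<close>

primrec B :: "nat \<Rightarrow> nat \<Rightarrow> real \<Rightarrow> ('s \<Rightarrow> real) \<Rightarrow> 's \<Rightarrow> real" where
  "B 0 k x v = v"
| "B (Suc c) k x v = h k x (B c (Suc k) x v)"

primrec C :: "nat \<Rightarrow> nat \<Rightarrow> real \<Rightarrow> ('s \<Rightarrow> real) \<Rightarrow> 's \<Rightarrow> real" where
  "C 0 k x v = v"
| "C (Suc c) k x v = C c (Suc k) x (h k x v)"

lemma B_lin: "lin_op (B c k x)"
proof (induction c arbitrary: k)
  case 0
  show ?case by (simp add: lin_op_id)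
next
  case (Suc c)
  show ?case using lin_op_comp[OF h_lin Suc] by simp
qed

lemma C_lin: "lin_op (C c k x)"
proof (induction c arbitrary: k)
  case 0
  show ?case by (simp add: lin_op_id)
next
  case (Suc c)
  show ?case using lin_op_comp[OF Suc h_lin[of k x]] by simp
qed

lemma B_C_inv [simp]: "B c k x (C c k (- x) v) = v"
  by (induction c arbitrary: k v) auto

lemma C_B_inv [simp]: "C c k (- x) (B c k x v) = v"
  by (induction c arbitrary: k v) auto

lemma C_B_inv' [simp]: "C c k x (B c k (- x) v) = v"
  using C_B_inv[of c k "- x"] by simp

lemma h_B_comm: "Suc i < k \<Longrightarrow> h i a (B c k x v) = B c k x (h i a v)"
  by (induction c arbitrary: k v) (auto simp: h_comm)

lemma h_C_comm: "Suc i < k \<Longrightarrow> h i a (C c k x v) = C c k x (h i a v)"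
  by (induction c arbitrary: k v) (auto simp: h_comm)

text \<open>Where the two rows touch, a factor with parameter \<open>x + y\<close> arises; in the
  induction one Yang-Baxter move carries it past one index. All linear factors of the later values
  come from this sum.\<close>

lemma C_then_B:
  "B (Suc c) k y (C (Suc c) k x v) = C c (Suc k) x (h k (x + y) (B c (Suc k) y v))"
proof (induction c arbitrary: k v)
  case 0
  show ?case by (simp add: h_h add.commute)
next
  case (Suc c)
  have "B (Suc (Suc c)) k y (C (Suc (Suc c)) k x v)
      = h k y (B (Suc c) (Suc k) y (C (Suc c) (Suc k) x (h k x v)))"
    by simp
  also have "\<dots> = h k y (C c (Suc (Suc k)) x (h (Suc k) (x + y) (B c (Suc (Suc k)) y (h k x v))))"
    by (simp only: Suc.IH)
  also have "\<dots> = C c (Suc (Suc k)) x (h k y (h (Suc k) (x + y) (h k x (B c (Suc (Suc k)) y v))))"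
    by (simp add: h_C_comm h_B_comm)
  also have "\<dots> = C c (Suc (Suc k)) x
      (h (Suc k) x (h k (x + y) (h (Suc k) y (B c (Suc (Suc k)) y v))))"
    by (simp only: yang_baxter)
  finally show ?case by simp
qed

lemma B_exchange:
  "B c (Suc k) x (B (Suc c) k y v) = h k (y - x) (B c (Suc k) y (B (Suc c) k x v))"
proof -
  have "B (Suc c) k y v = B (Suc c) k y (C (Suc c) k (- x) (B (Suc c) k x v))"
    by (simp only: C_B_inv)
  also have "\<dots> = C c (Suc k) (- x) (h k (y - x) (B c (Suc k) y (B (Suc c) k x v)))"
    by (simp only: C_then_B) simp
  finally show ?thesis by (simp only: B_C_inv)
qed

text \<open>By \<open>B_exchange\<close> the variables can be swapped at the price of
  \<open>h k (y - x)\<close>, and the outer factor \<open>h k x\<close> completes this to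
  \<open>h k y\<close>.\<close>

lemma B_comm: "B c k x (B c k y v) = B c k y (B c k x v)"
proof (cases c)
  case (Suc c')
  have "B c k x (B c k y v) = h k x (B c' (Suc k) x (B (Suc c') k y v))"
    by (simp add: Suc)
  also have "\<dots> = h k x (h k (y - x) (B c' (Suc k) y (B (Suc c') k x v)))"
    by (rule arg_cong[of _ _ "h k x"], rule B_exchange)
  also have "\<dots> = B c k y (B c k x v)"
    by (simp only: h_h) (simp add: Suc)
  finally show ?thesis .
qed simp

text \<open>The inverse of \<open>C c k x\<close> is \<open>B c k (- x)\<close>, so this is
  \<open>B_comm\<close> for the inverses.\<close>

lemma C_comm: "C c k x (C c k y v) = C c k y (C c k x v)"
proof -
  have "C c k x (C c k y v)
    = C c k x (C c k y (B c k (- x) (B c k (- y) (C c k y (C c k x v)))))"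
    using B_C_inv[of c k "- y"] B_C_inv[of c k "- x"] by simp
  also have "\<dots> = C c k x (C c k y (B c k (- y) (B c k (- x) (C c k y (C c k x v)))))"
    by (simp only: B_comm)
  finally show ?thesis by simp
qed

text \<open>The isobaric divided difference of $B_k(a) B_{k+1}(b)$ is $B_k(a) B_k(b)$.\<close>

lemma B_divided_difference:
  "(a - b) * B c k b (B c k a v) z
    = a * B (c - 1) (Suc k) b (B c k a v) z - b * B (c - 1) (Suc k) a (B c k b v) z"
proof (cases c)
  case 0
  then show ?thesis by (simp add: algebra_simps)
next
  case (Suc c')
  have e: "c - 1 = c'" by (simp add: Suc)
  define w where "w = B c k b (B c k a v)"
  have 1: "B c' (Suc k) b (B c k a v) = h k (- b) w"
    by (simp add: w_def Suc)
  have 2: "B c' (Suc k) a (B c k b v) = h k (- a) w"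
    unfolding w_def B_comm[of c k b a v] by (simp add: Suc)
  have "a * h k (- b) w z - b * h k (- a) w z = (a - b) * w z"
    by (simp add: h_def algebra_simps)
  then show ?thesis
    unfolding e 1 2 w_def[symmetric] by simp
qed

text \<open>Here the factor of index k is the innermost one, so leaving it out replaces v by
  \<open>h k (- b) v\<close>; after \<open>C_comm\<close> the terms with \<open>u k v\<close>
  cancel.\<close>

lemma C_divided_difference:
  "(a - b) * C c k a (C c k b v) z
    = a * C c k a (C (c - 1) (Suc k) b v) z - b * C c k b (C (c - 1) (Suc k) a v) z"
proof (cases c)
  case 0
  then show ?thesis by (simp add: algebra_simps)
next
  case (Suc c')
  have 1: "C c' (Suc k) b v = C c k b (h k (- b) v)" for b
    by (simp add: Suc)
  have lin: "lin_op (\<lambda>v. C c k a (C c k b v))"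
    by (rule lin_op_comp[OF C_lin C_lin])
  have h: "h k y v = (\<lambda>z. 1 * v z + y * u k v z)" for y
    by (simp add: h_def)
  have 2: "C c k a (C c' (Suc k) b v)
      = (\<lambda>z. 1 * C c k a (C c k b v) z + - b * C c k a (C c k b (u k v)) z)"
    unfolding 1 h by (rule lin_opD[OF lin])
  have 3: "C c k b (C c' (Suc k) a v)
      = (\<lambda>z. 1 * C c k a (C c k b v) z + - a * C c k a (C c k b (u k v)) z)"
    unfolding 1 C_comm[of c k b a] h by (rule lin_opD[OF lin])
  show ?thesis using 2 3 Suc by (simp add: algebra_simps)
qed

section \<open>Staircase products and reversed rows\<close>

context
  fixes x :: "nat \<Rightarrow> real"
begin

primrec staircase_rows :: "nat \<Rightarrow> nat \<Rightarrow> nat \<Rightarrow> ('s \<Rightarrow> real) \<Rightarrow> 's \<Rightarrow> real" where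
  "staircase_rows 0 k l v = v"
| "staircase_rows (Suc c) k l v = staircase_rows c (Suc k) (Suc l) (B (Suc c) k (x l) v)"

primrec dual_rows :: "nat \<Rightarrow> nat \<Rightarrow> nat \<Rightarrow> ('s \<Rightarrow> real) \<Rightarrow> 's \<Rightarrow> real" where
  "dual_rows 0 k l v = v"
| "dual_rows (Suc c) k l v = C (Suc c) k (x l) (dual_rows c (Suc k) (Suc l) v)"

text \<open>The trace of a reversed row with variable y that has been pushed through the staircase:
  one factor for each row it met.\<close>

primrec shifted_row :: "nat \<Rightarrow> nat \<Rightarrow> nat \<Rightarrow> real \<Rightarrow> ('s \<Rightarrow> real) \<Rightarrow> 's \<Rightarrow> real" where
  "shifted_row 0 k l y v = v"
| "shifted_row (Suc c) k l y v = shifted_row c (Suc k) (Suc l) y (h k (y + x l) v)"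

lemma h_staircase_comm:
  "Suc i < k \<Longrightarrow> h i a (staircase_rows c k l v) = staircase_rows c k l (h i a v)"
  by (induction c arbitrary: k l v) (auto simp: h_comm h_B_comm)

text \<open>The reversed row meets the staircase rows in turn. At each meeting
  \<open>C_then_B\<close> takes the lowest generator from both rows and leaves one factor of
  \<open>shifted_row\<close>, which commutes with all later rows.\<close>

lemma staircase_rows_C:
  "staircase_rows (Suc c) k l (C (Suc c) k y v)
    = shifted_row (Suc c) k l y (staircase_rows c (Suc k) l v)"
proof (induction c arbitrary: k l v)
  case 0
  show ?case by (simp add: h_h add.commute)
next
  case (Suc c)
  have "staircase_rows (Suc (Suc c)) k l (C (Suc (Suc c)) k y v)
      = staircase_rows (Suc c) (Suc k) (Suc l)
          (C (Suc c) (Suc k) y (h k (y + x l) (B (Suc c) (Suc k) (x l) v)))"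
    by (simp only: staircase_rows.simps C_then_B)
  also have "\<dots> = shifted_row (Suc c) (Suc k) (Suc l) y
      (staircase_rows c (Suc (Suc k)) (Suc l) (h k (y + x l) (B (Suc c) (Suc k) (x l) v)))"
    by (simp only: Suc.IH)
  also have "\<dots> = shifted_row (Suc c) (Suc k) (Suc l) y
      (h k (y + x l) (staircase_rows c (Suc (Suc k)) (Suc l) (B (Suc c) (Suc k) (x l) v)))"
    by (simp only: h_staircase_comm lessI)
  finally show ?case by simp
qed

lemma staircase_rows_dual_rows:
  "staircase_rows (Suc c) k l (dual_rows (Suc c) k l' v)
    = shifted_row (Suc c) k l (x l') (staircase_rows c (Suc k) l (dual_rows c (Suc k) (Suc l') v))"
  by (simp only: dual_rows.simps staircase_rows_C)

text \<open>The reversed first row is pushed through the others. Its own row is used up and the rest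
  lose their lowest generator, so the start moves from k to \<open>k + 2\<close> while the variable
  index only moves from l to \<open>Suc l\<close>. This mismatch is what halves the
  staircase.\<close>

lemma staircase_rows_reflect:
  assumes "B (Suc c) k (x l) e = C (Suc c) k (x l) e"
  shows "staircase_rows (Suc c) k l e
    = shifted_row c (Suc k) (Suc l) (x l)
        (h k (x l) (staircase_rows (c - 1) (k + 2) (Suc l) e))"
proof (cases c)
  case 0
  then show ?thesis by simp
next
  case (Suc c')
  have "staircase_rows (Suc c) k l e
      = staircase_rows c (Suc k) (Suc l) (C c (Suc k) (x l) (h k (x l) e))"
    using assms by simp
  also have "\<dots> = shifted_row c (Suc k) (Suc l) (x l)
      (staircase_rows c' (Suc (Suc k)) (Suc l) (h k (x l) e))"
    unfolding Suc by (rule staircase_rows_C)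
  finally show ?thesis by (simp add: Suc h_staircase_comm)
qed

end

end

section \<open>Isobaric symmetrization\<close>

definition pairs :: "nat \<Rightarrow> (nat \<times> nat) set" where
  "pairs m = {(i, j). 1 \<le> i \<and> i < j \<and> j \<le> m}"

lemma finite_pairs [simp]: "finite (pairs m)"
  by (rule finite_subset[of _ "{..m} \<times> {..m}"]) (auto simp: pairs_def)

definition sym_weight :: "nat \<Rightarrow> (nat \<Rightarrow> real) \<Rightarrow> real" where
  "sym_weight m x = (\<Prod>(i, j)\<in>pairs m. x i / (x i - x j))"

text \<open>The isobaric symmetrization; on polynomials it is the Demazure operator of the longest
  element of $S_m$.\<close>

definition symz :: "nat \<Rightarrow> ((nat \<Rightarrow> real) \<Rightarrow> real) \<Rightarrow> (nat \<Rightarrow> real) \<Rightarrow> real" where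
  "symz m G x = (\<Sum>\<sigma>\<in>{\<sigma>. \<sigma> permutes {1..m}}. sym_weight m (x \<circ> \<sigma>) * G (x \<circ> \<sigma>))"

lemma symz_cong: "(\<And>\<sigma>. \<sigma> permutes {1..m} \<Longrightarrow> G (x \<circ> \<sigma>) = H (x \<circ> \<sigma>)) \<Longrightarrow> symz m G x = symz m H x"
  unfolding symz_def by (intro sum.cong) auto

lemma symz_mult_sym:
  assumes "\<And>\<sigma>. \<sigma> permutes {1..m} \<Longrightarrow> P (x \<circ> \<sigma>) = P x"
  shows "symz m (\<lambda>x. P x * G x) x = P x * symz m G x"
  unfolding symz_def sum_distrib_left by (intro sum.cong) (auto simp: assms)

lemma prod_pairs_swap:
  fixes f :: "nat \<Rightarrow> nat \<Rightarrow> real"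
  assumes "1 \<le> j" "j < m"
  shows "(\<Prod>(a, b)\<in>pairs m - {(j, Suc j)}.
      f (transpose j (Suc j) a) (transpose j (Suc j) b)) = (\<Prod>(a, b)\<in>pairs m - {(j, Suc j)}. f a b)"
  by (rule prod.reindex_bij_witness
      [where i = "\<lambda>(a, b). (transpose j (Suc j) a, transpose j (Suc j) b)"
        and j = "\<lambda>(a, b). (transpose j (Suc j) a, transpose j (Suc j) b)"])
    (use assms in \<open>auto simp: pairs_def transpose_def split: if_splits\<close>)

text \<open>Reindex the second summand of \<open>G'\<close> by the transposition of j and j + 1.
  With a, b the values at these places, the weight of G is then multiplied by a / (a - b) - b / (a -
  b) = 1.\<close>

lemma symz_divided_difference:
  assumes j: "1 \<le> j" "j < m" and inj: "inj_on x {1..m}"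
    and G': "\<And>x. (x j - x (Suc j)) * G' x = x j * G x - x (Suc j) * G (x \<circ> transpose j (Suc j))"
  shows "symz m G' x = symz m G x"
proof -
  let ?s = "transpose j (Suc j)"
  let ?S = "{\<sigma>. \<sigma> permutes {1..m}}"
  have s: "?s permutes {1..m}"
    using j by (intro permutes_swap_id) auto
  define W' where "W' x = (\<Prod>(a, b)\<in>pairs m - {(j, Suc j)}. x a / (x a - x b))"
    for x :: "nat \<Rightarrow> real"
  have W: "sym_weight m x = x j / (x j - x (Suc j)) * W' x" for x
    unfolding sym_weight_def W'_def
    by (subst prod.remove[of _ "(j, Suc j)"]) (use j in \<open>simp_all add: pairs_def[of m, THEN eqset_imp_iff]\<close>)
  have W's: "W' (x \<circ> ?s) = W' x" for x
    unfolding W'_def o_def using prod_pairs_swap[OF j, of "\<lambda>a b. x a / (x a - x b)"] by simp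
  have ne: "x (\<sigma> j) \<noteq> x (\<sigma> (Suc j))" if "\<sigma> permutes {1..m}" for \<sigma>
  proof
    assume "x (\<sigma> j) = x (\<sigma> (Suc j))"
    then have "\<sigma> j = \<sigma> (Suc j)"
      using j permutes_in_image[OF that, of j] permutes_in_image[OF that, of "Suc j"]
      by (intro inj_onD[OF inj]) auto
    then show False
      using injD[OF permutes_inj[OF that], of j "Suc j"] by simp
  qed
  define F where "F \<sigma> = sym_weight m (x \<circ> \<sigma>) * (x (\<sigma> (Suc j)) / (x (\<sigma> j) - x (\<sigma> (Suc j))))
      * G (x \<circ> \<sigma> \<circ> ?s)" for \<sigma>
  have "symz m G' x = (\<Sum>\<sigma>\<in>?S. sym_weight m (x \<circ> \<sigma>) *
      (x (\<sigma> j) / (x (\<sigma> j) - x (\<sigma> (Suc j)))) * G (x \<circ> \<sigma>) - F \<sigma>)"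
    unfolding symz_def
  proof (intro sum.cong refl)
    fix \<sigma> assume "\<sigma> \<in> ?S"
    then have n: "x (\<sigma> j) - x (\<sigma> (Suc j)) \<noteq> 0" using ne by simp
    have E: "G' (x \<circ> \<sigma>) = (x (\<sigma> j) * G (x \<circ> \<sigma>) - x (\<sigma> (Suc j)) * G (x \<circ> \<sigma> \<circ> ?s))
        / (x (\<sigma> j) - x (\<sigma> (Suc j)))"
      using G'[of "x \<circ> \<sigma>"] n by (simp add: field_simps)
    show "sym_weight m (x \<circ> \<sigma>) * G' (x \<circ> \<sigma>) = sym_weight m (x \<circ> \<sigma>) *
      (x (\<sigma> j) / (x (\<sigma> j) - x (\<sigma> (Suc j)))) * G (x \<circ> \<sigma>) - F \<sigma>"
      unfolding F_def E by (simp add: diff_divide_distrib right_diff_distrib mult_ac)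
  qed
  also have "\<dots> = (\<Sum>\<sigma>\<in>?S. sym_weight m (x \<circ> \<sigma>) *
      (x (\<sigma> j) / (x (\<sigma> j) - x (\<sigma> (Suc j)))) * G (x \<circ> \<sigma>)) - (\<Sum>\<sigma>\<in>?S. F \<sigma>)"
    by (rule sum_subtractf)
  also have "(\<Sum>\<sigma>\<in>?S. F \<sigma>) = (\<Sum>\<sigma>\<in>?S. F (\<sigma> \<circ> ?s))"
    by (rule sum_permutations_compose_right[OF s])
  also have "(\<Sum>\<sigma>\<in>?S. sym_weight m (x \<circ> \<sigma>) *
      (x (\<sigma> j) / (x (\<sigma> j) - x (\<sigma> (Suc j)))) * G (x \<circ> \<sigma>)) - \<dots> = symz m G x"
    unfolding symz_def sum_subtractf[symmetric]
  proof (intro sum.cong refl)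
    fix \<sigma> assume "\<sigma> \<in> ?S"
    then have n: "x (\<sigma> j) - x (\<sigma> (Suc j)) \<noteq> 0" using ne by simp
    have ss: "x \<circ> (\<sigma> \<circ> ?s) \<circ> ?s = x \<circ> \<sigma>"
      by (simp add: o_assoc[symmetric])
    have W1: "sym_weight m (x \<circ> \<sigma>) = x (\<sigma> j) / (x (\<sigma> j) - x (\<sigma> (Suc j))) * W' (x \<circ> \<sigma>)"
      by (simp add: W)
    have W2: "sym_weight m (x \<circ> (\<sigma> \<circ> ?s))
        = x (\<sigma> (Suc j)) / (x (\<sigma> (Suc j)) - x (\<sigma> j)) * W' (x \<circ> \<sigma>)"
      unfolding o_assoc W W's by simp
    have frac: "a / c * w * (a / c) * g - b / - c * w * (a / - c) * g = a / c * w * g"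
      if "c \<noteq> 0" "c = a - b" for a b c w g :: real
    proof -
      have "a / c * w * (a / c) * g - b / - c * w * (a / - c) * g = (a - b) / c * (a / c * w * g)"
        by (simp add: diff_divide_distrib left_diff_distrib right_diff_distrib mult_ac)
      then show ?thesis using that by simp
    qed
    have mc: "x (\<sigma> (Suc j)) - x (\<sigma> j) = - (x (\<sigma> j) - x (\<sigma> (Suc j)))" by simp
    show "sym_weight m (x \<circ> \<sigma>) * (x (\<sigma> j) / (x (\<sigma> j) - x (\<sigma> (Suc j)))) * G (x \<circ> \<sigma>)
        - F (\<sigma> \<circ> ?s) = sym_weight m (x \<circ> \<sigma>) * G (x \<circ> \<sigma>)"
      unfolding F_def ss W2 W1 using frac[OF n refl, of "W' (x \<circ> \<sigma>)" "G (x \<circ> \<sigma>)"]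
      by (simp only: o_apply transpose_apply_first transpose_apply_second mc)
  qed
  finally show ?thesis .
qed

text \<open>Lagrange interpolation of the constant 1 at the nodes \<open>x a\<close>, evaluated at
  0: the error q has degree below \<open>card A\<close> but \<open>card A\<close> zeros.\<close>

lemma lagrange_at_0:
  fixes x :: "nat \<Rightarrow> real"
  assumes "finite A" "A \<noteq> {}" "inj_on x A"
  shows "(\<Sum>b\<in>A. \<Prod>a\<in>A - {b}. x a / (x a - x b)) = 1"
proof -
  define q where "q = (\<Sum>b\<in>A. smult (1 / (\<Prod>a\<in>A - {b}. x b - x a)) (\<Prod>a\<in>A - {b}. [:- x a, 1:])) - 1"
  have ne: "(\<Prod>a\<in>A - {b}. x b - x a) \<noteq> 0" if "b \<in> A" for b
    using that assms by (auto simp: inj_on_def)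
  have "poly q (x c) = 0" if c: "c \<in> A" for c
  proof -
    have "poly q (x c) = (\<Sum>b\<in>A. 1 / (\<Prod>a\<in>A - {b}. x b - x a) * (\<Prod>a\<in>A - {b}. x c - x a)) - 1"
      by (simp add: q_def poly_sum poly_prod)
    also have "(\<Sum>b\<in>A. 1 / (\<Prod>a\<in>A - {b}. x b - x a) * (\<Prod>a\<in>A - {b}. x c - x a))
        = (\<Sum>b\<in>A. if b = c then 1 else 0)"
    proof (intro sum.cong refl)
      fix b assume "b \<in> A"
      then show "1 / (\<Prod>a\<in>A - {b}. x b - x a) * (\<Prod>a\<in>A - {b}. x c - x a) = (if b = c then 1 else 0)"
        using ne[of b] c assms(1) by (auto simp: prod_zero_iff)
    qed
    finally show ?thesis using assms(1) c by simp
  qed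
  then have sub: "x ` A \<subseteq> {t. poly q t = 0}" by auto
  have deg: "degree q \<le> card A - 1"
    unfolding q_def
  proof (intro degree_diff_le degree_sum_le assms(1))
    fix b assume "b \<in> A"
    have "degree (\<Prod>a\<in>A - {b}. [:- x a, 1:]) \<le> sum (degree \<circ> (\<lambda>a. [:- x a, 1:])) (A - {b})"
      by (rule degree_prod_sum_le) (use assms(1) in auto)
    also have "\<dots> = card A - 1"
      using \<open>b \<in> A\<close> assms(1) by simp
    finally show "degree (smult (1 / (\<Prod>a\<in>A - {b}. x b - x a)) (\<Prod>a\<in>A - {b}. [:- x a, 1:])) \<le> card A - 1"
      by (meson degree_smult_le le_trans)
  qed simp
  have "q = 0"
  proof (rule ccontr)
    assume "q \<noteq> 0"
    then have "card (x ` A) \<le> degree q"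
      using card_mono[OF poly_roots_finite sub] card_poly_roots_bound[of q] by fastforce
    moreover have "card (x ` A) = card A" by (rule card_image[OF assms(3)])
    moreover have "card A > 0" using assms by (simp add: card_gt_0_iff)
    ultimately show False using deg by simp
  qed
  then have "poly q 0 = 0" by simp
  then have "(\<Sum>b\<in>A. 1 / (\<Prod>a\<in>A - {b}. x b - x a) * (\<Prod>a\<in>A - {b}. - x a)) = 1"
    by (simp add: q_def poly_sum poly_prod)
  moreover have "1 / (\<Prod>a\<in>A - {b}. x b - x a) * (\<Prod>a\<in>A - {b}. - x a)
      = (\<Prod>a\<in>A - {b}. x a / (x a - x b))" for b
  proof -
    have "1 / (\<Prod>a\<in>A - {b}. x b - x a) * (\<Prod>a\<in>A - {b}. - x a)
        = (\<Prod>a\<in>A - {b}. - x a / (x b - x a))"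
      by (simp only: prod_dividef times_divide_eq_left mult_1_left)
    also have "\<dots> = (\<Prod>a\<in>A - {b}. x a / (x a - x b))"
    proof (rule prod.cong[OF refl])
      fix a
      have "- x a / (x b - x a) = - x a / - (x a - x b)" by simp
      also have "\<dots> = x a / (x a - x b)" by (rule minus_divide_divide)
      finally show "- x a / (x b - x a) = x a / (x a - x b)" .
    qed
    finally show ?thesis .
  qed
  ultimately show ?thesis by simp
qed

lemma sym_weight_Suc:
  "sym_weight (Suc m) x = sym_weight m x * (\<Prod>i\<in>{1..m}. x i / (x i - x (Suc m)))"
proof -
  have "pairs (Suc m) = pairs m \<union> (\<lambda>i. (i, Suc m)) ` {1..m}"
    by (auto simp: pairs_def)
  moreover have "pairs m \<inter> (\<lambda>i. (i, Suc m)) ` {1..m} = {}"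
    by (auto simp: pairs_def)
  ultimately show ?thesis
    unfolding sym_weight_def by (simp add: prod.union_disjoint prod.reindex inj_on_def)
qed

text \<open>This normalization makes \<open>symz\<close> fix symmetric functions. Sorting the
  permutations by the image b of \<open>Suc m\<close>, the inner sums are instances for m, and the
  outer sum is \<open>lagrange_at_0\<close>.\<close>

lemma symz_one:
  assumes "inj_on x {1..m}"
  shows "symz m (\<lambda>_. 1) x = 1"
  using assms
proof (induction m arbitrary: x)
  case 0
  have "pairs 0 = {}" by (auto simp: pairs_def)
  then show ?case by (simp add: symz_def sym_weight_def)
next
  case (Suc m)
  have ins: "{1..Suc m} = insert (Suc m) {1..m}" by auto
  have "symz (Suc m) (\<lambda>_. 1) x = (\<Sum>b\<in>{1..Suc m}. \<Sum>q\<in>{q. q permutes {1..m}}.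
      sym_weight (Suc m) (x \<circ> (transpose (Suc m) b \<circ> q)))"
    unfolding symz_def ins by (subst sum_over_permutations_insert) auto
  also have "\<dots> = (\<Sum>b\<in>{1..Suc m}. \<Prod>a\<in>{1..Suc m} - {b}. x a / (x a - x b))"
  proof (rule sum.cong[OF refl])
    fix b assume b: "b \<in> {1..Suc m}"
    let ?t = "transpose (Suc m) b"
    have "(\<Sum>q\<in>{q. q permutes {1..m}}. sym_weight (Suc m) (x \<circ> (?t \<circ> q)))
        = (\<Sum>q\<in>{q. q permutes {1..m}}. (\<Prod>a\<in>{1..Suc m} - {b}. x a / (x a - x b))
            * sym_weight m (x \<circ> ?t \<circ> q))"
    proof (rule sum.cong[OF refl])
      fix q assume "q \<in> {q. q permutes {1..m}}"
      then have q: "q permutes {1..m}" by simp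
      have qS: "q (Suc m) = Suc m" using q by (auto simp: permutes_def)
      have bij: "bij_betw (\<lambda>i. ?t (q i)) {1..m} ({1..Suc m} - {b})"
      proof -
        have "bij_betw ?t {1..m} ({1..Suc m} - {b})"
          by (rule bij_betwI[of _ _ _ ?t]) (use b in \<open>auto simp: transpose_def\<close>)
        from bij_betw_trans[OF permutes_imp_bij[OF q] this] show ?thesis by (simp add: o_def)
      qed
      have "(\<Prod>a\<in>{1..Suc m} - {b}. x a / (x a - x b))
          = (\<Prod>i\<in>{1..m}. x (?t (q i)) / (x (?t (q i)) - x b))"
        by (rule prod.reindex_bij_betw[OF bij, symmetric])
      then show "sym_weight (Suc m) (x \<circ> (?t \<circ> q))
          = (\<Prod>a\<in>{1..Suc m} - {b}. x a / (x a - x b)) * sym_weight m (x \<circ> ?t \<circ> q)"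
        by (simp add: sym_weight_Suc qS o_assoc)
    qed
    also have "\<dots> = (\<Prod>a\<in>{1..Suc m} - {b}. x a / (x a - x b)) * symz m (\<lambda>_. 1) (x \<circ> ?t)"
      by (simp add: symz_def sum_distrib_left)
    also have "symz m (\<lambda>_. 1) (x \<circ> ?t) = 1"
    proof (rule Suc.IH)
      have "inj_on ?t {1..m}" by (rule inj_on_subset[OF inj_transpose]) simp
      moreover have "?t ` {1..m} \<subseteq> {1..Suc m}" using b by (auto simp: transpose_def)
      ultimately show "inj_on (x \<circ> ?t) {1..m}"
        using Suc.prems by (meson comp_inj_on inj_on_subset)
    qed
    finally show "(\<Sum>q\<in>{q. q permutes {1..m}}. sym_weight (Suc m) (x \<circ> (?t \<circ> q)))
        = (\<Prod>a\<in>{1..Suc m} - {b}. x a / (x a - x b))" by (simp only: mult_1_right)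
  qed
  also have "\<dots> = 1"
    by (rule lagrange_at_0) (use Suc.prems in auto)
  finally show ?case .
qed

text \<open>Lower single entries as long as some step rises. When none does, r starts at its minimum
  k and can never leave it. Abstracting \<open>val\<close> separates this from the
  symmetrization.\<close>

lemma lower_rows:
  fixes val :: "(nat \<Rightarrow> nat) \<Rightarrow> 'a"
  assumes step: "\<And>r j. a \<le> j \<Longrightarrow> j < b \<Longrightarrow> r (Suc j) = Suc (r j) \<Longrightarrow> val (r(Suc j := r j)) = val r"
    and "r a = k" "\<And>j. a \<le> j \<Longrightarrow> j < b \<Longrightarrow> r (Suc j) \<le> Suc (r j)"
    and "\<And>j. a \<le> j \<Longrightarrow> j \<le> b \<Longrightarrow> k \<le> r j"
  shows "val (\<lambda>j. if a \<le> j \<and> j \<le> b then k else r j) = val r"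
  using assms(2-4)
proof (induction "\<Sum>j\<in>{a..b}. r j" arbitrary: r rule: less_induct)
  case less
  let ?J = "{j. a \<le> j \<and> j < b \<and> r (Suc j) = Suc (r j)}"
  show ?case
  proof (cases "?J = {}")
    case True
    have "r j = k" if "a \<le> j" "j \<le> b" for j
      using that
    proof (induction j rule: dec_induct)
      case base
      show ?case by (rule less.prems(1))
    next
      case (step i)
      then have "r (Suc i) \<noteq> Suc (r i)" "r (Suc i) \<le> Suc (r i)" "k \<le> r (Suc i)" "r i = k"
        using True less.prems by auto
      then show ?case by simp
    qed
    then have "(\<lambda>j. if a \<le> j \<and> j \<le> b then k else r j) = r" by auto
    then show ?thesis by simp
  next
    case False
    \<comment> \<open>Taking the last rise preserves the bound on steps: the entry after
      \<open>Suc j\<close> does not exceed \<open>r (Suc j)\<close>, which is one more than the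
      lowered entry.\<close>
    define j where "j = Max ?J"
    have fin: "finite ?J" by simp
    have j: "a \<le> j" "j < b" "r (Suc j) = Suc (r j)"
      using Max_in[OF fin False] by (auto simp: j_def)
    have jmax: "i \<le> j" if "a \<le> i" "i < b" "r (Suc i) = Suc (r i)" for i
      unfolding j_def by (rule Max_ge[OF fin]) (use that in simp)
    let ?r = "r(Suc j := r j)"
    have "(\<Sum>i\<in>{a..b}. ?r i) < (\<Sum>i\<in>{a..b}. r i)"
      by (rule sum_strict_mono_ex1) (use j in \<open>auto intro!: bexI[of _ "Suc j"]\<close>)
    then have "val (\<lambda>j. if a \<le> j \<and> j \<le> b then k else ?r j) = val ?r"
    proof (rule less.hyps)
      show "?r a = k" using less.prems(1) j by auto
      show "?r (Suc i) \<le> Suc (?r i)" if "a \<le> i" "i < b" for i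
      proof (cases "i = Suc j")
        case True
        have "r (Suc i) \<noteq> Suc (r i)" using jmax[OF that] True by auto
        with less.prems(2)[OF that] True j show ?thesis by simp
      next
        case False
        with less.prems(2)[OF that] j show ?thesis by auto
      qed
      show "k \<le> ?r i" if "a \<le> i" "i \<le> b" for i
        using less.prems(3)[OF that] less.prems(3)[of j] j by auto
    qed
    moreover have "(\<lambda>j. if a \<le> j \<and> j \<le> b then k else ?r j) = (\<lambda>j. if a \<le> j \<and> j \<le> b then k else r j)"
      using j by auto
    ultimately show ?thesis using step[OF j] by simp
  qed
qed

text \<open>Lowering row j + 1 to the start of row j is an isobaric divided difference in the
  variables j and j + 1, and these are invisible to \<open>symz\<close>.\<close>

lemma symz_lower_rows:
  fixes G :: "(nat \<Rightarrow> nat) \<Rightarrow> (nat \<Rightarrow> real) \<Rightarrow> real"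
  assumes ab: "1 \<le> a" "b \<le> m" and inj: "inj_on x {1..m}"
    and dd: "\<And>r j x. a \<le> j \<Longrightarrow> j < b \<Longrightarrow> r (Suc j) = Suc (r j) \<Longrightarrow>
      (x j - x (Suc j)) * G (r(Suc j := r j)) x
        = x j * G r x - x (Suc j) * G r (x \<circ> transpose j (Suc j))"
    and r: "r a = k" "\<And>j. a \<le> j \<Longrightarrow> j < b \<Longrightarrow> r (Suc j) \<le> Suc (r j)"
      "\<And>j. a \<le> j \<Longrightarrow> j \<le> b \<Longrightarrow> k \<le> r j"
  shows "symz m (G (\<lambda>j. if a \<le> j \<and> j \<le> b then k else r j)) x = symz m (G r) x"
proof (rule lower_rows[where val = "\<lambda>r. symz m (G r) x"])
  fix r j assume j: "a \<le> j" "j < b" "r (Suc j) = Suc (r j)"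
  show "symz m (G (r(Suc j := r j))) x = symz m (G r) x"
    by (rule symz_divided_difference[where j = j]) (use ab j inj dd[OF j] in auto)
qed (use r in auto)

section \<open>Products of rows with arbitrary starting generators\<close>

context nil_coxeter
begin

text \<open>Row j uses the generators from \<open>r j\<close> to \<open>N - 1\<close>. By truncated
  subtraction it is trivial if \<open>N \<le> r j\<close>, so a staircase can be padded with surplus
  variables.\<close>

definition brows :: "nat \<Rightarrow> (nat \<Rightarrow> nat) \<Rightarrow> (nat \<Rightarrow> real) \<Rightarrow> nat list \<Rightarrow> ('s \<Rightarrow> real) \<Rightarrow> 's \<Rightarrow> real" where
  "brows N r x js = fold (\<lambda>j. B (N - r j) (r j) (x j)) js"

definition crows :: "nat \<Rightarrow> (nat \<Rightarrow> nat) \<Rightarrow> (nat \<Rightarrow> real) \<Rightarrow> nat list \<Rightarrow> ('s \<Rightarrow> real) \<Rightarrow> 's \<Rightarrow> real" where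
  "crows N r x js = foldr (\<lambda>j. C (N - r j) (r j) (x j)) js"

lemma brows_Nil [simp]: "brows N r x [] v = v"
  by (simp add: brows_def)

lemma brows_Cons [simp]: "brows N r x (j # js) v = brows N r x js (B (N - r j) (r j) (x j) v)"
  by (simp add: brows_def)

lemma brows_append: "brows N r x (is @ js) v = brows N r x js (brows N r x is v)"
  by (simp add: brows_def)

lemma crows_Nil [simp]: "crows N r x [] v = v"
  by (simp add: crows_def)

lemma crows_Cons [simp]: "crows N r x (j # js) v = C (N - r j) (r j) (x j) (crows N r x js v)"
  by (simp add: crows_def)

lemma crows_append: "crows N r x (is @ js) v = crows N r x is (crows N r x js v)"
  by (simp add: crows_def)

lemma brows_cong:
  "(\<And>j. j \<in> set js \<Longrightarrow> r j = r' j \<and> x j = x' j) \<Longrightarrow> brows N r x js v = brows N r' x' js v"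
  unfolding brows_def by (intro fold_cong) auto

lemma crows_cong:
  "(\<And>j. j \<in> set js \<Longrightarrow> r j = r' j \<and> x j = x' j) \<Longrightarrow> crows N r x js v = crows N r' x' js v"
  unfolding crows_def by (intro foldr_cong) auto

lemma brows_lin: "lin_op (brows N r x js)"
proof (induction js)
  case Nil
  then show ?case by (simp add: lin_op_def)
next
  case (Cons j js)
  show ?case using lin_op_comp[OF Cons B_lin] by (simp add: lin_op_def)
qed

lemma crows_lin: "lin_op (crows N r x js)"
proof (induction js)
  case Nil
  then show ?case by (simp add: lin_op_def)
next
  case (Cons j js)
  show ?case using lin_op_comp[OF C_lin Cons] by (simp add: lin_op_def)
qed

lemma upt_split_pair:
  "a \<le> j \<Longrightarrow> Suc j < b \<Longrightarrow> [a..<b] = [a..<j] @ j # Suc j # [Suc (Suc j)..<b]"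
  by (metis Suc_lessD le_Suc_ex less_imp_le_nat upt_add_eq_append upt_conv_Cons)

lemma brows_divided_difference:
  assumes j: "a \<le> j" "Suc j < b" and r: "r (Suc j) = Suc (r j)"
  shows "(x j - x (Suc j)) * brows N (r(Suc j := r j)) x [a..<b] v z
    = x j * brows N r x [a..<b] v z
      - x (Suc j) * brows N r (x \<circ> transpose j (Suc j)) [a..<b] v z"
proof -
  let ?r = "r(Suc j := r j)" and ?y = "x \<circ> transpose j (Suc j)"
  define T where "T = brows N r x [Suc (Suc j)..<b]"
  define w where "w = brows N r x [a..<j] v"
  let ?B = "\<lambda>k x. B (N - k) k x"
  have c: "N - r j - 1 = N - Suc (r j)" by simp
  have post: "brows N ?r x [Suc (Suc j)..<b] = T" "brows N r ?y [Suc (Suc j)..<b] = T"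
    unfolding T_def by (intro ext brows_cong; auto simp: transpose_def)+
  have pre: "brows N ?r x [a..<j] v = w" "brows N r ?y [a..<j] v = w"
    unfolding w_def by (intro brows_cong; auto simp: transpose_def)+
  have 1: "brows N ?r x [a..<b] v = T (?B (r j) (x (Suc j)) (?B (r j) (x j) w))"
    unfolding upt_split_pair[OF j] brows_append brows_Cons pre post by simp
  have 2: "brows N r x [a..<b] v = T (?B (Suc (r j)) (x (Suc j)) (?B (r j) (x j) w))"
    unfolding upt_split_pair[OF j] brows_append brows_Cons w_def[symmetric] T_def[symmetric] r by simp
  have 3: "brows N r ?y [a..<b] v = T (?B (Suc (r j)) (x j) (?B (r j) (x (Suc j)) w))"
    unfolding upt_split_pair[OF j] brows_append brows_Cons pre post r by simp
  \<comment> \<open>The summand with coefficient 0 gives both sides the two-term shape to which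
    \<open>lin_opD\<close> for T applies.\<close>
  have "(\<lambda>z. (x j - x (Suc j)) * ?B (r j) (x (Suc j)) (?B (r j) (x j) w) z + 0 * w z)
    = (\<lambda>z. x j * ?B (Suc (r j)) (x (Suc j)) (?B (r j) (x j) w) z
        + - x (Suc j) * ?B (Suc (r j)) (x j) (?B (r j) (x (Suc j)) w) z)"
    using B_divided_difference[of "x j" "x (Suc j)" "N - r j" "r j" w] unfolding c by simp
  from arg_cong[OF this, of T] show ?thesis
    unfolding 1 2 3 lin_opD[OF brows_lin[of N r x "[Suc (Suc j)..<b]", folded T_def]]
    by (simp add: fun_eq_iff)
qed

lemma crows_divided_difference:
  assumes j: "a \<le> j" "Suc j < b" and r: "r (Suc j) = Suc (r j)"
  shows "(x j - x (Suc j)) * crows N (r(Suc j := r j)) x [a..<b] v z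
    = x j * crows N r x [a..<b] v z
      - x (Suc j) * crows N r (x \<circ> transpose j (Suc j)) [a..<b] v z"
proof -
  let ?r = "r(Suc j := r j)" and ?y = "x \<circ> transpose j (Suc j)"
  define T where "T = crows N r x [a..<j]"
  define w where "w = crows N r x [Suc (Suc j)..<b] v"
  let ?C = "\<lambda>k x. C (N - k) k x"
  have c: "N - r j - 1 = N - Suc (r j)" by simp
  have post: "crows N ?r x [Suc (Suc j)..<b] v = w" "crows N r ?y [Suc (Suc j)..<b] v = w"
    unfolding w_def by (intro crows_cong; auto simp: transpose_def)+
  have pre: "crows N ?r x [a..<j] = T" "crows N r ?y [a..<j] = T"
    unfolding T_def by (intro ext crows_cong; auto simp: transpose_def)+
  have 1: "crows N ?r x [a..<b] v = T (?C (r j) (x j) (?C (r j) (x (Suc j)) w))"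
    unfolding upt_split_pair[OF j] crows_append crows_Cons pre post by simp
  have 2: "crows N r x [a..<b] v = T (?C (r j) (x j) (?C (Suc (r j)) (x (Suc j)) w))"
    unfolding upt_split_pair[OF j] crows_append crows_Cons w_def[symmetric] T_def[symmetric] r by simp
  have 3: "crows N r ?y [a..<b] v = T (?C (r j) (x (Suc j)) (?C (Suc (r j)) (x j) w))"
    unfolding upt_split_pair[OF j] crows_append crows_Cons pre post r by simp
  have "(\<lambda>z. (x j - x (Suc j)) * ?C (r j) (x j) (?C (r j) (x (Suc j)) w) z + 0 * w z)
    = (\<lambda>z. x j * ?C (r j) (x j) (?C (Suc (r j)) (x (Suc j)) w) z
        + - x (Suc j) * ?C (r j) (x (Suc j)) (?C (Suc (r j)) (x j) w) z)"
    using C_divided_difference[of "x j" "x (Suc j)" "N - r j" "r j" w] unfolding c by simp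
  from arg_cong[OF this, of T] show ?thesis
    unfolding 1 2 3 lin_opD[OF crows_lin[of N r x "[a..<j]", folded T_def]]
    by (simp add: fun_eq_iff)
qed

lemma brows_permute:
  assumes "\<sigma> permutes {1..m}"
  shows "brows N (\<lambda>_. k) (x \<circ> \<sigma>) [1..<Suc m] v = brows N (\<lambda>_. k) x [1..<Suc m] v"
proof -
  have "image_mset \<sigma> (mset [1..<Suc m]) = mset [1..<Suc m]"
    using assms
    by (simp add: mset_upt atLeastLessThanSuc_atLeastAtMost image_mset_mset_set
        permutes_inj_on permutes_image del: upt_Suc)
  then have "mset (map (x \<circ> \<sigma>) [1..<Suc m]) = mset (map x [1..<Suc m])"
    by (metis mset_map multiset.map_comp)
  then have "fold (B (N - k) k) (map (x \<circ> \<sigma>) [1..<Suc m]) = fold (B (N - k) k) (map x [1..<Suc m])"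
    by (rule fold_multiset_equiv[rotated]) (auto simp: fun_eq_iff intro: fun_cong[OF B_comm])
  then show ?thesis
    by (simp add: brows_def fold_map o_def del: upt_Suc)
qed

text \<open>The factor P and the start vector w may depend on the variables: being invariant under
  the swaps inside the block from a to b, they are constants for the divided differences used
  there.\<close>

lemma symz_brows:
  assumes "1 \<le> a" "b \<le> m" "c \<le> a" "b < d" and inj: "inj_on x {1..m}"
    and P: "\<And>j x. a \<le> j \<Longrightarrow> j < b \<Longrightarrow> P (x \<circ> transpose j (Suc j)) = P x"
    and w: "\<And>j x. a \<le> j \<Longrightarrow> j < b \<Longrightarrow> w (x \<circ> transpose j (Suc j)) = w x"
    and r: "r a = k" "\<And>j. a \<le> j \<Longrightarrow> j < b \<Longrightarrow> r (Suc j) \<le> Suc (r j)"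
      "\<And>j. a \<le> j \<Longrightarrow> j \<le> b \<Longrightarrow> k \<le> r j"
  shows "symz m (\<lambda>x. P x * brows N (\<lambda>j. if a \<le> j \<and> j \<le> b then k else r j) x [c..<d] (w x) z) x
    = symz m (\<lambda>x. P x * brows N r x [c..<d] (w x) z) x"
proof (rule symz_lower_rows[where G = "\<lambda>r x. P x * brows N r x [c..<d] (w x) z", OF assms(1,2) inj _ r])
  fix r :: "nat \<Rightarrow> nat" and j and x :: "nat \<Rightarrow> real"
  assume j: "a \<le> j" "j < b" "r (Suc j) = Suc (r j)"
  show "(x j - x (Suc j)) * (P x * brows N (r(Suc j := r j)) x [c..<d] (w x) z)
      = x j * (P x * brows N r x [c..<d] (w x) z) - x (Suc j) * (P (x \<circ> transpose j (Suc j))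
        * brows N r (x \<circ> transpose j (Suc j)) [c..<d] (w (x \<circ> transpose j (Suc j))) z)"
    using arg_cong[OF brows_divided_difference[of c j d r x N "w x" z], of "\<lambda>t. P x * t"] j assms(3,4)
    unfolding P[OF j(1,2)] w[OF j(1,2)] by (simp add: algebra_simps)
qed

text \<open>As \<open>symz_brows\<close>, for reversed rows. Further operators are applied after
  them, collected in \<open>T x\<close>; linearity carries the divided differences through
  it.\<close>

lemma symz_crows:
  assumes "1 \<le> a" "b \<le> m" "c \<le> a" "b < d" and inj: "inj_on x {1..m}"
    and P: "\<And>j x. a \<le> j \<Longrightarrow> j < b \<Longrightarrow> P (x \<circ> transpose j (Suc j)) = P x"
    and T: "\<And>j x. a \<le> j \<Longrightarrow> j < b \<Longrightarrow> T (x \<circ> transpose j (Suc j)) = T x"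
      "\<And>x. lin_op (T x)"
    and r: "r a = k" "\<And>j. a \<le> j \<Longrightarrow> j < b \<Longrightarrow> r (Suc j) \<le> Suc (r j)"
      "\<And>j. a \<le> j \<Longrightarrow> j \<le> b \<Longrightarrow> k \<le> r j"
  shows "symz m (\<lambda>x. P x * T x (crows N (\<lambda>j. if a \<le> j \<and> j \<le> b then k else r j) x [c..<d] v) z) x
    = symz m (\<lambda>x. P x * T x (crows N r x [c..<d] v) z) x"
proof (rule symz_lower_rows[where G = "\<lambda>r x. P x * T x (crows N r x [c..<d] v) z",
      OF assms(1,2) inj _ r])
  fix r :: "nat \<Rightarrow> nat" and j and x :: "nat \<Rightarrow> real"
  assume j: "a \<le> j" "j < b" "r (Suc j) = Suc (r j)"
  let ?y = "x \<circ> transpose j (Suc j)"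
  have "(\<lambda>z. (x j - x (Suc j)) * crows N (r(Suc j := r j)) x [c..<d] v z + 0 * v z)
    = (\<lambda>z. x j * crows N r x [c..<d] v z + - x (Suc j) * crows N r ?y [c..<d] v z)"
    using crows_divided_difference[of c j d r x N v] j assms(3,4) by simp
  from arg_cong[OF this, of "T x"] have "(x j - x (Suc j)) * T x (crows N (r(Suc j := r j)) x [c..<d] v) z
    = x j * T x (crows N r x [c..<d] v) z - x (Suc j) * T x (crows N r ?y [c..<d] v) z"
    unfolding lin_opD[OF T(2)] by (simp add: fun_eq_iff)
  from arg_cong[OF this, of "\<lambda>t. P x * t"]
  show "(x j - x (Suc j)) * (P x * T x (crows N (r(Suc j := r j)) x [c..<d] v) z)
      = x j * (P x * T x (crows N r x [c..<d] v) z) - x (Suc j) * (P ?y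
        * T ?y (crows N r ?y [c..<d] v) z)"
    unfolding P[OF j(1,2)] T(1)[OF j(1,2)] by (simp add: algebra_simps)
qed

text \<open>For involutions, \<open>cw_rows\<close> below identifies the coefficients of
  \<open>full_rows N m x (delta y)\<close> with generating polynomials of words together with
  compatible sequences.\<close>

definition full_rows :: "nat \<Rightarrow> nat \<Rightarrow> (nat \<Rightarrow> real) \<Rightarrow> ('s \<Rightarrow> real) \<Rightarrow> 's \<Rightarrow> real" where
  "full_rows N m x = brows N (\<lambda>_. 1) x [1..<Suc m]"

text \<open>Two choices of l matter. With l = 0 the product is a pure staircase and can be
  evaluated; with larger l the first l rows are already complete, which relates different numbers of
  variables.\<close>

lemma full_rows_symz:
  assumes "inj_on x {1..m}" "l \<le> m"
  shows "full_rows N m x v z = symz m (\<lambda>x. brows N (\<lambda>j. if j \<le> l then 1 else j) x [1..<Suc m] v z) x"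
proof (cases "m = 0")
  case True
  moreover have "pairs 0 = {}" by (auto simp: pairs_def)
  ultimately show ?thesis by (simp add: full_rows_def symz_def sym_weight_def)
next
  case m: False
  have block: "symz m (\<lambda>x. brows N (\<lambda>j. if j \<le> l then 1 else j) x [1..<Suc m] v z) x
      = symz m (\<lambda>x. brows N (\<lambda>j. j) x [1..<Suc m] v z) x" if l: "1 \<le> l" "l \<le> m" for l
  proof -
    have "symz m (\<lambda>x. 1 * brows N (\<lambda>j. if 1 \<le> j \<and> j \<le> l then 1 else j) x [1..<Suc m] v z) x
      = symz m (\<lambda>x. 1 * brows N (\<lambda>j. j) x [1..<Suc m] v z) x"
      by (rule symz_brows) (use assms l in auto)
    moreover have "brows N (\<lambda>j. if j \<le> l then 1 else j) x [1..<Suc m] v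
        = brows N (\<lambda>j. if 1 \<le> j \<and> j \<le> l then 1 else j) x [1..<Suc m] v" for x
      by (rule brows_cong) auto
    ultimately show ?thesis by simp
  qed
  \<comment> \<open>If all rows are complete the product is symmetric, hence by
    \<open>symz_one\<close> equal to its own symmetrization.\<close>
  have "brows N (\<lambda>j. if j \<le> m then 1 else j) x [1..<Suc m] v = full_rows N m x v" for x
    unfolding full_rows_def by (rule brows_cong) auto
  then have "symz m (\<lambda>x. brows N (\<lambda>j. if j \<le> m then 1 else j) x [1..<Suc m] v z) x
      = symz m (\<lambda>x. full_rows N m x v z * 1) x"
    by (simp only: mult_1_right)
  also have "\<dots> = full_rows N m x v z"
    by (subst symz_mult_sym) (simp_all only: full_rows_def brows_permute symz_one[OF assms(1)] mult_1_right)
  finally have full: "full_rows N m x v z = symz m (\<lambda>x. brows N (\<lambda>j. j) x [1..<Suc m] v z) x"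
    using block[of m] m by simp
  show ?thesis
  proof (cases "l = 0")
    case True
    then have "brows N (\<lambda>j. if j \<le> l then 1 else j) x [1..<Suc m] v = brows N (\<lambda>j. j) x [1..<Suc m] v" for x
      by (intro brows_cong) auto
    then show ?thesis using full by simp
  qed (use full block[of l] assms in simp)
qed

lemma full_rows_permute:
  "\<sigma> permutes {1..m} \<Longrightarrow> full_rows N m (x \<circ> \<sigma>) v = full_rows N m x v"
  unfolding full_rows_def by (rule brows_permute)

lemma staircase_rows_brows:
  "N - k = c \<Longrightarrow> staircase_rows x c k l v = brows N (\<lambda>j. k + (j - l)) x [l..<l + c] v"
proof (induction c arbitrary: k l v)
  case (Suc c)
  have "brows N (\<lambda>j. k + (j - l)) x [Suc l..<Suc l + c] w
      = brows N (\<lambda>j. Suc k + (j - Suc l)) x [Suc l..<Suc l + c] w" for w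
    by (rule brows_cong) auto
  then show ?case using Suc by (simp add: upt_conv_Cons del: upt_Suc)
qed simp

lemma dual_rows_crows:
  "N - k = c \<Longrightarrow> dual_rows x c k l v = crows N (\<lambda>j. k + (j - l)) x [l..<l + c] v"
proof (induction c arbitrary: k l v)
  case (Suc c)
  have "crows N (\<lambda>j. k + (j - l)) x [Suc l..<Suc l + c] w
      = crows N (\<lambda>j. Suc k + (j - Suc l)) x [Suc l..<Suc l + c] w" for w
    by (rule crows_cong) auto
  then show ?case using Suc by (simp add: upt_conv_Cons del: upt_Suc)
qed simp

lemma brows_trivial: "(\<And>j. j \<in> set js \<Longrightarrow> N \<le> r j) \<Longrightarrow> brows N r x js v = v"
  by (induction js arbitrary: v) auto

lemma crows_trivial: "(\<And>j. j \<in> set js \<Longrightarrow> N \<le> r j) \<Longrightarrow> crows N r x js v = v"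
  by (induction js) auto

end

section \<open>Nil-Coxeter operators on involutions and on sequences\<close>

text \<open>Operators on functions are the transposed picture: a value at z is pulled back from the
  element \<open>t i z\<close> below z. On \<open>delta y\<close> this yields the delta of the
  element above y, or zero, as \<open>inv_op_delta\<close> and \<open>seq_op_delta\<close>
  show.\<close>

definition move_op :: "(nat \<Rightarrow> 's \<Rightarrow> bool) \<Rightarrow> (nat \<Rightarrow> 's \<Rightarrow> 's) \<Rightarrow> nat \<Rightarrow> ('s \<Rightarrow> real) \<Rightarrow> 's \<Rightarrow> real" where
  "move_op D t i v z = (if D i z then v (t i z) else 0)"

lemma move_op_lin: "lin_op (move_op D t i)"
  by (auto simp: lin_op_def move_op_def)

abbreviation swp :: "nat \<Rightarrow> nat \<Rightarrow> nat" where
  "swp i \<equiv> transpose i (Suc i)"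

section \<open>The involution weak order satisfies the nil-Coxeter relations\<close>

definition is_inv :: "(nat \<Rightarrow> nat) \<Rightarrow> bool" where
  "is_inv z \<longleftrightarrow> z \<circ> z = id"

lemma is_invD: "is_inv z \<Longrightarrow> z (z j) = j"
  by (simp add: is_inv_def fun_eq_iff)

lemma is_inv_eq: "is_inv z \<Longrightarrow> z j = k \<longleftrightarrow> j = z k"
  using is_invD by metis

lemma is_inv_inj: "is_inv z \<Longrightarrow> z j = z k \<longleftrightarrow> j = k"
  using is_invD by metis

lemma swp_less:
  "\<not> (x = i \<and> y = Suc i) \<Longrightarrow> \<not> (x = Suc i \<and> y = i) \<Longrightarrow> swp i x < swp i y \<longleftrightarrow> x < y"
  by (auto simp: transpose_def)

lemma swp_braid: "swp i (swp (Suc i) (swp i k)) = swp (Suc i) (swp i (swp (Suc i) k))"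
  by (auto simp: transpose_def)

lemma swp_comm: "Suc i < j \<Longrightarrow> swp i (swp j k) = swp j (swp i k)"
  by (auto simp: transpose_def)

definition fixes_pair :: "nat \<Rightarrow> (nat \<Rightarrow> nat) \<Rightarrow> bool" where
  "fixes_pair i z \<longleftrightarrow> (z i = i \<and> z (Suc i) = Suc i) \<or> (z i = Suc i \<and> z (Suc i) = i)"

lemma commute_swp_iff:
  assumes "is_inv z"
  shows "z \<circ> swp i = swp i \<circ> z \<longleftrightarrow> fixes_pair i z"
proof
  assume "z \<circ> swp i = swp i \<circ> z"
  then have "z (Suc i) = swp i (z i)"
    by (metis comp_apply transpose_apply_first)
  then show "fixes_pair i z"
    using is_inv_inj[OF assms, of i "Suc i"]
    by (auto simp: fixes_pair_def transpose_def split: if_splits)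
next
  assume "fixes_pair i z"
  then show "z \<circ> swp i = swp i \<circ> z"
    unfolding fixes_pair_def
    by (auto simp: transpose_def fun_eq_iff is_invD[OF assms] is_inv_eq[OF assms] dest: sym)
qed

lemma inv_act_apply:
  assumes "is_inv z"
  shows "inv_act z i j = (if fixes_pair i z then z (swp i j) else swp i (z (swp i j)))"
  unfolding inv_act_def simple_refl_def Suc_eq_plus1[symmetric] commute_swp_iff[OF assms] by simp

lemma is_inv_inv_act:
  assumes "is_inv z" shows "is_inv (inv_act z i)"
proof (cases "z \<circ> swp i = swp i \<circ> z")
  case True
  then have "inv_act z i = z \<circ> swp i" by (simp add: inv_act_def simple_refl_def)
  moreover have "z \<circ> swp i \<circ> (z \<circ> swp i) = z \<circ> (swp i \<circ> z) \<circ> swp i"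
    by (simp only: o_assoc)
  moreover have "\<dots> = z \<circ> z \<circ> (swp i \<circ> swp i)"
    unfolding True[symmetric] by (simp only: o_assoc)
  ultimately show ?thesis using assms by (simp add: is_inv_def)
next
  case False
  then have "inv_act z i = swp i \<circ> z \<circ> swp i" by (simp add: inv_act_def simple_refl_def)
  then show ?thesis using assms by (simp add: is_inv_def fun_eq_iff)
qed

lemma fixes_pair_inv_act:
  assumes "is_inv z" shows "fixes_pair i (inv_act z i) \<longleftrightarrow> fixes_pair i z"
  by (auto simp: fixes_pair_def inv_act_apply[OF assms] transpose_def split: if_splits)

lemma inv_act_inv_act:
  assumes "is_inv z" shows "inv_act (inv_act z i) i = z"
  by (simp add: fun_eq_iff inv_act_apply[OF is_inv_inv_act[OF assms]] inv_act_apply[OF assms]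
      fixes_pair_inv_act[OF assms])

lemma inv_act_descent:
  assumes "is_inv z"
  shows "inv_act z i (Suc i) < inv_act z i i \<longleftrightarrow> z i < z (Suc i)"
  using is_inv_inj[OF assms, of i "Suc i"]
  by (auto simp: inv_act_apply[OF assms] swp_less fixes_pair_def)

definition inv_desc :: "nat \<Rightarrow> (nat \<Rightarrow> nat) \<Rightarrow> bool" where
  "inv_desc i z \<longleftrightarrow> is_inv z \<and> z (Suc i) < z i"

abbreviation inv_op :: "nat \<Rightarrow> ((nat \<Rightarrow> nat) \<Rightarrow> real) \<Rightarrow> (nat \<Rightarrow> nat) \<Rightarrow> real" where
  "inv_op \<equiv> move_op inv_desc (\<lambda>i z. inv_act z i)"

lemma inv_desc_act: "is_inv z \<Longrightarrow> inv_desc j (inv_act z i) \<longleftrightarrow> inv_act z i (Suc j) < inv_act z i j"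
  by (simp add: inv_desc_def is_inv_inv_act)

lemma inv_act_far:
  assumes z: "is_inv z" and ij: "Suc i < j \<or> Suc j < i"
  shows "inv_act z i j = (if fixes_pair i z then z j else swp i (z j))"
    "inv_act z i (Suc j) = (if fixes_pair i z then z (Suc j) else swp i (z (Suc j)))"
  using ij by (auto simp: inv_act_apply[OF z])

lemma fixes_pair_far:
  assumes z: "is_inv z" and ij: "Suc i < j \<or> Suc j < i"
  shows "fixes_pair j (inv_act z i) \<longleftrightarrow> fixes_pair j z"
proof -
  have "swp i k = j \<longleftrightarrow> k = j" "swp i k = Suc j \<longleftrightarrow> k = Suc j" for k
    using ij by (auto simp: transpose_def)
  then show ?thesis unfolding fixes_pair_def inv_act_far[OF assms] by auto
qed

lemma inv_desc_far:
  assumes z: "is_inv z" and ij: "Suc i < j \<or> Suc j < i"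
    and ne: "\<not> (z j = i \<and> z (Suc j) = Suc i)" "\<not> (z j = Suc i \<and> z (Suc j) = i)"
  shows "inv_desc j (inv_act z i) \<longleftrightarrow> inv_desc j z"
proof -
  have "swp i (z (Suc j)) < swp i (z j) \<longleftrightarrow> z (Suc j) < z j"
    by (rule swp_less) (use ne in auto)
  then show ?thesis
    by (simp add: inv_desc_act[OF z] inv_act_far[OF z ij]) (simp add: inv_desc_def z)
qed

text \<open>Acting at i changes the order of the values at j and j + 1 only if z exchanges the pairs
  {i, i+1} and {j, j+1}. If it does so increasingly, i is no descent; if decreasingly, acting at i
  has already removed the descent at j.\<close>

lemma inv_comm_desc:
  assumes z: "is_inv z" and ij: "Suc i < j \<or> Suc j < i"
    and d: "inv_desc i z" "inv_desc j (inv_act z i)"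
  shows "inv_desc j z \<and> inv_desc i (inv_act z j)"
proof -
  have n1: "\<not> (z j = i \<and> z (Suc j) = Suc i)"
    using d(1) is_inv_eq[OF z] unfolding inv_desc_def by (metis lessI less_asym)
  moreover have n2: "\<not> (z j = Suc i \<and> z (Suc j) = i)"
  proof
    assume e: "z j = Suc i \<and> z (Suc j) = i"
    then have "z (Suc i) = j" "z i = Suc j" using is_inv_eq[OF z] by metis+
    then have "\<not> fixes_pair i z" unfolding fixes_pair_def using ij by auto
    then show False using d(2) e by (simp add: inv_desc_act[OF z] inv_act_far[OF z ij])
  qed
  ultimately have "inv_desc j z"
    using inv_desc_far[OF z ij] d(2) by simp
  moreover have "inv_desc i (inv_act z j)"
  proof (subst inv_desc_far[OF z])
    show "Suc j < i \<or> Suc i < j" using ij by auto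
    show "\<not> (z i = j \<and> z (Suc i) = Suc j)" "\<not> (z i = Suc j \<and> z (Suc i) = j)"
      using n1 n2 is_inv_eq[OF z] by metis+
  qed (rule d(1))
  ultimately show ?thesis ..
qed

lemma inv_comm_act:
  assumes z: "is_inv z" and ij: "Suc i < j"
  shows "inv_act (inv_act z i) j = inv_act (inv_act z j) i"
proof -
  have "fixes_pair j (inv_act z i) \<longleftrightarrow> fixes_pair j z" "fixes_pair i (inv_act z j) \<longleftrightarrow> fixes_pair i z"
    using fixes_pair_far[OF z] ij by auto
  then show ?thesis
    by (simp add: fun_eq_iff inv_act_apply[OF is_inv_inv_act[OF z]] inv_act_apply[OF z] swp_comm[OF ij])
qed

text \<open>For the braid relation only the values \<open>a, b, c\<close> at \<open>i, i + 1, i + 2\<close> matter.\<close>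

lemma inv_act_triple:
  assumes z: "is_inv z" and a: "a = z i" and b: "b = z (Suc i)" and c: "c = z (Suc (Suc i))"
  shows "inv_act z i i = (if fixes_pair i z then b else swp i b)"
    "inv_act z i (Suc i) = (if fixes_pair i z then a else swp i a)"
    "inv_act z i (Suc (Suc i)) = (if fixes_pair i z then c else swp i c)"
    "inv_act z (Suc i) i = (if fixes_pair (Suc i) z then a else swp (Suc i) a)"
    "inv_act z (Suc i) (Suc i) = (if fixes_pair (Suc i) z then c else swp (Suc i) c)"
    "inv_act z (Suc i) (Suc (Suc i)) = (if fixes_pair (Suc i) z then b else swp (Suc i) b)"
  unfolding a b c by (simp_all add: inv_act_apply[OF z])

text \<open>Here p, q, r are the values at the three places after acting at i, and p', q' those at
  the first two after acting at i + 1 as well; F and G tell whether the step is one-sided. The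
  excluded case \<open>a = Suc (Suc i)\<close> with c < b < a is the reversal of three points, which
  two steps already reduce to the identity there.\<close>

lemma triple_chain:
  fixes a b c i :: nat
  assumes *: "c = i \<longleftrightarrow> a = Suc (Suc i)" "c = Suc i \<longleftrightarrow> b = Suc (Suc i)" "b = i \<longleftrightarrow> a = Suc i"
      "a \<noteq> b" "a \<noteq> c" "b \<noteq> c"
  and F: "F \<longleftrightarrow> a = i \<and> b = Suc i \<or> a = Suc i \<and> b = i"
  and p: "p = (if F then b else swp i b)" "q = (if F then a else swp i a)" "r = (if F then c else swp i c)"
  and G: "G \<longleftrightarrow> q = Suc i \<and> r = Suc (Suc i) \<or> q = Suc (Suc i) \<and> r = Suc i"
  and p': "p' = (if G then p else swp (Suc i) p)" "q' = (if G then r else swp (Suc i) r)"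
  shows "b < a \<and> r < q \<and> q' < p' \<longleftrightarrow> c < b \<and> b < a \<and> a \<noteq> Suc (Suc i)"
proof (cases "b < a")
  case True
  then have F': "F \<longleftrightarrow> a = Suc i" using F * by auto
  consider "a = Suc i" | "a = Suc (Suc i)" | "b = Suc (Suc i)"
    | "a \<noteq> Suc i" "a \<noteq> Suc (Suc i)" "b \<noteq> Suc (Suc i)" by blast
  then show ?thesis
  proof cases
    case 1
    then have "b = i" "c \<noteq> Suc i" "c \<noteq> Suc (Suc i) \<or> c = Suc (Suc i)" using * by auto
    then show ?thesis using 1 True * unfolding p' G p F' by (auto simp: transpose_def)
  next
    case 2
    then have "c = i" "b \<noteq> i" using * by auto
    then show ?thesis using 2 True * unfolding p' G p F' by (auto simp: transpose_def)
  next
    case 3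
    then have "c = Suc i" "a > Suc (Suc i)" using * True by auto
    then show ?thesis using 3 True * unfolding p' G p F' by (auto simp: transpose_def)
  next
    case 4
    then have 5: "c \<noteq> i" "c \<noteq> Suc i" "b \<noteq> i" using * by auto
    have p'': "p = (if b = Suc i then i else b)" "q = (if a = i then Suc i else a)" "r = c"
      using p F' 4 5 by (auto simp: transpose_def)
    have "\<not> G" if "r < q"
      using that G p'' 4 by (auto split: if_splits)
    moreover have "swp (Suc i) r < swp (Suc i) p \<longleftrightarrow> r < p"
      by (rule swp_less) (use p'' 4 5 in \<open>auto split: if_splits\<close>)
    moreover have "r < q \<and> r < p \<longleftrightarrow> c < b"
      using p'' 5 True by (auto split: if_splits)
    ultimately show ?thesis using p' 4 True by auto
  qed
qed auto

text \<open>The other braid word, acting at i + 1, i, i + 1. The resulting condition is the one of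
  \<open>triple_chain\<close>, so both sides of the braid relation vanish together.\<close>

lemma triple_chain':
  fixes a b c i :: nat
  assumes *: "c = i \<longleftrightarrow> a = Suc (Suc i)" "c = Suc i \<longleftrightarrow> b = Suc (Suc i)" "b = i \<longleftrightarrow> a = Suc i"
      "a \<noteq> b" "a \<noteq> c" "b \<noteq> c"
  and F: "F \<longleftrightarrow> b = Suc i \<and> c = Suc (Suc i) \<or> b = Suc (Suc i) \<and> c = Suc i"
  and p: "p = (if F then a else swp (Suc i) a)" "q = (if F then c else swp (Suc i) c)"
    "r = (if F then b else swp (Suc i) b)"
  and G: "G \<longleftrightarrow> p = i \<and> q = Suc i \<or> p = Suc i \<and> q = i"
  and p': "p' = (if G then p else swp i p)" "q' = (if G then r else swp i r)"
  shows "c < b \<and> q < p \<and> q' < p' \<longleftrightarrow> c < b \<and> b < a \<and> a \<noteq> Suc (Suc i)"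
proof (cases "c < b")
  case True
  then have F': "F \<longleftrightarrow> b = Suc (Suc i)" using F * by auto
  consider "a = Suc i" | "a = Suc (Suc i)" | "b = Suc (Suc i)"
    | "a \<noteq> Suc i" "a \<noteq> Suc (Suc i)" "b \<noteq> Suc (Suc i)" by blast
  then show ?thesis
  proof cases
    case 1
    then have "b = i" "c \<noteq> Suc i" using * by auto
    then show ?thesis using 1 True * unfolding p' G p F' by (auto simp: transpose_def)
  next
    case 2
    then have "c = i" "b \<noteq> i" using * by auto
    then show ?thesis using 2 True * unfolding p' G p F' by (auto simp: transpose_def)
  next
    case 3
    then have "c = Suc i" using * True by auto
    then show ?thesis using 3 True * unfolding p' G p F' by (auto simp: transpose_def)
  next
    case 4
    then have 5: "c \<noteq> i" "c \<noteq> Suc i" "b \<noteq> i" using * by auto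
    have p'': "p = a" "q = (if c = Suc (Suc i) then Suc i else c)" "r = (if b = Suc i then Suc (Suc i) else b)"
      using p F' 4 5 by (auto simp: transpose_def)
    have "\<not> G" if "q < p"
      using that G p'' 4 by (auto split: if_splits)
    moreover have "swp i r < swp i p \<longleftrightarrow> r < p"
      by (rule swp_less) (use p'' 4 5 in \<open>auto split: if_splits\<close>)
    moreover have "q < p \<and> r < p \<longleftrightarrow> b < a"
      using p'' 4 5 True by (auto split: if_splits)
    ultimately show ?thesis using p' 4 True by auto
  qed
qed auto

lemma inv_braid_desc:
  assumes z: "is_inv z"
  shows "inv_desc i z \<and> inv_desc (Suc i) (inv_act z i) \<and> inv_desc i (inv_act (inv_act z i) (Suc i))
    \<longleftrightarrow> z (Suc (Suc i)) < z (Suc i) \<and> z (Suc i) < z i \<and> z i \<noteq> Suc (Suc i)" (is "?L \<longleftrightarrow> ?M")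
    and "inv_desc (Suc i) z \<and> inv_desc i (inv_act z (Suc i)) \<and> inv_desc (Suc i) (inv_act (inv_act z (Suc i)) i)
    \<longleftrightarrow> z (Suc (Suc i)) < z (Suc i) \<and> z (Suc i) < z i \<and> z i \<noteq> Suc (Suc i)" (is "?R \<longleftrightarrow> ?M")
proof -
  define a b c where "a = z i" and "b = z (Suc i)" and "c = z (Suc (Suc i))"
  note abc = a_def b_def c_def
  have *: "a = Suc i \<longleftrightarrow> b = i" "a = Suc (Suc i) \<longleftrightarrow> c = i" "b = Suc (Suc i) \<longleftrightarrow> c = Suc i"
    "a \<noteq> b" "a \<noteq> c" "b \<noteq> c"
    using is_inv_eq[OF z, of i "Suc i"] is_inv_eq[OF z, of i "Suc (Suc i)"]
      is_inv_eq[OF z, of "Suc i" "Suc (Suc i)"] unfolding abc by (auto simp: is_inv_inj[OF z])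
  note I = inv_act_triple[OF is_inv_inv_act[OF z] refl refl refl] inv_act_triple[OF z abc]
    inv_desc_def is_inv_inv_act[OF z] is_inv_inv_act[OF is_inv_inv_act[OF z]] z fixes_pair_def
  have *: "c = i \<longleftrightarrow> a = Suc (Suc i)" "c = Suc i \<longleftrightarrow> b = Suc (Suc i)" "b = i \<longleftrightarrow> a = Suc i"
    "a \<noteq> b" "a \<noteq> c" "b \<noteq> c" using * by auto
  note T = inv_act_triple[OF z abc] inv_act_triple[OF is_inv_inv_act[OF z] refl refl refl]
  note fp = fixes_pair_def[of i z, folded abc] fixes_pair_def[of "Suc i" "inv_act z i"]
    fixes_pair_def[of "Suc i" z, folded abc] fixes_pair_def[of i "inv_act z (Suc i)"]
  have "b < a \<and> inv_act z i (Suc (Suc i)) < inv_act z i (Suc i)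
      \<and> inv_act (inv_act z i) (Suc i) (Suc i) < inv_act (inv_act z i) (Suc i) i
    \<longleftrightarrow> c < b \<and> b < a \<and> a \<noteq> Suc (Suc i)"
    by (rule triple_chain[OF * fp(1) T(1-3) fp(2) T(10,11)])
  then show "?L \<longleftrightarrow> ?M"
    by (simp add: inv_desc_def z is_inv_inv_act abc)
  have "c < b \<and> inv_act z (Suc i) (Suc i) < inv_act z (Suc i) i
      \<and> inv_act (inv_act z (Suc i)) i (Suc (Suc i)) < inv_act (inv_act z (Suc i)) i (Suc i)
    \<longleftrightarrow> c < b \<and> b < a \<and> a \<noteq> Suc (Suc i)"
    by (rule triple_chain'[OF * fp(3) T(4-6) fp(4) T(8,9)])
  then show "?R \<longleftrightarrow> ?M"
    by (simp add: inv_desc_def z is_inv_inv_act abc)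
qed

text \<open>The middle step is a conjugation in both words, and the first step of one word is
  one-sided exactly when the last step of the other is. What remains is the braid relation for
  transpositions.\<close>

lemma inv_braid_act:
  assumes z: "is_inv z"
    and lt: "z (Suc (Suc i)) < z (Suc i)" "z (Suc i) < z i" "z i \<noteq> Suc (Suc i)"
  shows "inv_act (inv_act (inv_act z i) (Suc i)) i = inv_act (inv_act (inv_act z (Suc i)) i) (Suc i)"
proof -
  define a b c where "a = z i" and "b = z (Suc i)" and "c = z (Suc (Suc i))"
  note abc = a_def b_def c_def
  have *: "a = Suc i \<longleftrightarrow> b = i" "a = Suc (Suc i) \<longleftrightarrow> c = i" "b = Suc (Suc i) \<longleftrightarrow> c = Suc i"
    using is_inv_eq[OF z] unfolding abc by metis+
  have **: "c = i \<longleftrightarrow> a = Suc (Suc i)" "c = Suc i \<longleftrightarrow> b = Suc (Suc i)" "b = i \<longleftrightarrow> a = Suc i"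
    "c < b" "b < a" "a \<noteq> Suc (Suc i)" using * lt unfolding abc by auto
  note I = inv_act_triple[OF is_inv_inv_act[OF z] refl refl refl] inv_act_triple[OF z abc]
  have f: "fixes_pair i z \<longleftrightarrow> a = Suc i" "fixes_pair (Suc i) z \<longleftrightarrow> b = Suc (Suc i)"
    unfolding fixes_pair_def abc[symmetric] using ** by auto
  have g: "\<not> fixes_pair (Suc i) (inv_act z i)" "\<not> fixes_pair i (inv_act z (Suc i))"
    unfolding fixes_pair_def[of _ "inv_act _ _"] I f using ** by (auto simp: transpose_def split: if_splits)
  have h: "fixes_pair i (inv_act (inv_act z i) (Suc i)) \<longleftrightarrow> b = Suc (Suc i)"
    "fixes_pair (Suc i) (inv_act (inv_act z (Suc i)) i) \<longleftrightarrow> a = Suc i"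
    unfolding fixes_pair_def[of _ "inv_act (inv_act _ _) _"] I f g using **
    by (auto simp: g transpose_def split: if_splits)
  have "\<not> (a = Suc i \<and> b = Suc (Suc i))" using ** by auto
  then show ?thesis
    by (cases "a = Suc i"; cases "b = Suc (Suc i)")
      (simp_all add: fun_eq_iff inv_act_apply[OF is_inv_inv_act[OF is_inv_inv_act[OF z]]]
        inv_act_apply[OF is_inv_inv_act[OF z]] inv_act_apply[OF z] f g h swp_braid)
qed

interpretation inv: nil_coxeter inv_op
proof
  fix i j :: nat and v :: "(nat \<Rightarrow> nat) \<Rightarrow> real"
  show "lin_op (inv_op i)" by (rule move_op_lin)
  show "inv_op i (inv_op i v) = (\<lambda>z. 0)"
    by (auto simp: move_op_def fun_eq_iff inv_desc_def inv_act_descent)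
  show "inv_op i (inv_op j v) = inv_op j (inv_op i v)" if "Suc i < j"
  proof
    fix z
    show "inv_op i (inv_op j v) z = inv_op j (inv_op i v) z"
    proof (cases "is_inv z")
      case True
      show ?thesis
        using inv_comm_desc[OF True, of i j] inv_comm_desc[OF True, of j i] inv_comm_act[OF True, of i j] that
        by (auto simp: move_op_def)
    qed (simp add: move_op_def inv_desc_def)
  qed
  show "inv_op i (inv_op (Suc i) (inv_op i v)) = inv_op (Suc i) (inv_op i (inv_op (Suc i) v))"
  proof
    fix z
    show "inv_op i (inv_op (Suc i) (inv_op i v)) z = inv_op (Suc i) (inv_op i (inv_op (Suc i) v)) z"
    proof (cases "is_inv z")
      case True
      have "inv_op i (inv_op (Suc i) (inv_op i v)) z =
        (if inv_desc i z \<and> inv_desc (Suc i) (inv_act z i) \<and> inv_desc i (inv_act (inv_act z i) (Suc i))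
         then v (inv_act (inv_act (inv_act z i) (Suc i)) i) else 0)"
        by (simp add: move_op_def)
      moreover have "inv_op (Suc i) (inv_op i (inv_op (Suc i) v)) z =
        (if inv_desc (Suc i) z \<and> inv_desc i (inv_act z (Suc i))
            \<and> inv_desc (Suc i) (inv_act (inv_act z (Suc i)) i)
         then v (inv_act (inv_act (inv_act z (Suc i)) i) (Suc i)) else 0)"
        by (simp add: move_op_def)
      ultimately show ?thesis
        unfolding inv_braid_desc[OF True] using inv_braid_act[OF True, of i] by auto
    qed (simp add: move_op_def inv_desc_def)
  qed
qed

section \<open>Permutations and 0-1-sequences as integer sequences\<close>

definition seq_desc :: "nat \<Rightarrow> (nat \<Rightarrow> nat) \<Rightarrow> bool" where
  "seq_desc i b \<longleftrightarrow> b (Suc i) < b i"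

definition seq_move :: "nat \<Rightarrow> (nat \<Rightarrow> nat) \<Rightarrow> nat \<Rightarrow> nat" where
  "seq_move i b = b \<circ> swp i"

lemma seq_move_apply [simp]: "seq_move i b j = b (swp i j)"
  by (simp add: seq_move_def)

lemma seq_move_seq_move [simp]: "seq_move i (seq_move i b) = b"
  by (simp add: seq_move_def o_assoc[symmetric])

text \<open>No injectivity is imposed: equal neighbours are simply no descent, so one model covers
  right multiplication of permutations and moves in 0-1-sequences.\<close>

abbreviation seq_op :: "nat \<Rightarrow> ((nat \<Rightarrow> nat) \<Rightarrow> real) \<Rightarrow> (nat \<Rightarrow> nat) \<Rightarrow> real" where
  "seq_op \<equiv> move_op seq_desc seq_move"

interpretation sq: nil_coxeter seq_op
proof
  fix i j :: nat and v :: "(nat \<Rightarrow> nat) \<Rightarrow> real"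
  show "lin_op (seq_op i)" by (rule move_op_lin)
  show "seq_op i (seq_op i v) = (\<lambda>z. 0)"
    by (auto simp: move_op_def fun_eq_iff seq_desc_def)
  show "seq_op i (seq_op j v) = seq_op j (seq_op i v)" if "Suc i < j"
    using that by (auto simp: move_op_def fun_eq_iff seq_desc_def seq_move_def o_def swp_comm[OF that])
  show "seq_op i (seq_op (Suc i) (seq_op i v)) = seq_op (Suc i) (seq_op i (seq_op (Suc i) v))"
    by (auto simp: move_op_def seq_desc_def fun_eq_iff seq_move_def o_def swp_braid)
qed

section \<open>Values of staircase products\<close>

context nil_coxeter
begin

text \<open>Move the factor of index k to the other end. The only factor it does not commute with
  has index k + 1, and these two commute when applied to e.\<close>

lemma B_eq_C_reflecting:
  assumes "\<And>i. k \<le> i \<Longrightarrow> Suc i < k + c \<Longrightarrow> u (Suc i) (u i e) = u i (u (Suc i) e)"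
  shows "B c k y e = C c k y e"
  using assms
proof (induction c arbitrary: k)
  case (Suc c)
  have IH: "B c (Suc k) y e = C c (Suc k) y e"
    by (rule Suc.IH) (use Suc.prems in auto)
  show ?case
  proof (cases c)
    case (Suc c')
    have "h k y (h (Suc k) y e) = h (Suc k) y (h k y e)"
      using Suc.prems[of k] Suc by (simp add: h_def u_add u_scale fun_eq_iff algebra_simps)
    then show ?thesis using IH by (simp add: Suc h_C_comm)
  qed simp
qed simp

text \<open>The variant for v_n: factors at even offset fix e, and after a factor at odd offset its
  two neighbours act alike, so the left neighbour can be exchanged for the right one.\<close>

lemma B_eq_C_alternating:
  assumes "\<And>i. even i \<Longrightarrow> i \<le> 2 * d \<Longrightarrow> u (k + i) e = (\<lambda>z. 0)"
    and "\<And>i. odd i \<Longrightarrow> i < 2 * d \<Longrightarrow> u (k + i - 1) (u (k + i) e) = u (k + i + 1) (u (k + i) e)"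
  shows "B (Suc (2 * d)) k y e = C (Suc (2 * d)) k y e"
  using assms
proof (induction d arbitrary: k)
  case 0
  show ?case by simp
next
  case (Suc d)
  have IH: "B (Suc (2 * d)) (k + 2) y e = C (Suc (2 * d)) (k + 2) y e"
  proof (rule Suc.IH)
    show "u (k + 2 + i) e = (\<lambda>z. 0)" if "even i" "i \<le> 2 * d" for i
      using Suc.prems(1)[of "2 + i"] that by (simp add: add.assoc)
    show "u (k + 2 + i - 1) (u (k + 2 + i) e) = u (k + 2 + i + 1) (u (k + 2 + i) e)"
      if "odd i" "i < 2 * d" for i
      using Suc.prems(2)[of "2 + i"] that by (simp add: add.assoc)
  qed
  have e: "h k y e = e" "h (k + 2) y e = e"
    using Suc.prems(1)[of 0] Suc.prems(1)[of 2] by (simp_all add: h_def)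
  have "h k y (h (Suc k) y e) = h (k + 2) y (h (Suc k) y e)"
    using Suc.prems(2)[of 1] Suc.prems(1)[of 0] Suc.prems(1)[of 2]
    by (simp add: h_def u_add u_scale u_zero fun_eq_iff algebra_simps)
  then show ?case using IH e by (simp add: h_C_comm)
qed

end

locale moves = nil_coxeter "move_op D t" for D :: "nat \<Rightarrow> 's \<Rightarrow> bool" and t :: "nat \<Rightarrow> 's \<Rightarrow> 's"
begin

lemma h_move: "h i y v z = v z + y * (if D i z then v (t i z) else 0)"
  by (simp add: h_def move_op_def)

lemma shifted_row_Suc_last:
  "shifted_row x (Suc c) k l y v = h (k + c) (y + x (l + c)) (shifted_row x c k l y v)"
  by (induction c arbitrary: k l v) auto

primrec unmoves :: "nat \<Rightarrow> nat \<Rightarrow> 's \<Rightarrow> 's" where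
  "unmoves k 0 z = z"
| "unmoves k (Suc c) z = unmoves k c (t (k + c) z)"

text \<open>\<open>Q j z\<close> says that a distinguished entry of \<open>z\<close> is at position \<open>j\<close>.  Every factor of the row
  has to move it down by one, since no later factor can move it any more.\<close>

lemma shifted_row_marker:
  assumes Q1: "\<And>i z. k \<le> i \<Longrightarrow> Q (Suc i) z \<Longrightarrow> D i z \<and> Q i (t i z)"
    and Q2: "\<And>i j z. k \<le> i \<Longrightarrow> Suc i < j \<Longrightarrow> Q j z \<Longrightarrow> D i z \<Longrightarrow> Q j (t i z)"
    and Q3: "\<And>j z. k < j \<Longrightarrow> Q j z \<Longrightarrow> v z = 0"
    and Q: "Q (k + c) z"
  shows "shifted_row x c k l y v z = (\<Prod>i<c. y + x (l + i)) * v (unmoves k c z)"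
proof -
  have zero: "shifted_row x c k l y v z = 0" if "k + c < j" "Q j z" for c j z
    using that
  proof (induction c arbitrary: z)
    case 0
    then show ?case using Q3 by simp
  next
    case (Suc c)
    then show ?case
      using Suc.IH[of z] Suc.IH[of "t (k + c) z"] Q2[of "k + c" j z]
      by (simp add: shifted_row_Suc_last h_move del: shifted_row.simps)
  qed
  show ?thesis using Q
  proof (induction c arbitrary: z)
    case (Suc c)
    have "shifted_row x c k l y v z = 0"
      using zero[of c "k + Suc c" z] Suc.prems by simp
    then show ?case
      using Suc.IH[of "t (k + c) z"] Q1[of "k + c" z] Suc.prems
      by (simp add: shifted_row_Suc_last h_move del: shifted_row.simps)
  qed simp
qed

lemma shifted_row_trivial:
  "(\<And>i. k + c \<le> i \<Longrightarrow> i < k + c + d \<Longrightarrow> \<not> D i z) \<Longrightarrow>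
    shifted_row x (c + d) k l y v z = shifted_row x c k l y v z"
  by (induction d) (simp_all add: shifted_row_Suc_last h_move del: shifted_row.simps)

text \<open>The predicate S records what z looks like at places that generators from k0 on cannot
  disturb. Functions supported on S then stay supported on S under all rows built from these
  generators.\<close>

context
  fixes S :: "'s \<Rightarrow> bool" and k0 :: nat
  assumes S: "\<And>i z. k0 \<le> i \<Longrightarrow> D i z \<Longrightarrow> S (t i z) \<Longrightarrow> S z"
begin

lemma B_support: "k0 \<le> k \<Longrightarrow> (\<And>z. \<not> S z \<Longrightarrow> v z = 0) \<Longrightarrow> \<not> S z \<Longrightarrow> B c k y v z = 0"
proof (induction c arbitrary: k z)
  case (Suc c)
  have IH: "\<not> S z \<Longrightarrow> B c (Suc k) y v z = 0" for z
    using Suc.IH[of "Suc k" z] Suc.prems by simp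
  show ?case using S[of k z] IH[of z] IH[of "t k z"] Suc.prems by (auto simp: h_move)
qed simp

lemma C_support: "k0 \<le> k \<Longrightarrow> (\<And>z. \<not> S z \<Longrightarrow> v z = 0) \<Longrightarrow> \<not> S z \<Longrightarrow> C c k y v z = 0"
proof (induction c arbitrary: k z v)
  case (Suc c)
  have "h k y v z = 0" if "\<not> S z" for z
    using Suc.prems that S[of k z] by (auto simp: h_move)
  then show ?case using Suc by simp
qed simp

lemma staircase_rows_support:
  "k0 \<le> k \<Longrightarrow> (\<And>z. \<not> S z \<Longrightarrow> v z = 0) \<Longrightarrow> \<not> S z \<Longrightarrow> staircase_rows x c k l v z = 0"
proof (induction c arbitrary: k l v)
  case (Suc c)
  have "B (Suc c) k (x l) v z = 0" if "\<not> S z" for z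
    using Suc.prems(1,2) that by (rule B_support)
  then show ?case unfolding staircase_rows.simps using Suc.prems by (intro Suc.IH) auto
qed simp

lemma dual_rows_support:
  "k0 \<le> k \<Longrightarrow> (\<And>z. \<not> S z \<Longrightarrow> v z = 0) \<Longrightarrow> \<not> S z \<Longrightarrow> dual_rows x c k l v z = 0"
proof (induction c arbitrary: k l z)
  case (Suc c)
  show ?case unfolding dual_rows.simps
    using Suc by (intro C_support) auto
qed simp

end

end

interpretation inv: moves inv_desc "\<lambda>i z. inv_act z i" ..
interpretation sq: moves seq_desc seq_move ..

section \<open>Recursive evaluation of staircase products\<close>

definition delta :: "'s \<Rightarrow> 's \<Rightarrow> real" where
  "delta y z = (if z = y then 1 else 0)"

lemma delta_simps [simp]: "delta y y = 1" "z \<noteq> y \<Longrightarrow> delta y z = 0"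
  by (auto simp: delta_def)

text \<open>The elements at which coefficients are read off: k = 1 gives the longest permutation,
  and larger k appears after the lowest places have returned to their state in y.\<close>

definition reversal :: "(nat \<Rightarrow> nat) \<Rightarrow> nat \<Rightarrow> nat \<Rightarrow> nat \<Rightarrow> nat" where
  "reversal y k N j = (if k \<le> j \<and> j \<le> N then k + N - j else y j)"

lemma inv_op_delta:
  assumes "is_inv y"
  shows "inv_op i (delta y) = (if y i < y (Suc i) then delta (inv_act y i) else (\<lambda>z. 0))"
proof (intro ext)
  fix z
  show "inv_op i (delta y) z = (if y i < y (Suc i) then delta (inv_act y i) else (\<lambda>z. 0)) z"
  proof (cases "is_inv z")
    case True
    have "inv_act z i = y \<longleftrightarrow> z = inv_act y i"
      using inv_act_inv_act[OF True] inv_act_inv_act[OF assms] by metis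
    moreover have "z (Suc i) < z i \<longleftrightarrow> y i < y (Suc i)" if "z = inv_act y i"
      using inv_act_descent[OF assms] that by simp
    ultimately show ?thesis by (auto simp: move_op_def inv_desc_def True delta_def)
  next
    case False
    then have "z \<noteq> inv_act y i" using is_inv_inv_act[OF assms] by auto
    then show ?thesis using False by (simp add: move_op_def inv_desc_def)
  qed
qed

lemma is_inv_reversal:
  assumes "is_inv y" "\<And>j. y j < k \<longleftrightarrow> j < k"  "\<And>j. N < y j \<longleftrightarrow> N < j"
  shows "is_inv (reversal y k N)"
proof -
  have "reversal y k N (reversal y k N j) = j" for j
    using assms(2)[of j] assms(3)[of j] is_invD[OF assms(1), of j] by (auto simp: reversal_def)
  then show ?thesis by (auto simp: is_inv_def fun_eq_iff)
qed

text \<open>The involution which exchanges \<open>k\<close> and \<open>p\<close> and reverses the rest of \<open>{k..N}\<close>.\<close>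

definition pulled :: "(nat \<Rightarrow> nat) \<Rightarrow> nat \<Rightarrow> nat \<Rightarrow> nat \<Rightarrow> nat \<Rightarrow> nat" where
  "pulled y k N p j = (if j = k then p else if j = p then k else if k < j \<and> j \<le> N then
     (let r = (if j < p then N - j else N - j + 1) in if k + r < p then k + r else k + r + 1) else y j)"

lemma pulled_last: "k < N \<Longrightarrow> pulled y k N N = reversal y k N"
  by (auto simp: pulled_def reversal_def fun_eq_iff Let_def)

lemma pulled_step:
  assumes "k < p" "p < N" "is_inv (pulled y k N (Suc p))"
    and y: "\<And>j. y j < k \<longleftrightarrow> j < k"  "\<And>j. N < y j \<longleftrightarrow> N < j"
  shows "inv_act (pulled y k N (Suc p)) p = pulled y k N p"
proof
  fix j
  have "\<not> fixes_pair p (pulled y k N (Suc p))"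
    using assms(1,2) by (auto simp: fixes_pair_def pulled_def)
  then have "inv_act (pulled y k N (Suc p)) p j = swp p (pulled y k N (Suc p) (swp p j))"
    by (simp add: inv_act_apply[OF assms(3)])
  also have "\<dots> = pulled y k N p j"
  proof -
    have aux: "swp p (if n < Suc p then n else n + 1) = (if n < p then n else n + 1)" for n
      by (cases "n < p"; cases "n = p"; simp add: transpose_def)
    consider "j = k" | "j = p" | "j = Suc p" | "k < j" "j < p" | "Suc p < j" "j \<le> N"
      | "j < k \<or> N < j" by linarith
    then show ?thesis
    proof cases
      case 6
      then have "y j < k \<or> N < y j" using y[of j] by auto
      then have "swp p (y j) = y j" "swp p j = j"
        using 6 assms(1,2) by (auto intro!: transpose_apply_other)
      moreover have "pulled y k N q j = y j" if "k < q" "q \<le> N" for q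
        using 6 that by (auto simp: pulled_def)
      ultimately show ?thesis using assms(1,2) by simp
    next
      case 3
      then obtain d where "N = p + d" using assms(2) le_Suc_ex less_imp_le by blast
      then show ?thesis using 3 assms(1,2) aux[of "k + d"] by (simp add: pulled_def Let_def)
    next
      case 4
      then obtain d where "N = j + d" using assms(2) le_Suc_ex less_imp_le less_trans by blast
      then show ?thesis using 4 assms(1,2) aux[of "k + d"] by (simp add: pulled_def Let_def)
    next
      case 5
      then obtain d where "N = j + d" using le_Suc_ex by blast
      then show ?thesis using 5 assms(1,2) aux[of "k + Suc d"] by (simp add: pulled_def Let_def)
    qed (use assms(1,2) in \<open>simp_all add: pulled_def\<close>)
  qed
  finally show "inv_act (pulled y k N (Suc p)) p j = pulled y k N p j" .
qed

lemma unmoves_pulled: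
  assumes "is_inv (pulled y k N (Suc k + c))" "k + c < N"
    and y: "\<And>j. y j < k \<longleftrightarrow> j < k"  "\<And>j. N < y j \<longleftrightarrow> N < j"
  shows "inv.unmoves (Suc k) c (pulled y k N (Suc k + c)) = pulled y k N (Suc k)"
  using assms(1,2)
proof (induction c)
  case (Suc c)
  have *: "inv_act (pulled y k N (Suc k + Suc c)) (Suc k + c) = pulled y k N (Suc k + c)"
    using pulled_step[OF _ _ _ y, of "Suc k + c"] Suc.prems by simp
  then have "is_inv (pulled y k N (Suc k + c))"
    using is_inv_inv_act[OF Suc.prems(1), of "Suc k + c"] by simp
  then show ?case using Suc * by (simp del: add_Suc)
qed simp

text \<open>The marker is the partner of k. In the reversal it is N, so all c factors are forced to
  act, and it ends at \<open>Suc k\<close>.\<close>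

lemma inv_marker:
  assumes "is_inv (reversal y k N)" "N = Suc k + c" "\<And>j. y j < k \<longleftrightarrow> j < k"  "\<And>j. N < y j \<longleftrightarrow> N < j"
    and v: "\<And>j z. Suc k < j \<Longrightarrow> is_inv z \<Longrightarrow> z k = j \<Longrightarrow> v z = 0"
  shows "inv.shifted_row x c (Suc k) l a v (reversal y k N)
    = (\<Prod>i<c. a + x (l + i)) * v (pulled y k N (Suc k))"
proof -
  define Q where "Q j z \<longleftrightarrow> is_inv z \<and> z k = j \<and> (\<forall>i\<ge>k. k \<le> z i)" for j and z :: "nat \<Rightarrow> nat"
  have "inv.shifted_row x c (Suc k) l a v (reversal y k N)
    = (\<Prod>i<c. a + x (l + i)) * v (inv.unmoves (Suc k) c (reversal y k N))"
  proof (rule inv.shifted_row_marker[where Q = Q])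
    fix i z assume i: "Suc k \<le> i" and Q: "Q (Suc i) z"
    then have z: "is_inv z" "z k = Suc i" "z (Suc i) = k" and ge: "\<And>j. k \<le> j \<Longrightarrow> k \<le> z j"
      using is_invD[of z k] by (auto simp: Q_def)
    have "z i \<noteq> k" using is_inv_eq[OF z(1), of i k] z(2) by simp
    then have "inv_desc i z" using ge[of i] i z by (simp add: inv_desc_def)
    moreover have "\<not> fixes_pair i z" using z i by (auto simp: fixes_pair_def)
    then have "Q i (inv_act z i)"
      using i z ge is_inv_inv_act[OF z(1)] by (auto simp: Q_def inv_act_apply transpose_def)
    ultimately show "inv_desc i z \<and> Q i (inv_act z i)" by simp
  next
    fix i j z assume "Suc k \<le> i" "Suc i < j" "Q j z" "inv_desc i z"
    then show "Q j (inv_act z i)"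
      using is_inv_inv_act[of z i] by (auto simp: Q_def inv_act_apply transpose_def)
  next
    fix j z assume "Suc k < j" "Q j z"
    then show "v z = 0" using v by (auto simp: Q_def)
  next
    show "Q (Suc k + c) (reversal y k N)"
    proof -
      have "k \<le> reversal y k N i" if "k \<le> i" for i
        using assms(3)[of i] that unfolding reversal_def by (cases "i \<le> N") simp_all
      moreover have "reversal y k N k = Suc k + c"
        using assms(2) by (simp add: reversal_def)
      ultimately show ?thesis using assms(1) by (simp add: Q_def)
    qed
  qed
  moreover have "inv.unmoves (Suc k) c (reversal y k N) = pulled y k N (Suc k)"
    using unmoves_pulled[of y k N c] assms(1-4) by (simp add: pulled_last[symmetric])
  ultimately show ?thesis by simp
qed

lemma is_inv_id [simp]: "is_inv id" by (simp add: is_inv_def)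

lemma reversal_trivial: "N \<le> k \<Longrightarrow> reversal id k N = id"
  by (auto simp: reversal_def fun_eq_iff)

text \<open>From the identity the letters i, i + 1 in either order lead to the transposition of i
  and i + 2.\<close>

lemma inv_reflect: "inv.B c k y (delta id) = inv.C c k y (delta id)"
proof (rule inv.B_eq_C_reflecting)
  fix i
  have 1: "inv_act id i = swp i" for i
    by (auto simp: fun_eq_iff inv_act_apply fixes_pair_def)
  have 2: "is_inv (swp i)" for i using is_inv_inv_act[of id i] 1 by simp
  have 3: "inv_act (swp i) (Suc i) = inv_act (swp (Suc i)) i"
    by (auto simp: fun_eq_iff inv_act_apply 2 fixes_pair_def transpose_def)
  show "inv_op (Suc i) (inv_op i (delta id)) = inv_op i (inv_op (Suc i) (delta id))"
    by (simp add: inv_op_delta 1 2 3 transpose_def)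
qed

text \<open>After the forced moves k and k + 1 are exchanged, whereas v lives on involutions fixing
  both. So \<open>h k (x l)\<close> has to act once more and remove this cycle, which is the origin
  of the isolated factor \<open>x l\<close>.\<close>

lemma inv_staircase_value:
  "inv.staircase_rows x (Suc c) k l (delta id) (reversal id k (Suc k + c))
    = x l * (\<Prod>i<c. x l + x (Suc l + i))
      * inv.staircase_rows x (c - 1) (k + 2) (Suc l) (delta id) (reversal id (k + 2) (Suc k + c))"
proof -
  define v where "v = inv.staircase_rows x (c - 1) (k + 2) (Suc l) (delta id)"
  define S where "S z \<longleftrightarrow> is_inv z \<and> z k = k \<and> z (Suc k) = Suc k" for z :: "nat \<Rightarrow> nat"
  have v0: "v z = 0" if "\<not> S z" for z
    unfolding v_def
  proof (rule inv.staircase_rows_support[where S = S and ?k0.0 = "k + 2"])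
    fix i z assume "k + 2 \<le> i" "inv_desc i z" "S (inv_act z i)"
    then show "S z" by (auto simp: S_def inv_desc_def inv_act_apply transpose_def split: if_splits)
  qed (use that in \<open>auto simp: S_def delta_def\<close>)
  have rev: "is_inv (reversal id k (Suc k + c))" for k
    by (rule is_inv_reversal) auto
  have hv0: "inv.h k (x l) v z = 0" if "Suc k < j" "is_inv z" "z k = j" for j z
  proof -
    have "\<not> S z" "\<not> S (inv_act z k)"
      using that inv_act_inv_act[OF that(2), of k]
      by (auto simp: S_def inv_act_apply transpose_def split: if_splits)
    then show ?thesis by (simp add: inv.h_move v0)
  qed
  define p where "p = pulled id k (Suc k + c) (Suc k)"
  have p_inv: "is_inv p"
    by (auto simp: is_inv_def p_def fun_eq_iff pulled_def Let_def)
  have pk: "p k = Suc k" "p (Suc k) = k" by (auto simp: p_def pulled_def)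
  have "inv_act p k = reversal id (k + 2) (Suc k + c)"
    using pk by (auto simp: fun_eq_iff inv_act_apply[OF p_inv] fixes_pair_def transpose_def)
      (auto simp: p_def pulled_def reversal_def Let_def)
  then have hp: "inv.h k (x l) v p = x l * v (reversal id (k + 2) (Suc k + c))"
    using v0[of p] pk p_inv by (simp add: inv.h_move S_def inv_desc_def)
  have 1: "inv.staircase_rows x (Suc c) k l (delta id)
      = inv.shifted_row x c (Suc k) (Suc l) (x l) (inv.h k (x l) v)"
    unfolding v_def by (rule inv.staircase_rows_reflect[OF inv_reflect])
  have 2: "inv.shifted_row x c (Suc k) (Suc l) (x l) (inv.h k (x l) v) (reversal id k (Suc k + c))
      = (\<Prod>i<c. x l + x (Suc l + i)) * inv.h k (x l) v p"
    unfolding p_def by (rule inv_marker[OF rev refl]) (auto intro: hv0)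
  show ?thesis unfolding 1 2 hp v_def[symmetric] by (simp only: mult_ac)
qed

lemma is_inv_fpf_min: "is_inv (fpf_min n)"
proof -
  have "fpf_min n (fpf_min n j) = j" for j
    by (auto simp: fpf_min_def; presburger)
  then show ?thesis by (auto simp: is_inv_def fun_eq_iff)
qed

lemma fpf_min_bounds:
  assumes "odd k" "k \<le> 2 * n + 1"
  shows "fpf_min n j < k \<longleftrightarrow> j < k"
proof -
  show ?thesis using assms by (auto simp: fpf_min_def; presburger)
qed

lemma fpf_min_above: "2 * n < fpf_min n j \<longleftrightarrow> 2 * n < j"
  by (auto simp: fpf_min_def; presburger)

lemma fpf_min_odd: "odd i \<Longrightarrow> i < 2 * n \<Longrightarrow> fpf_min n i = Suc i \<and> fpf_min n (Suc i) = i"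
  by (auto simp: fpf_min_def; presburger)

lemma fpf_op_odd:
  "odd i \<Longrightarrow> i < 2 * n \<Longrightarrow> inv_op i (delta (fpf_min n)) = (\<lambda>z. 0)"
  using fpf_min_odd[of i n] by (simp add: inv_op_delta is_inv_fpf_min)

text \<open>Four consecutive points matter: after acting at a + 1 the points a, a + 2 and a + 1, a +
  3 are matched, and acting at a or at a + 2 both give the nested matching of a, a + 3 and a + 1, a
  + 2.\<close>

lemma fpf_reflect:
  assumes "odd k" "k + 2 * d < 2 * n"
  shows "inv.B (Suc (2 * d)) k y (delta (fpf_min n)) = inv.C (Suc (2 * d)) k y (delta (fpf_min n))"
proof (rule inv.B_eq_C_alternating)
  let ?v = "fpf_min n"
  show "inv_op (k + i) (delta ?v) = (\<lambda>z. 0)" if "even i" "i \<le> 2 * d" for i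
    using that assms by (intro fpf_op_odd) auto
  show "inv_op (k + i - 1) (inv_op (k + i) (delta ?v)) = inv_op (k + i + 1) (inv_op (k + i) (delta ?v))"
    if "odd i" "i < 2 * d" for i
  proof -
    define a where "a = k + i - 1"
    have a: "k + i = Suc a" "odd a" "Suc (Suc a) < 2 * n" using that assms unfolding a_def by presburger+
    note v = is_inv_fpf_min[of n]
    have val: "?v a = Suc a" "?v (Suc a) = a" "?v (Suc (Suc a)) = Suc (Suc (Suc a))"
      "?v (Suc (Suc (Suc a))) = Suc (Suc a)"
      using fpf_min_odd[of a n] fpf_min_odd[of "Suc (Suc a)" n] a by auto
    have nf: "\<not> fixes_pair (Suc a) ?v" by (simp add: fixes_pair_def val)
    define w where "w = inv_act ?v (Suc a)"
    have w: "is_inv w" unfolding w_def by (rule is_inv_inv_act[OF v])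
    have wv: "w a = Suc (Suc a)" "w (Suc a) = Suc (Suc (Suc a))" "w (Suc (Suc a)) = a"
      "w (Suc (Suc (Suc a))) = Suc a"
      using nf by (auto simp: w_def inv_act_apply[OF v] val transpose_def)
    have nf': "\<not> fixes_pair a w" "\<not> fixes_pair (Suc (Suc a)) w"
      by (simp_all add: fixes_pair_def wv)
    have "inv_act w a = inv_act w (Suc (Suc a))"
    proof
      fix j
      have wi: "w j = p \<longleftrightarrow> j = w p" for p by (rule is_inv_eq[OF w])
      consider "j \<in> {a, Suc a, Suc (Suc a), Suc (Suc (Suc a))}"
        | "j \<notin> {a, Suc a, Suc (Suc a), Suc (Suc (Suc a))}" by blast
      then show "inv_act w a j = inv_act w (Suc (Suc a)) j"
      proof cases
        case 1
        then show ?thesis by (auto simp: inv_act_apply[OF w] nf' wv transpose_def)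
      next
        case 2
        then have "w j \<notin> {a, Suc a, Suc (Suc a), Suc (Suc (Suc a))}" using wi wv by auto
        then show ?thesis using 2 by (simp add: inv_act_apply[OF w] nf' transpose_def)
      qed
    qed
    then show ?thesis
      unfolding a by (simp add: inv_op_delta v val w_def[symmetric] w wv)
  qed
qed

lemma fpf_staircase_value:
  assumes k: "odd k" "k + c < 2 * n" "2 * n = Suc k + c"
  shows "inv.staircase_rows x (Suc c) k l (delta (fpf_min n)) (reversal (fpf_min n) k (Suc k + c))
    = (\<Prod>i<c. x l + x (Suc l + i))
      * inv.staircase_rows x (c - 1) (k + 2) (Suc l) (delta (fpf_min n))
          (reversal (fpf_min n) (k + 2) (Suc k + c))"
proof -
  let ?y = "fpf_min n"
  define v where "v = inv.staircase_rows x (c - 1) (k + 2) (Suc l) (delta ?y)"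
  define S where "S z \<longleftrightarrow> z k = Suc k" for z :: "nat \<Rightarrow> nat"
  have y: "?y j < k \<longleftrightarrow> j < k" "Suc k + c < ?y j \<longleftrightarrow> Suc k + c < j" for j
    using fpf_min_bounds[of k n j] fpf_min_above[of n j] k by simp_all
  have v0: "v z = 0" if "\<not> S z" for z
    unfolding v_def
  proof (rule inv.staircase_rows_support[where S = S and ?k0.0 = "k + 2"])
    fix i z assume "k + 2 \<le> i" "inv_desc i z" "S (inv_act z i)"
    then show "S z" by (auto simp: S_def inv_desc_def inv_act_apply transpose_def split: if_splits)
  next
    show "delta ?y z = 0" if "\<not> S z" for z
      using that fpf_min_odd[of k n] k by (auto simp: S_def delta_def)
  qed (use that in auto)
  \<comment> \<open>Since k is odd, k and k + 1 are already matched in v_n, so this factor is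
    trivial and no isolated \<open>x l\<close> appears.\<close>
  have "inv.h k (x l) v = v"
    unfolding v_def by (subst inv.h_staircase_comm) (use k in \<open>simp_all add: inv.h_def fpf_op_odd\<close>)
  moreover obtain d where d: "c = 2 * d"
  proof -
    have "even (Suc k + c)" using k(3) by (metis even_mult_iff even_numeral)
    then have "even c" using k(1) by simp
    then show ?thesis using that by (auto elim: evenE)
  qed
  ultimately have 1: "inv.staircase_rows x (Suc c) k l (delta ?y)
      = inv.shifted_row x c (Suc k) (Suc l) (x l) v"
    using inv.staircase_rows_reflect[of c k x l "delta ?y"] fpf_reflect[OF k(1) k(2)[unfolded d], of "x l"]
    by (simp only: v_def d)
  have 2: "inv.shifted_row x c (Suc k) (Suc l) (x l) v (reversal ?y k (Suc k + c))
      = (\<Prod>i<c. x l + x (Suc l + i)) * v (pulled ?y k (Suc k + c) (Suc k))"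
    by (rule inv_marker[OF is_inv_reversal[OF is_inv_fpf_min y] refl y])
      (auto intro!: v0 simp: S_def)
  have "pulled ?y k (Suc k + c) (Suc k) = reversal ?y (k + 2) (Suc k + c)"
    using fpf_min_odd[of k n] k by (auto simp: fun_eq_iff pulled_def reversal_def Let_def)
  then show ?thesis unfolding 1 2 by (simp add: v_def)
qed

text \<open>The 0-1-sequences $\ldots 0101\, 1^c 0^c\, 0101 \ldots$\<close>

definition block :: "nat \<Rightarrow> nat \<Rightarrow> nat \<Rightarrow> nat" where
  "block k c j = (if k \<le> j \<and> j < k + 2 * c then (if j < k + c then 1 else 0)
     else if even j then 1 else 0)"

lemma seq_op_delta:
  "seq_op i (delta b) = (if b i < b (Suc i) then delta (seq_move i b) else (\<lambda>z. 0))"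
proof
  fix z
  have "seq_move i z = b \<longleftrightarrow> z = seq_move i b" by auto
  then show "seq_op i (delta b) z = (if b i < b (Suc i) then delta (seq_move i b) else (\<lambda>z. 0)) z"
    by (auto simp: move_op_def seq_desc_def delta_def)
qed

lemma block_reflect: "sq.B c k y (delta (block 0 0)) = sq.C c k y (delta (block 0 0))"
  by (rule sq.B_eq_C_reflecting) (simp add: seq_op_delta block_def sq.u_zero)

text \<open>The marker is the first zero of the block, which has to pass all the ones before it. Its
  last move puts it at the odd place k, after which places k and k + 1 agree with the alternating
  background.\<close>

lemma block_staircase_value:
  assumes k: "odd k"
  shows "sq.staircase_rows x (Suc (2 * c)) k l (delta (block 0 0)) (block k (Suc c))
    = x l * (\<Prod>i<c. x l + x (Suc l + i))
      * sq.staircase_rows x (2 * c - 1) (k + 2) (Suc l) (delta (block 0 0)) (block (k + 2) c)"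
proof -
  define v where "v = sq.staircase_rows x (2 * c - 1) (k + 2) (Suc l) (delta (block 0 0))"
  define S where "S z \<longleftrightarrow> z k = 0" for z :: "nat \<Rightarrow> nat"
  have v0: "v z = 0" if "\<not> S z" for z
    unfolding v_def
  proof (rule sq.staircase_rows_support[where S = S and ?k0.0 = "k + 2"])
    fix i z assume "k + 2 \<le> i" "seq_desc i z" "S (seq_move i z)"
    then show "S z" by (auto simp: S_def)
  qed (use that k in \<open>auto simp: S_def delta_def block_def\<close>)
  define hv where "hv = sq.h k (x l) v"
  define Q where "Q j b \<longleftrightarrow> b j = 0 \<and> (\<forall>i. k \<le> i \<and> i < j \<longrightarrow> b i = 1)" for j and b :: "nat \<Rightarrow> nat"
  define mid where "mid p j = (if j = p then 0 else if j = k + Suc c then 1 else block k (Suc c) j)"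
    for p j
  have hv0: "hv b = 0" if "Suc k < j" "Q j b" for j b
    using that v0[of b] by (auto simp: hv_def sq.h_move Q_def S_def seq_desc_def)
  have 1: "sq.staircase_rows x (Suc (2 * c)) k l (delta (block 0 0))
      = sq.shifted_row x (2 * c) (Suc k) (Suc l) (x l) hv"
    unfolding v_def hv_def by (rule sq.staircase_rows_reflect[OF block_reflect])
  \<comment> \<open>The upper half of the factors acts inside the run of zeros, where there is no
    descent.\<close>
  have 2: "sq.shifted_row x (c + c) (Suc k) (Suc l) (x l) hv (block k (Suc c))
      = sq.shifted_row x c (Suc k) (Suc l) (x l) hv (block k (Suc c))"
    by (rule sq.shifted_row_trivial) (auto simp: seq_desc_def block_def)
  have 3: "sq.shifted_row x c (Suc k) (Suc l) (x l) hv (block k (Suc c))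
      = (\<Prod>i<c. x l + x (Suc l + i)) * hv (sq.unmoves (Suc k) c (block k (Suc c)))"
  proof (rule sq.shifted_row_marker[where Q = Q])
    show "seq_desc i z \<and> Q i (seq_move i z)" if "Suc k \<le> i" "Q (Suc i) z" for i z
      using that by (auto simp: Q_def seq_desc_def)
    show "Q j (seq_move i z)" if "Suc k \<le> i" "Suc i < j" "Q j z" "seq_desc i z" for i j z
      using that by (auto simp: Q_def seq_desc_def)
    show "hv z = 0" if "Suc k < j" "Q j z" for j z using hv0 that .
    show "Q (Suc k + c) (block k (Suc c))" by (auto simp: Q_def block_def)
  qed
  have "sq.unmoves (Suc k) d (mid (Suc k + d)) = mid (Suc k)" if "d \<le> c" for d
    using that
  proof (induction d)
    case (Suc d)
    have "seq_move (Suc k + d) (mid (Suc k + Suc d)) = mid (Suc k + d)"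
      using Suc.prems by (auto simp: fun_eq_iff mid_def block_def transpose_def)
    then show ?case using Suc by (simp del: add_Suc seq_move_apply)
  qed simp
  from this[of c] have 4: "sq.unmoves (Suc k) c (block k (Suc c)) = mid (Suc k)"
  proof -
    have "mid (Suc k + c) = block k (Suc c)" by (auto simp: mid_def block_def fun_eq_iff)
    then show ?thesis using \<open>c \<le> c \<Longrightarrow> _\<close> by simp
  qed
  have "seq_move k (mid (Suc k)) = block (k + 2) c"
    using k by (auto simp: fun_eq_iff mid_def block_def transpose_def)
  moreover have "seq_desc k (mid (Suc k))" "mid (Suc k) k = 1"
    by (auto simp: seq_desc_def mid_def block_def)
  ultimately have "hv (mid (Suc k)) = x l * v (block (k + 2) c)"
    using v0[of "mid (Suc k)"] by (simp add: hv_def sq.h_move S_def)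
  with 1 2 3 4 show ?thesis by (simp add: v_def mult_2 del: sq.shifted_row.simps)
qed

section \<open>Cauchy products as coefficients at the longest permutation\<close>

lemma inj_seq_move [simp]: "inj (seq_move i b) \<longleftrightarrow> inj b"
proof -
  have *: "inj (seq_move i b)" if "inj b" for b
    unfolding seq_move_def by (rule inj_compose[OF that]) simp
  show ?thesis using *[of b] *[of "seq_move i b"] by auto
qed

text \<open>Each dual row is pushed through the staircase and leaves a shifted row, whose factors
  are all forced: the value k has to go from the last place of the reversal to place k.\<close>

lemma cauchy_value:
  "sq.staircase_rows x c k l (sq.dual_rows x c k l' (delta id)) (reversal id k (k + c))
    = (\<Prod>a<c. \<Prod>b<c - a. x (l' + a) + x (l + b))"
proof (induction c arbitrary: k l')
  case 0
  have "reversal id k k = id" by (rule reversal_trivial) simp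
  then show ?case by (simp del: id_apply seq_move_apply)
next
  case (Suc c)
  define v where "v = sq.staircase_rows x c (Suc k) l (sq.dual_rows x c (Suc k) (Suc l') (delta id))"
  define N where "N = k + Suc c"
  define S where "S w \<longleftrightarrow> w k = k" for w :: "nat \<Rightarrow> nat"
  have closed: "S w" if "Suc k \<le> i" "S (seq_move i w)" for i w
    using that by (auto simp: S_def)
  have v0: "v w = 0" if "\<not> S w" for w
    unfolding v_def
  proof (rule sq.staircase_rows_support[where S = S and ?k0.0 = "Suc k"])
    show "sq.dual_rows x c (Suc k) (Suc l') (delta id) z = 0" if "\<not> S z" for z
      by (rule sq.dual_rows_support[where S = S and ?k0.0 = "Suc k"])
        (use closed that in \<open>auto simp: S_def delta_def\<close>)
  qed (use closed that in auto)
  define Q where "Q j w \<longleftrightarrow> w j = k \<and> inj w \<and> (\<forall>i\<ge>k. k \<le> w i)" for j and w :: "nat \<Rightarrow> nat"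
  define mid where "mid p j = (if j = p then k else if k \<le> j \<and> j < p then k + N - j
    else if p < j \<and> j \<le> N then k + N - j + 1 else j)" for p j
  have 1: "sq.shifted_row x (Suc c) k l (x l') v (reversal id k N)
      = (\<Prod>i<Suc c. x l' + x (l + i)) * v (sq.unmoves k (Suc c) (reversal id k N))"
  proof (rule sq.shifted_row_marker[where Q = Q])
    show "seq_desc i z \<and> Q i (seq_move i z)" if "k \<le> i" "Q (Suc i) z" for i z
    proof -
      have "z i \<noteq> z (Suc i)" using that(2) injD[of z i "Suc i"] by (auto simp: Q_def)
      then show ?thesis
        using that by (auto simp: Q_def seq_desc_def transpose_def le_neq_implies_less)
    qed
    show "Q j (seq_move i z)" if "k \<le> i" "Suc i < j" "Q j z" "seq_desc i z" for i j z
      using that by (auto simp: Q_def transpose_def)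
    show "v z = 0" if "k < j" "Q j z" for j z
    proof (rule v0)
      show "\<not> S z" using that injD[of z j k] by (auto simp: Q_def S_def)
    qed
    show "Q (k + Suc c) (reversal id k N)"
      by (auto simp: Q_def N_def reversal_def inj_def split: if_splits)
  qed
  have "sq.unmoves k d (mid (k + d)) = mid k" if "d \<le> Suc c" for d
    using that
  proof (induction d)
    case (Suc d)
    have "seq_move (k + d) (mid (k + Suc d)) = mid (k + d)"
      using Suc.prems by (auto simp: fun_eq_iff mid_def transpose_def N_def)
    then show ?case using Suc by (simp del: seq_move_apply)
  qed simp
  from this[of "Suc c"] have 2: "sq.unmoves k (Suc c) (mid N) = mid k"
    by (simp add: N_def)
  have 3: "mid N = reversal id k N" "mid k = reversal id (Suc k) N"
    by (auto simp: mid_def reversal_def fun_eq_iff N_def)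
  have "sq.staircase_rows x (Suc c) k l (sq.dual_rows x (Suc c) k l' (delta id)) (reversal id k N)
      = (\<Prod>i<Suc c. x l' + x (l + i)) * v (reversal id (Suc k) (Suc k + c))"
    unfolding sq.staircase_rows_dual_rows v_def[symmetric] 1 2[unfolded 3] by (simp add: N_def)
  also have "v (reversal id (Suc k) (Suc k + c)) = (\<Prod>a<c. \<Prod>b<c - a. x (Suc l' + a) + x (l + b))"
    unfolding v_def by (rule Suc.IH)
  also have "(\<Prod>i<Suc c. x l' + x (l + i)) * \<dots> = (\<Prod>a<Suc c. \<Prod>b<Suc c - a. x (l' + a) + x (l + b))"
    by (subst (2) prod.lessThan_Suc_shift) simp
  finally show ?case
    unfolding N_def .
qed

section \<open>The Nakayama automorphism\<close>

declare seq_move_apply [simp del] id_apply [simp del]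

definition left_desc :: "nat \<Rightarrow> (nat \<Rightarrow> nat) \<Rightarrow> bool" where
  "left_desc i w \<longleftrightarrow> (\<exists>a b. a < b \<and> w a = Suc i \<and> w b = i)"

text \<open>Left multiplication exchanges values where \<open>seq_op\<close> exchanges places. On
  injective sequences each of the two values occurs at most once.\<close>

definition left_op :: "nat \<Rightarrow> ((nat \<Rightarrow> nat) \<Rightarrow> real) \<Rightarrow> (nat \<Rightarrow> nat) \<Rightarrow> real" where
  "left_op i v w = (if inj w \<and> left_desc i w then v (swp i \<circ> w) else 0)"

lemma left_op_lin: "lin_op (left_op i)"
  by (simp add: lin_op_def left_op_def fun_eq_iff)

text \<open>Left and right multiplication commute. The delicate case has the values i, i + 1 at the
  places j, j + 1; there both composites vanish.\<close>

lemma left_op_seq_op: "left_op i (seq_op j v) = seq_op j (left_op i v)"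
proof
  fix w
  show "left_op i (seq_op j v) w = seq_op j (left_op i v) w"
  proof (cases "inj w")
    case inj: True
    have "left_desc i w \<and> seq_desc j (swp i \<circ> w) \<longleftrightarrow> seq_desc j w \<and> left_desc i (seq_move j w)"
    proof (cases "{w j, w (Suc j)} = {i, Suc i}")
      case True
      then consider "w j = i" "w (Suc j) = Suc i" | "w j = Suc i" "w (Suc j) = i"
        by (auto simp: doubleton_eq_iff)
      then show ?thesis
      proof cases
        case 1
        have "a = Suc j \<and> b = j" if "w a = Suc i" "w b = i" for a b
          using 1 that injD[OF inj, of a "Suc j"] injD[OF inj, of b j] by simp
        then have "\<not> left_desc i w" unfolding left_desc_def by (metis lessI less_asym)
        then show ?thesis using 1 by (simp add: seq_desc_def)
      next
        case 2
        have "a = Suc j \<and> b = j" if "w (swp j a) = Suc i" "w (swp j b) = i" for a b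
        proof -
          have "swp j a = j" "swp j b = Suc j"
            using 2 that injD[OF inj, of "swp j a" j] injD[OF inj, of "swp j b" "Suc j"] by simp_all
          then have "a = swp j j" "b = swp j (Suc j)" by (metis transpose_involutory)+
          then show ?thesis by simp
        qed
        then have "\<not> left_desc i (seq_move j w)"
          unfolding left_desc_def seq_move_apply by (metis lessI less_asym)
        then show ?thesis using 2 by (simp add: seq_desc_def)
      qed
    next
      case False
      have 1: "seq_desc j (swp i \<circ> w) \<longleftrightarrow> seq_desc j w"
        unfolding seq_desc_def o_apply by (rule swp_less) (use False in auto)
      have lt: "swp j a < swp j b \<longleftrightarrow> a < b" if "{w a, w b} = {i, Suc i}" for a b
        by (rule swp_less) (use False that in auto)
      have "left_desc i (seq_move j w) \<longleftrightarrow> left_desc i w"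
      proof
        assume "left_desc i w"
        then obtain a b where "a < b" "w a = Suc i" "w b = i" unfolding left_desc_def by blast
        then show "left_desc i (seq_move j w)" unfolding left_desc_def seq_move_apply
          using lt[of a b] by (intro exI[of _ "swp j a"] exI[of _ "swp j b"]) auto
      next
        assume "left_desc i (seq_move j w)"
        then obtain a b where "a < b" "w (swp j a) = Suc i" "w (swp j b) = i"
          unfolding left_desc_def seq_move_apply by auto
        then show "left_desc i w" unfolding left_desc_def
          using lt[of "swp j a" "swp j b"] by (intro exI[of _ "swp j a"] exI[of _ "swp j b"]) auto
      qed
      then show ?thesis using 1 by blast
    qed
    moreover have "seq_move j (swp i \<circ> w) = swp i \<circ> seq_move j w"
      by (simp add: seq_move_def o_assoc)
    ultimately show ?thesis
      by (auto simp: left_op_def move_op_def inj)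
  qed (simp add: left_op_def move_op_def)
qed

lemma seq_op_delta_id: "seq_op i (delta id) = left_op i (delta id)"
proof
  fix w
  have "left_op i (delta id) w = delta (seq_move i id) w"
  proof (cases "w = seq_move i id")
    case True
    moreover have "inj (seq_move i id)" by simp
    moreover have "\<exists>a b. a < b \<and> seq_move i id a = Suc i \<and> seq_move i id b = i"
      by (rule exI[of _ i], rule exI[of _ "Suc i"]) (simp add: seq_move_apply id_apply)
    moreover have "swp i \<circ> seq_move i id = id"
      by (simp add: seq_move_def)
    ultimately show ?thesis
      by (simp add: left_op_def left_desc_def)
  next
    case False
    have "swp i \<circ> w \<noteq> id"
    proof
      assume e: "swp i \<circ> w = id"
      have "w x = seq_move i id x" for x
        using fun_cong[OF e, of x] by (metis comp_apply id_apply seq_move_apply transpose_involutory)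
      then show False using False by blast
    qed
    then show ?thesis using False by (simp add: left_op_def del: o_apply)
  qed
  then show "seq_op i (delta id) w = left_op i (delta id) w"
    by (simp add: seq_op_delta id_apply)
qed

text \<open>For the longest element w this is s_i w = w s_(q-i).\<close>

lemma left_op_longest:
  assumes "1 \<le> i" "i < q"
  shows "left_op i v (reversal id 1 q) = seq_op (q - i) v (reversal id 1 q)"
proof -
  let ?w = "reversal id 1 q"
  have "inj ?w" by (auto simp: inj_def reversal_def id_apply split: if_splits)
  moreover have w: "?w (q - i) = Suc i" "?w (Suc (q - i)) = i"
    using assms by (auto simp: reversal_def)
  moreover have "\<exists>a b. a < b \<and> ?w a = Suc i \<and> ?w b = i"
    using w by blast
  moreover have "swp i \<circ> ?w = seq_move (q - i) ?w"
  proof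
    fix j
    have inv: "?w (?w j) = j" for j by (auto simp: reversal_def id_apply)
    consider "j = q - i" | "j = Suc (q - i)" | "j \<noteq> q - i" "j \<noteq> Suc (q - i)" by blast
    then show "(swp i \<circ> ?w) j = seq_move (q - i) ?w j"
    proof cases
      case 3
      then have "?w j \<noteq> i" "?w j \<noteq> Suc i" using w inv by metis+
      then show ?thesis using 3 by (simp add: seq_move_apply)
    qed (use w in \<open>simp_all add: seq_move_apply\<close>)
  qed
  ultimately show ?thesis
    by (simp add: left_op_def left_desc_def move_op_def seq_desc_def)
qed

definition right_op :: "(((nat \<Rightarrow> nat) \<Rightarrow> real) \<Rightarrow> (nat \<Rightarrow> nat) \<Rightarrow> real) \<Rightarrow> bool" where
  "right_op b \<longleftrightarrow> lin_op b \<and> (\<forall>i v. b (left_op i v) = left_op i (b v))"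

lemma right_op_comp: "right_op f \<Longrightarrow> right_op g \<Longrightarrow> right_op (\<lambda>v. f (g v))"
  using lin_op_comp[of f g] by (simp add: right_op_def)

definition left_h :: "nat \<Rightarrow> real \<Rightarrow> ((nat \<Rightarrow> nat) \<Rightarrow> real) \<Rightarrow> (nat \<Rightarrow> nat) \<Rightarrow> real" where
  "left_h i y v w = v w + y * left_op i v w"

lemma right_op_left_h:
  assumes "right_op b" shows "b (left_h i y v) = left_h i y (b v)"
proof -
  have e: "left_h i y v = (\<lambda>w. 1 * v w + y * left_op i v w)" for v
    by (simp add: left_h_def fun_eq_iff)
  have "lin_op b" "b (left_op i v) = left_op i (b v)" using assms by (auto simp: right_op_def)
  then show ?thesis unfolding e using lin_opD[of b 1 v y "left_op i v"] by simp
qed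

lemma right_op_h: "right_op (sq.h i y)"
proof -
  have "sq.h i y (left_op j v) = left_op j (sq.h i y v)" for j v
    using lin_opD[OF left_op_lin, of j 1 v y "seq_op i v"]
    by (simp add: sq.h_def left_op_seq_op)
  then show ?thesis by (simp add: right_op_def sq.h_lin)
qed

lemma right_op_B: "right_op (sq.B c k y)"
proof (induction c arbitrary: k)
  case 0
  show ?case unfolding right_op_def by (intro conjI allI sq.B_lin) simp
next
  case (Suc c)
  show ?case using right_op_comp[OF right_op_h Suc] by (simp add: right_op_def)
qed

lemma right_op_C: "right_op (sq.C c k y)"
proof (induction c arbitrary: k)
  case 0
  show ?case unfolding right_op_def by (intro conjI allI sq.C_lin) simp
next
  case (Suc c)
  show ?case using right_op_comp[OF Suc right_op_h] by (simp add: right_op_def)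
qed

lemma right_op_brows: "right_op (sq.brows N r x js)"
proof (induction js)
  case Nil
  show ?case unfolding right_op_def by (intro conjI allI sq.brows_lin) simp
next
  case (Cons j js)
  show ?case using right_op_comp[OF Cons right_op_B] by (simp add: right_op_def)
qed

lemma right_op_crows: "right_op (sq.crows N r x js)"
proof (induction js)
  case Nil
  show ?case unfolding right_op_def by (intro conjI allI sq.crows_lin) simp
next
  case (Cons j js)
  show ?case using right_op_comp[OF right_op_C Cons] by (simp add: right_op_def)
qed

primrec left_row :: "nat \<Rightarrow> nat \<Rightarrow> real \<Rightarrow> ((nat \<Rightarrow> nat) \<Rightarrow> real) \<Rightarrow> (nat \<Rightarrow> nat) \<Rightarrow> real" where
  "left_row 0 k y v = v"
| "left_row (Suc c) k y v = left_h k y (left_row c (Suc k) y v)"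

lemma right_op_left_row: "right_op b \<Longrightarrow> b (left_row c k y v) = left_row c k y (b v)"
  by (induction c arbitrary: k) (simp_all add: right_op_left_h)

text \<open>At the identity a right factor equals the left factor of the same index, and a left
  factor commutes with everything applied afterwards. Pulling them out one by one reverses their
  order.\<close>

lemma C_delta_id: "right_op b \<Longrightarrow> b (sq.C c k y (delta id)) = left_row c k y (b (delta id))"
proof (induction c arbitrary: k b)
  case (Suc c)
  have "sq.h k y (delta id) = left_h k y (delta id)"
    by (simp add: sq.h_def left_h_def seq_op_delta_id fun_eq_iff)
  then have "b (sq.C (Suc c) k y (delta id)) = b (sq.C c (Suc k) y (left_h k y (delta id)))"
    by simp
  also have "\<dots> = left_h k y (b (sq.C c (Suc k) y (delta id)))"
    using right_op_left_h[OF right_op_comp[OF Suc.prems right_op_C]] by simp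
  finally show ?case using Suc by simp
qed simp

text \<open>Evaluation at the longest element trades the left factor of index i for the right factor
  of index q - i. The order is reversed once more, so the indices from k to q - 1 become an ordinary
  row from 1 to c.\<close>

lemma left_row_longest:
  "1 \<le> k \<Longrightarrow> k + c = q \<Longrightarrow> left_row c k y v (reversal id 1 q) = sq.B c 1 y v (reversal id 1 q)"
proof (induction c arbitrary: k v)
  case (Suc c)
  have last: "sq.B (Suc c) k y v = sq.B c k y (sq.h (k + c) y v)" for c k v
    by (induction c arbitrary: k) auto
  have qk: "q - k = Suc c" using Suc.prems by simp
  have "left_row (Suc c) k y v (reversal id 1 q)
      = sq.h (Suc c) y (left_row c (Suc k) y v) (reversal id 1 q)"
    using left_op_longest[of k q] Suc.prems qk by (simp add: left_h_def sq.h_def)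
  also have "\<dots> = left_row c (Suc k) y (sq.h (Suc c) y v) (reversal id 1 q)"
    by (simp add: right_op_left_row[OF right_op_h])
  also have "\<dots> = sq.B c 1 y (sq.h (Suc c) y v) (reversal id 1 q)"
    by (rule Suc.IH) (use Suc.prems in auto)
  finally show ?case using last[of c 1 v] by simp
qed simp

text \<open>The Nakayama automorphism of the nil-Coxeter algebra moves a factor from the left end of a
  word for the longest element to its right end, exchanging the generators \<open>i\<close> and \<open>q - i\<close>.\<close>

lemma crows_longest:
  assumes "1 \<le> q"
  shows "right_op b \<Longrightarrow> b (sq.crows q (\<lambda>_. 1) x js (delta id)) (reversal id 1 q)
    = sq.brows q (\<lambda>_. 1) x (rev js) (b (delta id)) (reversal id 1 q)"
proof (induction js arbitrary: b rule: rev_induct)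
  case (snoc j js)
  let ?b = "\<lambda>v. b (sq.crows q (\<lambda>_. 1) x js v)"
  have b: "right_op ?b" by (rule right_op_comp[OF snoc.prems right_op_crows])
  have "b (sq.crows q (\<lambda>_. 1) x (js @ [j]) (delta id)) (reversal id 1 q)
      = ?b (sq.C (q - 1) 1 (x j) (delta id)) (reversal id 1 q)"
    by (simp add: sq.crows_append)
  \<comment> \<open>The innermost reversed row becomes a left row, passes all operators and returns
    as the outermost ordinary row.\<close>
  also have "\<dots> = sq.B (q - 1) 1 (x j) (?b (delta id)) (reversal id 1 q)"
    unfolding C_delta_id[OF b] by (rule left_row_longest) (use assms in auto)
  also have "\<dots> = sq.brows q (\<lambda>_. 1) x (rev (js @ [j])) (b (delta id)) (reversal id 1 q)"
    using snoc.IH[OF right_op_comp[OF right_op_B snoc.prems]] by simp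
  finally show ?case .
qed simp

text \<open>The Stanley symmetric function of the longest element of S_q, restricted to m
  variables.\<close>

definition stanley_long :: "nat \<Rightarrow> nat \<Rightarrow> (nat \<Rightarrow> real) \<Rightarrow> real" where
  "stanley_long q m x = sq.full_rows q m x (delta id) (reversal id 1 q)"

lemma brows_mset:
  assumes "mset is = mset js"
  shows "sq.brows N (\<lambda>_. k) x is v = sq.brows N (\<lambda>_. k) x js v"
proof -
  have "fold (\<lambda>j. sq.B (N - k) k (x j)) is = fold (\<lambda>j. sq.B (N - k) k (x j)) js"
    by (rule fold_multiset_equiv[OF _ assms]) (auto simp: fun_eq_iff intro: fun_cong[OF sq.B_comm])
  then show ?thesis by (simp add: sq.brows_def)
qed

lemma upt_append: "a \<le> b \<Longrightarrow> b \<le> c \<Longrightarrow> [a..<c] = [a..<b] @ [b..<c]"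
  by (metis le_Suc_ex upt_add_eq_append)

definition cauchy :: "nat \<Rightarrow> nat \<Rightarrow> nat \<Rightarrow> (nat \<Rightarrow> real) \<Rightarrow> real" where
  "cauchy c l l' x = (\<Prod>a<c. \<Prod>b<c - a. x (l' + a) + x (l + b))"

text \<open>Only symmetrization inside the blocks 1..l and l+1..m is used, so P need not be
  invariant under the swap at l. It completes the staircase in the first block and the dual
  staircase in the second; \<open>crows_longest\<close> turns the latter into ordinary rows, and the
  result is symmetric in all variables.\<close>

lemma symz_cauchy:
  assumes q: "1 \<le> q" "q \<le> Suc l" "l + q \<le> Suc m" and inj: "inj_on x {1..m}"
    and P: "\<And>j x. 1 \<le> j \<Longrightarrow> j < m \<Longrightarrow> j \<noteq> l \<Longrightarrow> P (x \<circ> swp j) = P x"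
  shows "symz m (\<lambda>x. P x * cauchy (q - 1) 1 (Suc l) x) x = symz m (\<lambda>x. P x * stanley_long q m x) x"
proof -
  let ?w = "reversal id 1 q" and ?e = "delta (id :: nat \<Rightarrow> nat)"
  define r where "r j = 1 + (j - 1)" for j :: nat
  define r' where "r' j = 1 + (j - Suc l)" for j
  define cr where "cr \<rho> x = sq.crows q \<rho> x [Suc l..<Suc m] ?e" for \<rho> :: "nat \<Rightarrow> nat" and x
  have split: "[1..<Suc l] = [1..<1 + (q - 1)] @ [1 + (q - 1)..<Suc l]"
    "[Suc l..<Suc m] = [Suc l..<Suc l + (q - 1)] @ [Suc l + (q - 1)..<Suc m]"
    using q by (auto intro!: upt_append simp del: upt_Suc)
  have 1: "cauchy (q - 1) 1 (Suc l) x = sq.brows q r x [1..<Suc l] (cr r' x) ?w" for x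
  proof -
    have "cauchy (q - 1) 1 (Suc l) x
        = sq.staircase_rows x (q - 1) 1 1 (sq.dual_rows x (q - 1) 1 (Suc l) ?e) ?w"
      using cauchy_value[of x "q - 1" 1 1 "Suc l"] q(1) by (simp add: cauchy_def del: id_apply)
    also have "sq.dual_rows x (q - 1) 1 (Suc l) ?e = sq.crows q r' x [Suc l..<Suc l + (q - 1)] ?e"
      unfolding r'_def by (rule sq.dual_rows_crows) simp
    also have "\<dots> = cr r' x"
      unfolding cr_def split(2) sq.crows_append
      by (subst (2) sq.crows_trivial) (auto simp: r'_def)
    also have "sq.staircase_rows x (q - 1) 1 1 (cr r' x) = sq.brows q r x [1..<1 + (q - 1)] (cr r' x)"
      unfolding r_def by (rule sq.staircase_rows_brows) simp
    also have "\<dots> = sq.brows q r x [1..<Suc l] (cr r' x)"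
      unfolding split(1) sq.brows_append
      by (subst (2) sq.brows_trivial) (auto simp: r_def)
    finally show ?thesis .
  qed
  have "symz m (\<lambda>x. P x * cauchy (q - 1) 1 (Suc l) x) x
      = symz m (\<lambda>x. P x * sq.brows q r x [1..<Suc l] (cr r' x) ?w) x"
    unfolding 1 ..
  also have "\<dots> = symz m (\<lambda>x. P x * sq.brows q (\<lambda>j. if 1 \<le> j \<and> j \<le> l then 1 else r j) x [1..<Suc l] (cr r' x) ?w) x"
  proof (rule sq.symz_brows[where P = P and w = "cr r'" and r = r and a = 1 and b = l and c = 1
      and d = "Suc l" and k = 1 and N = q and m = m and x = x and z = ?w, symmetric])
    show "cr r' (x \<circ> swp j) = cr r' x" if "1 \<le> j" "j < l" for j x
      unfolding cr_def by (rule sq.crows_cong) (use that in auto)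
  qed (use q inj P in \<open>auto simp: r_def\<close>)
  also have "\<dots> = symz m (\<lambda>x. P x * sq.brows q (\<lambda>_. 1) x [1..<Suc l] (cr r' x) ?w) x"
  proof -
    have "sq.brows q (\<lambda>j. if 1 \<le> j \<and> j \<le> l then 1 else r j) x [1..<Suc l] v
        = sq.brows q (\<lambda>_. 1) x [1..<Suc l] v" for x v
      by (rule sq.brows_cong) auto
    then show ?thesis by simp
  qed
  also have "\<dots> = symz m (\<lambda>x. P x * sq.brows q (\<lambda>_. 1) x [1..<Suc l]
      (cr (\<lambda>j. if Suc l \<le> j \<and> j \<le> m then 1 else r' j) x) ?w) x"
    unfolding cr_def
  proof (rule sq.symz_crows[where P = P and T = "\<lambda>x. sq.brows q (\<lambda>_. 1) x [1..<Suc l]" and r = r' and a = "Suc l"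
      and b = m and c = "Suc l" and d = "Suc m" and k = 1 and N = q and m = m and x = x and z = ?w, symmetric])
    show "sq.brows q (\<lambda>_. 1) (x \<circ> swp j) [1..<Suc l] = sq.brows q (\<lambda>_. 1) x [1..<Suc l]"
      if "Suc l \<le> j" "j < m" for j x
      by (intro ext sq.brows_cong) (use that in auto)
  qed (use q inj P in \<open>auto simp: r'_def sq.brows_lin\<close>)
  also have "\<dots> = symz m (\<lambda>x. P x * stanley_long q m x) x"
  proof -
    have "sq.brows q (\<lambda>_. 1) x [1..<Suc l] (cr (\<lambda>j. if Suc l \<le> j \<and> j \<le> m then 1 else r' j) x) ?w
        = stanley_long q m x" for x
    proof -
      have "cr (\<lambda>j. if Suc l \<le> j \<and> j \<le> m then 1 else r' j) x = cr (\<lambda>_. 1) x"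
        unfolding cr_def by (rule sq.crows_cong) auto
      then have "sq.brows q (\<lambda>_. 1) x [1..<Suc l] (cr (\<lambda>j. if Suc l \<le> j \<and> j \<le> m then 1 else r' j) x) ?w
          = sq.brows q (\<lambda>_. 1) x (rev [Suc l..<Suc m]) (sq.brows q (\<lambda>_. 1) x [1..<Suc l] ?e) ?w"
        unfolding cr_def by (simp only: crows_longest[OF q(1) right_op_brows])
      also have "\<dots> = sq.brows q (\<lambda>_. 1) x ([1..<Suc l] @ rev [Suc l..<Suc m]) ?e ?w"
        by (simp only: sq.brows_append)
      also have "\<dots> = sq.brows q (\<lambda>_. 1) x [1..<Suc m] ?e ?w"
      proof -
        have "mset ([1..<Suc l] @ rev [Suc l..<Suc m]) = mset ([1..<Suc l] @ [Suc l..<Suc m])"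
          by simp
        also have "[1..<Suc l] @ [Suc l..<Suc m] = [1..<Suc m]"
          using q by (intro upt_append[symmetric]) auto
        finally show ?thesis by (rule fun_cong[OF brows_mset])
      qed
      finally show ?thesis by (simp only: stanley_long_def sq.full_rows_def)
    qed
    then show ?thesis by (simp only:)
  qed
  finally show ?thesis .
qed

lemma prod_lessThan_add: "(\<Prod>i<h + d. f i) = (\<Prod>i<h. f i) * (\<Prod>i<d. f (h + i))"
  for f :: "nat \<Rightarrow> real"
  by (induction d) (simp_all add: mult.assoc)

section \<open>Symmetrization of the values\<close>

definition pair_sums :: "nat \<Rightarrow> nat \<Rightarrow> (nat \<Rightarrow> real) \<Rightarrow> real" where
  "pair_sums h l x = (\<Prod>i<h. \<Prod>j<i. x (l + j) + x (l + i))"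

lemma pair_sums_Suc:
  "pair_sums (Suc h) l x = (\<Prod>j<h. x l + x (Suc l + j)) * pair_sums h (Suc l) x"
proof -
  have "pair_sums (Suc h) l x = (\<Prod>i<h. \<Prod>j<Suc i. x (l + j) + x (l + Suc i))"
    unfolding pair_sums_def by (subst prod.lessThan_Suc_shift) simp
  also have "\<dots> = (\<Prod>i<h. (x l + x (Suc l + i)) * (\<Prod>j<i. x (Suc l + j) + x (Suc l + i)))"
    by (intro prod.cong refl) (subst prod.lessThan_Suc_shift, simp)
  finally show ?thesis by (simp add: prod.distrib pair_sums_def)
qed

lemma cauchy_Suc:
  "cauchy (Suc c) l l' x = (\<Prod>a<Suc c. x l + x (l' + a)) * cauchy c (Suc l) l' x"
proof -
  have "cauchy (Suc c) l l' x
      = (\<Prod>a<Suc c. (x l + x (l' + a)) * (\<Prod>b<c - a. x (l' + a) + x (Suc l + b)))"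
    unfolding cauchy_def
  proof (intro prod.cong refl)
    fix a assume "a \<in> {..<Suc c}"
    then have e: "Suc c - a = Suc (c - a)" by auto
    show "(\<Prod>b<Suc c - a. x (l' + a) + x (l + b))
        = (x l + x (l' + a)) * (\<Prod>b<c - a. x (l' + a) + x (Suc l + b))"
      unfolding e by (subst prod.lessThan_Suc_shift) (simp add: add.commute)
  qed
  then show ?thesis by (simp add: prod.distrib cauchy_def)
qed

text \<open>The value of the staircase with c rows: h counts the steps of the recursion, each
  consuming one of the first h variables. The isolated factor of a step is g of its variable, with g
  the identity for the start at \<open>id\<close> and g = 1 for v_n.\<close>

definition long_value :: "(real \<Rightarrow> real) \<Rightarrow> nat \<Rightarrow> nat \<Rightarrow> (nat \<Rightarrow> real) \<Rightarrow> real" where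
  "long_value g c l x = (let h = Suc c div 2 in
    (\<Prod>i<h. g (x (l + i))) * pair_sums h l x * cauchy (c - h) l (l + h) x)"

lemma long_value_small: "long_value g 0 l x = 1" "long_value g (Suc 0) l x = g (x l)"
  by (simp_all add: long_value_def pair_sums_def cauchy_def)

lemma long_value_step:
  "long_value g (c + 2) l x = g (x l) * (\<Prod>i<Suc c. x l + x (Suc l + i)) * long_value g c (Suc l) x"
proof -
  define h d where "h = Suc c div 2" and "d = c - h"
  have c: "c = h + d" by (simp add: h_def d_def)
  have e: "Suc (c + 2) div 2 = Suc h" "c + 2 - Suc h = Suc d" by (simp_all add: h_def d_def)
  have 1: "(\<Prod>i<Suc h. g (x (l + i))) = g (x l) * (\<Prod>i<h. g (x (Suc l + i)))"
    by (subst prod.lessThan_Suc_shift) simp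
  have 2: "(\<Prod>i<Suc c. x l + x (Suc l + i))
      = (\<Prod>i<h. x l + x (Suc l + i)) * (\<Prod>a<Suc d. x l + x (l + Suc h + a))"
    using prod_lessThan_add[of "\<lambda>i. x l + x (Suc l + i)" h "Suc d"] c by (simp add: add.assoc)
  show ?thesis
    unfolding long_value_def Let_def e h_def[symmetric] d_def[symmetric] 1 2 pair_sums_Suc cauchy_Suc
    by (simp add: mult_ac)
qed

lemma inv_staircase_long:
  "inv.staircase_rows x c k l (delta id) (reversal id k (k + c)) = long_value (\<lambda>t. t) c l x"
proof (induction c arbitrary: k l rule: induct_nat_012)
  case 0
  then show ?case by (simp add: reversal_trivial long_value_small)
next
  case 1
  have "reversal id (k + 2) (Suc k) = id" by (simp add: reversal_trivial)
  then show ?case using inv_staircase_value[of x 0 k l] by (simp add: long_value_small)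
next
  case (ge2 c)
  have "reversal id (k + 2) (Suc k + Suc c) = reversal id (k + 2) (k + 2 + c)" by simp
  then show ?case
    using inv_staircase_value[of x "Suc c" k l] ge2.IH(1)[of "k + 2" "Suc l"] long_value_step[of "\<lambda>t. t" c l x]
    by (simp del: inv.staircase_rows.simps prod.lessThan_Suc)
qed

lemma fpf_staircase_long:
  assumes "odd k" "2 * n = Suc k + c"
  shows "inv.staircase_rows x (Suc c) k l (delta (fpf_min n)) (reversal (fpf_min n) k (Suc k + c))
    = long_value (\<lambda>_. 1) (Suc c) l x"
  using assms
proof (induction c arbitrary: k l rule: induct_nat_012)
  case 0
  have "reversal (fpf_min n) (k + 2) (Suc k) = fpf_min n" by (auto simp: reversal_def fun_eq_iff)
  then show ?case using fpf_staircase_value[of k 0 n x l] 0 by (simp add: long_value_small)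
next
  case 1
  then have False by presburger
  then show ?case ..
next
  case (ge2 c)
  have "reversal (fpf_min n) (k + 2) (Suc k + Suc (Suc c)) = reversal (fpf_min n) (k + 2) (Suc (k + 2) + c)"
    by simp
  then show ?case
    using fpf_staircase_value[of k "Suc (Suc c)" n x l] ge2.IH(1)[of "k + 2" "Suc l"] ge2.prems
      long_value_step[of "\<lambda>_. 1" "Suc c" l x]
    by (simp del: inv.staircase_rows.simps prod.lessThan_Suc)
qed

lemma block_staircase_long:
  "odd k \<Longrightarrow> sq.staircase_rows x (2 * c - 1) k l (delta (block 0 0)) (block k c)
    = (\<Prod>i<c. x (l + i)) * pair_sums c l x"
proof (induction c arbitrary: k l)
  case 0
  have "block k 0 = block 0 0" by (auto simp: block_def fun_eq_iff)
  then show ?case by (simp add: pair_sums_def)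
next
  case (Suc c)
  have "(\<Prod>i<Suc c. x (l + i)) = x l * (\<Prod>i<c. x (Suc l + i))"
    by (subst prod.lessThan_Suc_shift) simp
  then show ?case
    using block_staircase_value[of k x c l] Suc.IH[of "k + 2" "Suc l"] Suc.prems
    by (simp add: pair_sums_Suc mult_ac del: sq.staircase_rows.simps prod.lessThan_Suc)
qed

section \<open>Closed forms in few variables\<close>

lemma sym_weight_nested:
  "sym_weight m x = (\<Prod>i<m. \<Prod>j<i. x (Suc j) / (x (Suc j) - x (Suc i)))"
proof (induction m)
  case 0
  have "pairs 0 = {}" by (auto simp: pairs_def)
  then show ?case by (simp add: sym_weight_def)
next
  case (Suc m)
  have "(\<Prod>i\<in>{1..m}. x i / (x i - x (Suc m))) = (\<Prod>j<m. x (Suc j) / (x (Suc j) - x (Suc m)))"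
    by (simp add: prod.atLeast1_atMost_eq)
  then show ?case using Suc by (simp add: sym_weight_Suc)
qed

lemma pair_sums_pairs: "pair_sums m 1 x = (\<Prod>(i, j)\<in>pairs m. x i + x j)"
proof (induction m)
  case 0
  have "pairs 0 = {}" by (auto simp: pairs_def)
  then show ?case by (simp add: pair_sums_def)
next
  case (Suc m)
  have "pairs (Suc m) = pairs m \<union> (\<lambda>i. (i, Suc m)) ` {1..m}"
    "pairs m \<inter> (\<lambda>i. (i, Suc m)) ` {1..m} = {}"
    by (auto simp: pairs_def)
  then have "(\<Prod>(i, j)\<in>pairs (Suc m). x i + x j)
      = (\<Prod>(i, j)\<in>pairs m. x i + x j) * (\<Prod>i\<in>{1..m}. x i + x (Suc m))"
    by (simp add: prod.union_disjoint prod.reindex inj_on_def)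
  then show ?case
    using Suc by (simp add: pair_sums_def prod.atLeast1_atMost_eq)
qed

text \<open>A permutation acts on unordered pairs; \<open>min\<close> and \<open>max\<close> choose
  the ordered representatives.\<close>

lemma pair_sums_permute:
  assumes \<sigma>: "\<sigma> permutes {1..m}"
  shows "pair_sums m 1 (x \<circ> \<sigma>) = pair_sums m 1 x"
proof -
  define f where "f \<tau> = (\<lambda>(a, b). (min (\<tau> a) (\<tau> b), max (\<tau> a) (\<tau> b)))" for \<tau> :: "nat \<Rightarrow> nat"
  have range: "f \<tau> p \<in> pairs m" if "\<tau> permutes {1..m}" "p \<in> pairs m" for \<tau> p
  proof -
    obtain a b where p: "p = (a, b)" by force
    have ab: "a \<in> {1..m}" "b \<in> {1..m}" "a \<noteq> b" using that p by (auto simp: pairs_def)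
    have "\<tau> a \<in> {1..m}" "\<tau> b \<in> {1..m}"
      using ab permutes_in_image[OF that(1)] by blast+
    moreover have "\<tau> a \<noteq> \<tau> b" using ab injD[OF permutes_inj[OF that(1)], of a b] by blast
    ultimately have "1 \<le> \<tau> a" "\<tau> a \<le> m" "1 \<le> \<tau> b" "\<tau> b \<le> m" "\<tau> a \<noteq> \<tau> b" by auto
    then show ?thesis using p by (auto simp: f_def pairs_def min_def max_def)
  qed
  have inv: "f \<tau> (f \<tau>' p) = p" if "\<And>a. \<tau> (\<tau>' a) = a" "p \<in> pairs m" for \<tau> \<tau>' p
    using that by (auto simp: f_def pairs_def min_def max_def)
  show ?thesis
    unfolding pair_sums_pairs
  proof (rule prod.reindex_bij_witness[where i = "f (inv \<sigma>)" and j = "f \<sigma>"])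
    show "f (inv \<sigma>) (f \<sigma> p) = p" if "p \<in> pairs m" for p
      by (rule inv) (use that permutes_inverses[OF \<sigma>] in auto)
    show "f \<sigma> (f (inv \<sigma>) p) = p" if "p \<in> pairs m" for p
      by (rule inv) (use that permutes_inverses[OF \<sigma>] in auto)
  next
    show "f \<sigma> p \<in> pairs m" "f (inv \<sigma>) p \<in> pairs m" if "p \<in> pairs m" for p
      using range[OF \<sigma> that] range[OF permutes_inv[OF \<sigma>] that] .
  qed (auto simp: f_def min_def max_def add.commute)
qed

lemma prod_permute:
  fixes m :: nat
  assumes \<sigma>: "\<sigma> permutes {1..m}"
  shows "(\<Prod>i<m. g ((x \<circ> \<sigma>) (1 + i))) = (\<Prod>i<m. g (x (1 + i)) :: real)"
proof -
  have "(\<Prod>i\<in>{1..m}. g (x (\<sigma> i))) = (\<Prod>i\<in>{1..m}. g (x i))"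
    by (rule prod.reindex_bij_betw[OF permutes_imp_bij[OF \<sigma>]])
  then show ?thesis by (simp only: One_nat_def prod.atLeast1_atMost_eq o_apply add_Suc add_0)
qed

text \<open>Distinctness keeps the denominators of \<open>sym_weight\<close> nonzero; positivity
  also keeps x_i + x_j nonzero and the squares distinct.\<close>

definition generic :: "nat \<Rightarrow> (nat \<Rightarrow> real) \<Rightarrow> bool" where
  "generic m x \<longleftrightarrow> inj_on x {1..m} \<and> (\<forall>i\<in>{1..m}. 0 < x i)"

lemma generic_permute:
  assumes "generic m x" "\<sigma> permutes {1..m}" "l \<le> m"
  shows "generic l (x \<circ> \<sigma>)"
proof -
  have sub: "\<sigma> ` {1..l} \<subseteq> {1..m}"
    using permutes_image[OF assms(2)] assms(3) by (metis atLeastatMost_subset_iff image_mono order_refl)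
  have "inj_on x (\<sigma> ` {1..l})" using assms(1) sub by (auto simp: generic_def intro: inj_on_subset)
  then have "inj_on (x \<circ> \<sigma>) {1..l}"
    by (intro comp_inj_on permutes_inj_on[OF assms(2)])
  moreover have "0 < x (\<sigma> i)" if "i \<in> {1..l}" for i
    using assms(1) sub that unfolding generic_def by blast
  ultimately show ?thesis by (simp add: generic_def)
qed

lemma dual_rows_zero:
  "(\<And>j. l \<le> j \<Longrightarrow> x j = 0) \<Longrightarrow> sq.dual_rows x c k l v = v"
proof (induction c arbitrary: k l)
  case (Suc c)
  have C0: "sq.C c k 0 v = v" for c k v
    by (induction c arbitrary: k v) auto
  have "sq.dual_rows x c (Suc k) (Suc l) v = v" by (rule Suc.IH) (use Suc.prems in auto)
  moreover have "x l = 0" using Suc.prems by simp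
  ultimately show ?case by (simp only: sq.dual_rows.simps C0)
qed simp

text \<open>This is \<open>cauchy_value\<close> with the second group of variables set to zero,
  which makes the dual rows trivial. The conditional row index is the shape of
  \<open>full_rows_symz\<close> at l = 0.\<close>

lemma staircase_monomial:
  assumes "1 \<le> q" "q \<le> Suc l"
  shows "sq.brows q (\<lambda>j. if j \<le> 0 then 1 else j) x [1..<Suc l] (delta id) (reversal id 1 q)
    = (\<Prod>i<q. \<Prod>j<i. x (Suc j))"
proof -
  define y where "y j = (if j \<le> l then x j else 0)" for j
  have "sq.brows q (\<lambda>j. if j \<le> 0 then 1 else j) x [1..<Suc l] v
      = sq.staircase_rows y (q - 1) 1 1 v" for v
  proof -
    have s: "[1..<Suc l] = [1..<1 + (q - 1)] @ [1 + (q - 1)..<Suc l]"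
      using assms by (intro upt_append) auto
    have "sq.brows q (\<lambda>j. if j \<le> 0 then 1 else j) x [1..<Suc l] v
        = sq.brows q (\<lambda>j. if j \<le> 0 then 1 else j) x [1..<1 + (q - 1)] v"
      unfolding s sq.brows_append by (rule sq.brows_trivial) (use assms in auto)
    also have "\<dots> = sq.brows q (\<lambda>j. 1 + (j - 1)) y [1..<1 + (q - 1)] v"
      by (rule sq.brows_cong) (use assms in \<open>auto simp: y_def\<close>)
    also have "\<dots> = sq.staircase_rows y (q - 1) 1 1 v"
      by (rule sq.staircase_rows_brows[symmetric]) simp
    finally show ?thesis .
  qed
  moreover have "sq.dual_rows y (q - 1) 1 (Suc l) (delta id) = delta id"
    by (rule dual_rows_zero) (simp add: y_def)
  ultimately have "sq.brows q (\<lambda>j. if j \<le> 0 then 1 else j) x [1..<Suc l] (delta id) (reversal id 1 q)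
      = (\<Prod>a<q - 1. \<Prod>b<q - 1 - a. y (Suc l + a) + y (1 + b))"
    using cauchy_value[of y "q - 1" 1 1 "Suc l"] assms(1) by simp
  also have "\<dots> = (\<Prod>a<q - 1. \<Prod>b<q - 1 - a. x (Suc b))"
    by (intro prod.cong refl) (use assms in \<open>auto simp: y_def\<close>)
  also have "\<dots> = (\<Prod>i<Suc (q - 1). \<Prod>j<i. x (Suc j))"
  proof (induction "q - 1" arbitrary: q)
    case (Suc c)
    have "(\<Prod>a<Suc c. \<Prod>b<Suc c - a. x (Suc b)) = (\<Prod>b<Suc c. x (Suc b)) * (\<Prod>a<c. \<Prod>b<c - a. x (Suc b))"
      by (subst prod.lessThan_Suc_shift) simp
    moreover have "(\<Prod>a<c. \<Prod>b<c - a. x (Suc b)) = (\<Prod>i<Suc c. \<Prod>j<i. x (Suc j))"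
      using Suc(1)[of "Suc c"] by simp
    ultimately show ?case unfolding Suc(2)[symmetric] by simp
  qed simp
  finally show ?thesis using assms(1) by simp
qed

text \<open>Multiplying the weight by the staircase monomial turns x_j / (x_j - x_i) into x_j^2 /
  (x_j - x_i) = (x_j + x_i) x_j^2 / (x_j^2 - x_i^2). So the pair sums split off, and the rest is
  \<open>symz_one\<close> at the squares.\<close>

lemma stanley_long_small:
  assumes x: "generic l x" and q: "q = l \<or> q = Suc l" "1 \<le> q"
  shows "stanley_long q l x = (\<Prod>i<l. if q = l then 1 else x (1 + i)) * pair_sums l 1 x"
proof -
  let ?E = "\<lambda>x :: nat \<Rightarrow> real. (\<Prod>i<l. if q = l then 1 else x (1 + i))"
  have inj: "inj_on x {1..l}" using x by (simp add: generic_def)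
  have "stanley_long q l x = symz l (\<lambda>x. (\<Prod>i<q. \<Prod>j<i. x (Suc j))) x"
    unfolding stanley_long_def sq.full_rows_symz[OF inj le0]
    using q by (intro symz_cong staircase_monomial) auto
  also have "\<dots> = symz l (\<lambda>x. ?E x * (\<Prod>i<l. \<Prod>j<i. x (Suc j))) x"
    by (rule symz_cong) (use q in auto)
  also have "\<dots> = ?E x * symz l (\<lambda>x. (\<Prod>i<l. \<Prod>j<i. x (Suc j))) x"
    by (rule symz_mult_sym) (rule prod_permute[where g = "\<lambda>t. if q = l then 1 else t"])
  also have "symz l (\<lambda>x. (\<Prod>i<l. \<Prod>j<i. x (Suc j))) x
      = (\<Sum>\<sigma>\<in>{\<sigma>. \<sigma> permutes {1..l}}. pair_sums l 1 x * sym_weight l ((\<lambda>i. (x i)\<^sup>2) \<circ> \<sigma>))"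
    unfolding symz_def
  proof (rule sum.cong[OF refl])
    fix \<sigma> assume "\<sigma> \<in> {\<sigma>. \<sigma> permutes {1..l}}"
    then have \<sigma>: "\<sigma> permutes {1..l}" by simp
    define y where "y = x \<circ> \<sigma>"
    have y: "generic l y" unfolding y_def by (rule generic_permute[OF x \<sigma>]) simp
    have "sym_weight l y * (\<Prod>i<l. \<Prod>j<i. y (Suc j)) = pair_sums l 1 y * sym_weight l (\<lambda>i. (y i)\<^sup>2)"
      unfolding sym_weight_nested pair_sums_def prod.distrib[symmetric]
    proof (intro prod.cong refl)
      fix i j assume "i \<in> {..<l}" "j \<in> {..<i}"
      then have "0 < y (Suc j)" "0 < y (Suc i)" using y by (auto simp: generic_def)
      then have pos: "y (Suc j) + y (Suc i) \<noteq> 0" by simp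
      have "(y (Suc j))\<^sup>2 - (y (Suc i))\<^sup>2 = (y (Suc j) + y (Suc i)) * (y (Suc j) - y (Suc i))"
        by (simp add: power2_eq_square algebra_simps)
      then show "y (Suc j) / (y (Suc j) - y (Suc i)) * y (Suc j)
          = (y (1 + j) + y (1 + i)) * ((y (Suc j))\<^sup>2 / ((y (Suc j))\<^sup>2 - (y (Suc i))\<^sup>2))"
        using pos by (simp add: power2_eq_square)
    qed
    then show "sym_weight l (x \<circ> \<sigma>) * (\<Prod>i<l. \<Prod>j<i. (x \<circ> \<sigma>) (Suc j))
        = pair_sums l 1 x * sym_weight l ((\<lambda>i. (x i)\<^sup>2) \<circ> \<sigma>)"
      unfolding y_def pair_sums_permute[OF \<sigma>] by (simp add: o_def)
  qed
  also have "\<dots> = pair_sums l 1 x * symz l (\<lambda>_. 1) (\<lambda>i. (x i)\<^sup>2)"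
    by (simp add: symz_def sum_distrib_left)
  also have "symz l (\<lambda>_. 1) (\<lambda>i. (x i)\<^sup>2) = 1"
  proof (rule symz_one)
    show "inj_on (\<lambda>i. (x i)\<^sup>2) {1..l}"
    proof (rule inj_onI)
      fix i j assume ij: "i \<in> {1..l}" "j \<in> {1..l}" "(x i)\<^sup>2 = (x j)\<^sup>2"
      then have "0 < x i" "0 < x j" using x unfolding generic_def by blast+
      then have "x i = x j" using ij(3) power2_eq_imp_eq[of "x i" "x j"] by linarith
      moreover have "inj_on x {1..l}" using x unfolding generic_def by blast
      ultimately show "i = j" using ij(1,2) by (blast dest: inj_onD)
    qed
  qed
  finally show ?thesis by simp
qed

text \<open>In \<open>full_rows_symz\<close> the rows after the first l start at l + 1 or later,
  hence not below q, and are trivial. So the polynomial in l variables determines the one in m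
  variables.\<close>

lemma stanley_long_symz:
  assumes "generic m x" "q \<le> Suc l" "l \<le> m"
  shows "stanley_long q m x = symz m (stanley_long q l) x"
proof -
  have "sq.brows q (\<lambda>j. if j \<le> l then 1 else j) x [1..<Suc m] v = sq.full_rows q l x v" for x v
  proof -
    have s: "[1..<Suc m] = [1..<Suc l] @ [Suc l..<Suc m]"
      using assms by (intro upt_append) auto
    have "sq.brows q (\<lambda>j. if j \<le> l then 1 else j) x [1..<Suc m] v
        = sq.brows q (\<lambda>j. if j \<le> l then 1 else j) x [1..<Suc l] v"
      unfolding s sq.brows_append by (rule sq.brows_trivial) (use assms in auto)
    also have "\<dots> = sq.full_rows q l x v"
      unfolding sq.full_rows_def by (rule sq.brows_cong) auto
    finally show ?thesis .
  qed
  then have "stanley_long q l x = sq.brows q (\<lambda>j. if j \<le> l then 1 else j) x [1..<Suc m]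
      (delta id) (reversal id 1 q)" for x
    by (simp only: stanley_long_def)
  then have "stanley_long q l = (\<lambda>x. sq.brows q (\<lambda>j. if j \<le> l then 1 else j) x [1..<Suc m]
      (delta id) (reversal id 1 q))"
    by (rule ext)
  then show ?thesis
    unfolding stanley_long_def[of q m]
    using sq.full_rows_symz[of x m l q "delta id" "reversal id 1 q"] assms
    by (simp only: generic_def simp_thms)
qed

lemma stanley_long_permute:
  "\<sigma> permutes {1..m} \<Longrightarrow> stanley_long q m (x \<circ> \<sigma>) = stanley_long q m x"
  by (simp add: stanley_long_def sq.full_rows_permute)

text \<open>Once the Cauchy factor has become symmetric it is pulled out. What is left to symmetrize
  is the closed form of \<open>stanley_long p\<close> in the first l variables.\<close>

lemma symz_long_value:
  assumes x: "generic m x" and g: "g = (\<lambda>_. 1) \<and> p = l \<or> g = (\<lambda>t. t) \<and> p = Suc l" and "1 \<le> p"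
    and c: "l = Suc c div 2" "Suc c \<le> m"
  shows "symz m (long_value g c 1) x = stanley_long p m x * stanley_long (Suc (c - l)) m x"
proof -
  let ?q = "Suc (c - l)"
  let ?P = "\<lambda>x :: nat \<Rightarrow> real. (\<Prod>i<l. g (x (1 + i))) * pair_sums l 1 x"
  have lm: "l \<le> m" using c by auto
  \<comment> \<open>For j < l by symmetry, for j > l because only the first l variables
    occur.\<close>
  have P: "?P (x \<circ> swp j) = ?P x" if "1 \<le> j" "j \<noteq> l" for j x
  proof (cases "j < l")
    case True
    then have "swp j permutes {1..l}" using that by (intro permutes_swap_id) auto
    then show ?thesis using pair_sums_permute prod_permute by metis
  next
    case False
    have "(x \<circ> swp j) i = x i" if "i \<le> l" for i using False that \<open>j \<noteq> l\<close> by simp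
    then show ?thesis unfolding pair_sums_def by (intro arg_cong2[of _ _ _ _ "(*)"] prod.cong) auto
  qed
  have "symz m (long_value g c 1) x = symz m (\<lambda>x. ?P x * cauchy (?q - 1) 1 (Suc l) x) x"
    by (rule symz_cong) (simp add: long_value_def c(1)[symmetric])
  also have "\<dots> = symz m (\<lambda>x. ?P x * stanley_long ?q m x) x"
    by (rule symz_cauchy) (use c x P in \<open>auto simp: generic_def\<close>)
  also have "\<dots> = symz m (\<lambda>x. stanley_long ?q m x * ?P x) x"
    by (simp add: mult.commute)
  also have "\<dots> = stanley_long ?q m x * symz m ?P x"
    by (rule symz_mult_sym) (rule stanley_long_permute)
  also have "symz m ?P x = symz m (stanley_long p l) x"
  proof (rule symz_cong)
    fix \<sigma> assume "\<sigma> permutes {1..m}"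
    then have "generic l (x \<circ> \<sigma>)" using generic_permute[OF x _ lm] by simp
    then show "?P (x \<circ> \<sigma>) = stanley_long p l (x \<circ> \<sigma>)"
      using stanley_long_small[of l "x \<circ> \<sigma>" p] g \<open>1 \<le> p\<close> by auto
  qed
  also have "\<dots> = stanley_long p m x"
    by (rule stanley_long_symz[symmetric]) (use x g lm in auto)
  finally show ?thesis by simp
qed

lemma inv_full_rows_long:
  assumes x: "generic m x" and n: "1 \<le> n" "n \<le> m"
  shows "inv.full_rows n m x (delta id) (reversal id 1 n)
    = stanley_long (Suc (n div 2)) m x * stanley_long (n - n div 2) m x"
proof -
  have "inv.full_rows n m x (delta id) (reversal id 1 n)
      = symz m (\<lambda>x. inv.brows n (\<lambda>j. if j \<le> 0 then 1 else j) x [1..<Suc m] (delta id) (reversal id 1 n)) x"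
    by (rule inv.full_rows_symz) (use x in \<open>auto simp: generic_def\<close>)
  also have "\<dots> = symz m (long_value (\<lambda>t. t) (n - 1) 1) x"
  proof (rule symz_cong)
    fix \<sigma> :: "nat \<Rightarrow> nat"
    define y where "y = x \<circ> \<sigma>"
    have s: "[1..<Suc m] = [1..<1 + (n - 1)] @ [1 + (n - 1)..<Suc m]"
      using n by (intro upt_append) auto
    have "inv.brows n (\<lambda>j. if j \<le> 0 then 1 else j) y [1..<Suc m] v
        = inv.brows n (\<lambda>j. if j \<le> 0 then 1 else j) y [1..<1 + (n - 1)] v" for v
      unfolding s inv.brows_append by (rule inv.brows_trivial) (use n in auto)
    also have "\<dots> v = inv.brows n (\<lambda>j. 1 + (j - 1)) y [1..<1 + (n - 1)] v" for v
      by (rule inv.brows_cong) auto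
    also have "\<dots> v = inv.staircase_rows y (n - 1) 1 1 v" for v
      by (rule inv.staircase_rows_brows[symmetric]) simp
    finally show "inv.brows n (\<lambda>j. if j \<le> 0 then 1 else j) (x \<circ> \<sigma>) [1..<Suc m] (delta id) (reversal id 1 n)
        = long_value (\<lambda>t. t) (n - 1) 1 (x \<circ> \<sigma>)"
      using inv_staircase_long[of y "n - 1" 1 1] n unfolding y_def by simp
  qed
  \<comment> \<open>There are c = n - 1 rows, so the first half has n div 2 variables; the isolated
    factors raise its staircase by one.\<close>
  also have "\<dots> = stanley_long (Suc (n div 2)) m x * stanley_long (Suc (n - 1 - n div 2)) m x"
    by (rule symz_long_value) (use x n in auto)
  also have "Suc (n - 1 - n div 2) = n - n div 2"
  proof -
    have "n div 2 < n" using n by simp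
    then show ?thesis by simp
  qed
  finally show ?thesis .
qed

lemma fpf_full_rows_long:
  assumes x: "generic m x" and n: "1 \<le> n" "2 * n \<le> m"
  shows "inv.full_rows (2 * n) m x (delta (fpf_min n)) (reversal (fpf_min n) 1 (2 * n))
    = (stanley_long n m x)\<^sup>2"
proof -
  let ?e = "delta (fpf_min n)" and ?w = "reversal (fpf_min n) 1 (2 * n)"
  have "inv.full_rows (2 * n) m x ?e ?w
      = symz m (\<lambda>x. inv.brows (2 * n) (\<lambda>j. if j \<le> 0 then 1 else j) x [1..<Suc m] ?e ?w) x"
    by (rule inv.full_rows_symz) (use x in \<open>auto simp: generic_def\<close>)
  also have "\<dots> = symz m (long_value (\<lambda>_. 1) (2 * n - 1) 1) x"
  proof (rule symz_cong)
    fix \<sigma> :: "nat \<Rightarrow> nat"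
    define y where "y = x \<circ> \<sigma>"
    have s: "[1..<Suc m] = [1..<1 + (2 * n - 1)] @ [1 + (2 * n - 1)..<Suc m]"
      using n by (intro upt_append) auto
    have "inv.brows (2 * n) (\<lambda>j. if j \<le> 0 then 1 else j) y [1..<Suc m] v
        = inv.brows (2 * n) (\<lambda>j. if j \<le> 0 then 1 else j) y [1..<1 + (2 * n - 1)] v" for v
      unfolding s inv.brows_append by (rule inv.brows_trivial) (use n in auto)
    also have "\<dots> v = inv.brows (2 * n) (\<lambda>j. 1 + (j - 1)) y [1..<1 + (2 * n - 1)] v" for v
      by (rule inv.brows_cong) auto
    also have "\<dots> v = inv.staircase_rows y (2 * n - 1) 1 1 v" for v
      by (rule inv.staircase_rows_brows[symmetric]) simp
    moreover have "inv.staircase_rows y (2 * n - 1) 1 1 ?e ?w = long_value (\<lambda>_. 1) (2 * n - 1) 1 y"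
    proof -
      have "Suc (2 * n - 2) = 2 * n - 1" "Suc 1 + (2 * n - 2) = 2 * n" using n by auto
      then show ?thesis
        using fpf_staircase_long[of 1 n "2 * n - 2" y 1] by (simp only: odd_one simp_thms)
    qed
    ultimately show "inv.brows (2 * n) (\<lambda>j. if j \<le> 0 then 1 else j) (x \<circ> \<sigma>) [1..<Suc m] ?e ?w
        = long_value (\<lambda>_. 1) (2 * n - 1) 1 (x \<circ> \<sigma>)"
      unfolding y_def by simp
  qed
  also have "\<dots> = stanley_long n m x * stanley_long (Suc (2 * n - 1 - n)) m x"
    by (rule symz_long_value) (use x n in auto)
  also have "Suc (2 * n - 1 - n) = n" using n by simp
  finally show ?thesis by (simp add: power2_eq_square)
qed

text \<open>Although there are 2k - 1 staircase rows, their value involves only the first k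
  variables and no Cauchy factor, and it is the closed form of \<open>stanley_long (Suc k)\<close>
  in these variables.\<close>

lemma block_full_rows_long:
  assumes x: "generic m x" and k: "2 * k \<le> m"
  shows "sq.full_rows (2 * k) m x (delta (block 0 0)) (block 1 k) = stanley_long (Suc k) m x"
proof -
  let ?e = "delta (block 0 0)" and ?w = "block 1 k"
  have "sq.full_rows (2 * k) m x ?e ?w
      = symz m (\<lambda>x. sq.brows (2 * k) (\<lambda>j. if j \<le> 0 then 1 else j) x [1..<Suc m] ?e ?w) x"
    by (rule sq.full_rows_symz) (use x in \<open>auto simp: generic_def\<close>)
  also have "\<dots> = symz m (stanley_long (Suc k) k) x"
  proof (rule symz_cong)
    fix \<sigma> assume "\<sigma> permutes {1..m}"
    define y where "y = x \<circ> \<sigma>"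
    have y: "generic k y" unfolding y_def
      by (rule generic_permute[OF x \<open>\<sigma> permutes {1..m}\<close>]) (use k in simp)
    have s: "[1..<Suc m] = [1..<1 + (2 * k - 1)] @ [1 + (2 * k - 1)..<Suc m]"
      using k by (intro upt_append) auto
    have "sq.brows (2 * k) (\<lambda>j. if j \<le> 0 then 1 else j) y [1..<Suc m] v
        = sq.brows (2 * k) (\<lambda>j. if j \<le> 0 then 1 else j) y [1..<1 + (2 * k - 1)] v" for v
      unfolding s sq.brows_append by (rule sq.brows_trivial) auto
    also have "\<dots> v = sq.brows (2 * k) (\<lambda>j. 1 + (j - 1)) y [1..<1 + (2 * k - 1)] v" for v
      by (rule sq.brows_cong) auto
    also have "\<dots> v = sq.staircase_rows y (2 * k - 1) 1 1 v" for v
      by (rule sq.staircase_rows_brows[symmetric]) simp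
    moreover have "sq.staircase_rows y (2 * k - 1) 1 1 ?e ?w = stanley_long (Suc k) k y"
      using stanley_long_small[OF y, of "Suc k"] block_staircase_long[of 1 y k 1] by simp
    ultimately show "sq.brows (2 * k) (\<lambda>j. if j \<le> 0 then 1 else j) (x \<circ> \<sigma>) [1..<Suc m] ?e ?w
        = stanley_long (Suc k) k (x \<circ> \<sigma>)"
      unfolding y_def by simp
  qed
  also have "\<dots> = stanley_long (Suc k) m x"
    by (rule stanley_long_symz[symmetric]) (use x k in auto)
  finally show ?thesis .
qed

declare id_apply [simp] seq_move_apply [simp]

section \<open>Involution words and compatible sequences\<close>

definition fin_inv :: "(nat \<Rightarrow> nat) \<Rightarrow> bool" where
  "fin_inv z \<longleftrightarrow> is_inv z \<and> (\<exists>N. \<forall>j>N. z j = j)"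

definition inversions :: "(nat \<Rightarrow> nat) \<Rightarrow> (nat \<times> nat) set" where
  "inversions z = {(a, b). a < b \<and> z b < z a}"

definition excedances :: "(nat \<Rightarrow> nat) \<Rightarrow> nat set" where
  "excedances z = {a. a < z a}"

text \<open>Twice the length of \<open>z\<close> in the involution weak order.\<close>

definition inv_rank :: "(nat \<Rightarrow> nat) \<Rightarrow> nat" where
  "inv_rank z = card (inversions z) + card (excedances z)"

lemma fin_inv_is_inv: "fin_inv z \<Longrightarrow> is_inv z"
  by (simp add: fin_inv_def)

lemma fin_inv_finite:
  assumes "fin_inv z" shows "finite (inversions z)" "finite (excedances z)"
proof -
  obtain N where N: "\<And>j. j > N \<Longrightarrow> z j = j" and z: "is_inv z" using assms by (auto simp: fin_inv_def)
  have le: "z j \<le> N" if "j \<le> N" for j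
    using N[of "z j"] is_invD[OF z, of j] that by (metis not_le)
  have "excedances z \<subseteq> {..N}"
    using N by (force simp: excedances_def not_le[symmetric])
  then show "finite (excedances z)" by (rule finite_subset) simp
  have "a \<le> N \<and> b \<le> N" if "a < b" "z b < z a" for a b
  proof (rule ccontr)
    assume "\<not> (a \<le> N \<and> b \<le> N)"
    then have "b > N" using that by auto
    then show False using that N[of b] N[of a] le[of a] by (cases "a \<le> N") auto
  qed
  then have "inversions z \<subseteq> {..N} \<times> {..N}" by (auto simp: inversions_def)
  then show "finite (inversions z)" by (rule finite_subset) simp
qed

lemma fin_inv_inv_act:
  assumes "fin_inv z" shows "fin_inv (inv_act z i)"
proof -
  obtain N where N: "\<And>j. j > N \<Longrightarrow> z j = j" and z: "is_inv z" using assms by (auto simp: fin_inv_def)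
  have "inv_act z i j = j" if "j > max N (Suc i)" for j
    using that N[of j] by (simp add: inv_act_apply[OF z])
  then have "\<forall>j>max N (Suc i). inv_act z i j = j" by blast
  then show ?thesis using is_inv_inv_act[OF z] unfolding fin_inv_def by blast
qed

lemma inversions_swp_right:
  assumes "z i < z (Suc i)"
  shows "inversions (z \<circ> swp i) = insert (i, Suc i) ((\<lambda>(a, b). (swp i a, swp i b)) ` inversions z)"
    "(i, Suc i) \<notin> (\<lambda>(a, b). (swp i a, swp i b)) ` inversions z"
proof -
  have lt: "swp i a < swp i b \<longleftrightarrow> a < b" if "(a, b) \<noteq> (i, Suc i)" "(a, b) \<noteq> (Suc i, i)" for a b
    by (rule swp_less) (use that in auto)
  show "inversions (z \<circ> swp i) = insert (i, Suc i) ((\<lambda>(a, b). (swp i a, swp i b)) ` inversions z)"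
  proof (intro set_eqI iffI)
    fix p assume "p \<in> inversions (z \<circ> swp i)"
    then obtain a b where p: "p = (a, b)" "a < b" "z (swp i b) < z (swp i a)"
      by (auto simp: inversions_def)
    show "p \<in> insert (i, Suc i) ((\<lambda>(a, b). (swp i a, swp i b)) ` inversions z)"
    proof (cases "p = (i, Suc i)")
      case False
      then have "(swp i a, swp i b) \<in> inversions z"
        using p lt[of a b] by (auto simp: inversions_def)
      then show ?thesis using p by (force intro: image_eqI[of _ _ "(swp i a, swp i b)"])
    qed simp
  next
    fix p assume "p \<in> insert (i, Suc i) ((\<lambda>(a, b). (swp i a, swp i b)) ` inversions z)"
    then consider "p = (i, Suc i)" | a b where "p = (swp i a, swp i b)" "a < b" "z b < z a"
      by (auto simp: inversions_def)
    then show "p \<in> inversions (z \<circ> swp i)"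
    proof cases
      case 1
      then show ?thesis using assms by (simp add: inversions_def)
    next
      case 2
      then have "(a, b) \<noteq> (i, Suc i)" using assms by auto
      then show ?thesis using 2 lt[of a b] by (auto simp: inversions_def)
    qed
  qed
  show "(i, Suc i) \<notin> (\<lambda>(a, b). (swp i a, swp i b)) ` inversions z"
  proof
    assume "(i, Suc i) \<in> (\<lambda>(a, b). (swp i a, swp i b)) ` inversions z"
    then obtain a b where "(a, b) \<in> inversions z" "(i, Suc i) = (swp i a, swp i b)" by auto
    then have ab: "swp i a = i" "swp i b = Suc i" "a < b"
      unfolding inversions_def by (metis Pair_inject, metis Pair_inject, simp)
    then have "a = Suc i" "b = i"
      by (metis transpose_apply_first transpose_apply_second transpose_involutory)+
    then show False using ab by simp
  qed
qed

lemma inversions_swp_left: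
  assumes "inj w" "a < b" "w a = i" "w b = Suc i"
  shows "inversions (swp i \<circ> w) = insert (a, b) (inversions w)" "(a, b) \<notin> inversions w"
proof -
  have "swp i (w d) < swp i (w c) \<longleftrightarrow> w d < w c \<or> (c, d) = (a, b)" if "c < d" for c d
  proof (cases "{w c, w d} = {i, Suc i}")
    case True
    then consider "w c = i" "w d = Suc i" | "w c = Suc i" "w d = i" by (auto simp: doubleton_eq_iff)
    then show ?thesis
    proof cases
      case 1
      then have "c = a" "d = b" using injD[OF assms(1), of c a] injD[OF assms(1), of d b] assms by simp_all
      then show ?thesis using 1 by simp
    next
      case 2
      then have "c = b" "d = a" using injD[OF assms(1), of c b] injD[OF assms(1), of d a] assms by simp_all
      then show ?thesis using that assms by simp
    qed
  next
    case False
    then have "(c, d) \<noteq> (a, b)" using assms by auto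
    moreover have "swp i (w d) < swp i (w c) \<longleftrightarrow> w d < w c" by (rule swp_less) (use False in auto)
    ultimately show ?thesis by blast
  qed
  then show "inversions (swp i \<circ> w) = insert (a, b) (inversions w)"
    using assms(2) by (auto simp: inversions_def)
  show "(a, b) \<notin> inversions w" using assms by (simp add: inversions_def)
qed

text \<open>A one-sided step adds an inversion and an excedance; a conjugation adds two inversions
  and merely relabels the excedances. Either way the rank grows by two.\<close>

lemma inv_rank_ascent:
  assumes z: "fin_inv z" and asc: "z i < z (Suc i)"
  shows "inv_rank (inv_act z i) = inv_rank z + 2"
proof -
  note zi = fin_inv_is_inv[OF z]
  have inj: "inj z" using is_inv_inj[OF zi] by (simp add: inj_def)
  note fin = fin_inv_finite[OF z]
  have r1: "card (inversions (z \<circ> swp i)) = Suc (card (inversions z))"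
  proof -
    have "inj_on (\<lambda>(a, b). (swp i a, swp i b)) (inversions z)"
      by (auto simp: inj_on_def dest: transpose_eq_imp_eq)
    then show ?thesis
      unfolding inversions_swp_right(1)[OF asc]
      using fin(1) inversions_swp_right(2)[OF asc] by (simp add: card_image)
  qed
  show ?thesis
  proof (cases "fixes_pair i z")
    case True
    then have e: "z i = i" "z (Suc i) = Suc i" using asc by (auto simp: fixes_pair_def)
    have act: "inv_act z i = z \<circ> swp i"
      by (simp add: fun_eq_iff inv_act_apply[OF zi] True)
    have "excedances (z \<circ> swp i) = insert i (excedances z)"
      using e by (auto simp: excedances_def transpose_def)
    moreover have "i \<notin> excedances z" using e by (simp add: excedances_def)
    ultimately show ?thesis using r1 fin(2) by (simp add: inv_rank_def act)
  next
    case False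
    define w where "w = z \<circ> swp i"
    have act: "inv_act z i = swp i \<circ> w"
      by (simp add: fun_eq_iff inv_act_apply[OF zi] False w_def)
    have winj: "inj w" unfolding w_def by (rule inj_compose[OF inj]) simp
    have "w (swp i (z i)) = i" "w (swp i (z (Suc i))) = Suc i"
      by (simp_all add: w_def is_invD[OF zi])
    moreover have "swp i (z i) < swp i (z (Suc i))"
    proof -
      have "swp i (z i) < swp i (z (Suc i)) \<longleftrightarrow> z i < z (Suc i)"
        by (rule swp_less) (use False in \<open>auto simp: fixes_pair_def\<close>)
      then show ?thesis using asc by simp
    qed
    ultimately have L: "inversions (swp i \<circ> w) = insert (swp i (z i), swp i (z (Suc i))) (inversions w)"
      "(swp i (z i), swp i (z (Suc i))) \<notin> inversions w"
      using inversions_swp_left[OF winj] by blast+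
    have "finite (inversions w)"
      using fin(1) unfolding w_def inversions_swp_right(1)[OF asc] by simp
    then have "card (inversions (inv_act z i)) = card (inversions z) + 2"
      using L r1 unfolding act by (simp add: w_def)
    moreover have "excedances (inv_act z i) = swp i ` excedances z"
    proof -
      have *: "swp i c < swp i (z c) \<longleftrightarrow> c < z c" for c
      proof (rule swp_less)
        have n: "\<not> (z i = Suc i)" using False is_inv_eq[OF zi, of i "Suc i"] by (auto simp: fixes_pair_def)
        then show "\<not> (c = i \<and> z c = Suc i)" by auto
        show "\<not> (c = Suc i \<and> z c = i)" using n is_inv_eq[OF zi, of i "Suc i"] by auto
      qed
      show ?thesis
      proof (intro set_eqI iffI)
        fix a assume "a \<in> excedances (inv_act z i)"
        then have "swp i a \<in> excedances z"
          using *[of "swp i a"] by (simp add: excedances_def act w_def)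
        then show "a \<in> swp i ` excedances z" by (force intro: image_eqI[of _ _ "swp i a"])
      next
        fix a assume "a \<in> swp i ` excedances z"
        then show "a \<in> excedances (inv_act z i)" using * by (auto simp: excedances_def act w_def)
      qed
    qed
    then have "card (excedances (inv_act z i)) = card (excedances z)"
      by (simp add: card_image inj_on_subset[OF inj_transpose])
    ultimately show ?thesis by (simp add: inv_rank_def)
  qed
qed

lemma inv_rank_descent:
  assumes z: "fin_inv z" and d: "z (Suc i) < z i"
  shows "inv_rank z = inv_rank (inv_act z i) + 2"
proof -
  note zi = fin_inv_is_inv[OF z]
  have "inv_act z i i < inv_act z i (Suc i)"
    using inv_act_descent[OF zi, of i] d is_inv_inj[OF is_inv_inv_act[OF zi], of i i "Suc i"] by auto
  from inv_rank_ascent[OF fin_inv_inv_act[OF z] this] show ?thesis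
    by (simp add: inv_act_inv_act[OF zi])
qed

text \<open>\<open>rpath y c z\<close>: the reversal of \<open>c\<close> is a chain from \<open>y\<close> up to \<open>z\<close> in involution weak order.\<close>

primrec rpath :: "(nat \<Rightarrow> nat) \<Rightarrow> nat list \<Rightarrow> (nat \<Rightarrow> nat) \<Rightarrow> bool" where
  "rpath y [] z \<longleftrightarrow> z = y"
| "rpath y (i # c) z \<longleftrightarrow> inv_desc i z \<and> rpath y c (inv_act z i)"

lemma rpath_foldl: "rpath y c z \<Longrightarrow> foldl inv_act y (rev c) = z"
  by (induction c arbitrary: z) (auto simp: inv_desc_def inv_act_inv_act)

lemma rpath_append: "rpath y (c @ d) z \<longleftrightarrow> (\<exists>w. rpath w c z \<and> rpath y d w)"
  by (induction c arbitrary: z) auto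

lemma foldl_fin_inv: "fin_inv y \<Longrightarrow> fin_inv (foldl inv_act y a)"
  by (induction a arbitrary: y) (auto simp: fin_inv_inv_act)

text \<open>A letter changes the rank by two, upwards exactly at an ascent. Hence the maximal rank
  is reached precisely by words all of whose steps go up.\<close>

lemma inv_rank_word:
  assumes "fin_inv y"
  shows "inv_rank (foldl inv_act y a) \<le> inv_rank y + 2 * length a"
    and "inv_rank (foldl inv_act y a) = inv_rank y + 2 * length a \<longleftrightarrow> rpath y (rev a) (foldl inv_act y a)"
proof (induction a rule: rev_induct)
  case (snoc i a)
  let ?w = "foldl inv_act y a"
  have w: "fin_inv ?w" by (rule foldl_fin_inv[OF assms])
  note wi = fin_inv_is_inv[OF w]
  have undo: "inv_act (inv_act ?w i) i = ?w" by (rule inv_act_inv_act[OF wi])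
  have d: "inv_desc i (inv_act ?w i) \<longleftrightarrow> ?w i < ?w (Suc i)"
    using inv_act_descent[OF wi] is_inv_inv_act[OF wi] by (simp add: inv_desc_def)
  {
    case 1
    show ?case
      using snoc inv_rank_ascent[OF w, of i] inv_rank_descent[OF w, of i] is_inv_inj[OF wi, of i "Suc i"]
      by (cases "?w i < ?w (Suc i)") auto
  next
    case 2
    show ?case
      using snoc inv_rank_ascent[OF w, of i] inv_rank_descent[OF w, of i] is_inv_inj[OF wi, of i "Suc i"]
      by (cases "?w i < ?w (Suc i)") (auto simp: d undo)
  }
qed auto

text \<open>Follow descents down. Since z fixes 0, the letter 0 never occurs, and an involution
  without descents is strictly increasing, hence the identity.\<close>

lemma rpath_exists:
  assumes "fin_inv z" "z 0 = 0"
  shows "\<exists>c. set c \<subseteq> {1..} \<and> rpath id c z"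
  using assms
proof (induction "inv_rank z" arbitrary: z rule: less_induct)
  case less
  note zi = fin_inv_is_inv[OF less.prems(1)]
  show ?case
  proof (cases "\<exists>i\<ge>1. z (Suc i) < z i")
    case True
    then obtain i where i: "1 \<le> i" "z (Suc i) < z i" by blast
    have "inv_rank (inv_act z i) < inv_rank z"
      using inv_rank_descent[OF less.prems(1) i(2)] by simp
    moreover have "inv_act z i 0 = 0"
      using i less.prems(2) by (simp add: inv_act_apply[OF zi])
    ultimately obtain c where "set c \<subseteq> {1..}" "rpath id c (inv_act z i)"
      using less.hyps fin_inv_inv_act[OF less.prems(1)] by blast
    then show ?thesis using i zi by (intro exI[of _ "i # c"]) (auto simp: inv_desc_def)
  next
    case False
    have "z i < z (Suc i)" for i
    proof (cases "i = 0")
      case True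
      then show ?thesis using less.prems(2) is_inv_inj[OF zi, of 0 "Suc 0"] by auto
    next
      case F: False
      then show ?thesis using False is_inv_inj[OF zi, of i "Suc i"] by (metis One_nat_def Suc_leI linorder_neqE_nat n_not_Suc_n neq0_conv)
    qed
    then have "strict_mono z" by (simp add: strict_mono_Suc_iff)
    then have ge: "j \<le> z j" for j by (rule strict_mono_imp_increasing)
    have "z j = j" for j using ge[of j] ge[of "z j"] is_invD[OF zi, of j] by simp
    then have "z = id" by auto
    then show ?thesis by (intro exI[of _ "[]"]) auto
  qed
qed

lemma fin_inv_id [simp]: "fin_inv id" by (simp add: fin_inv_def)

lemma inv_words_rpath:
  assumes z: "fin_inv z" "z 0 = 0"
  shows "inv_words z = {a. set a \<subseteq> {1..} \<and> rpath id (rev a) z}"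
proof -
  obtain c where c: "set c \<subseteq> {1..}" "rpath id c z" using rpath_exists[OF z] by blast
  have len: "inv_rank id + 2 * length (rev c) = inv_rank z"
    using inv_rank_word(2)[OF fin_inv_id, of "rev c"] rpath_foldl[OF c(2)] c(2) by simp
  have ex: "rev c \<in> inv_expressions z"
    using c rpath_foldl[OF c(2)] by (simp add: inv_expressions_def)
  have le: "inv_rank z \<le> inv_rank id + 2 * length b" if "b \<in> inv_expressions z" for b
    using inv_rank_word(1)[OF fin_inv_id, of b] that by (simp add: inv_expressions_def)
  show ?thesis
  proof (intro set_eqI iffI)
    fix a assume a: "a \<in> inv_words z"
    then have ae: "a \<in> inv_expressions z" and "length a \<le> length (rev c)"
      using ex by (auto simp: inv_words_def)
    then have "inv_rank z = inv_rank id + 2 * length a" using le[OF ae] len by simp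
    then show "a \<in> {a. set a \<subseteq> {1..} \<and> rpath id (rev a) z}"
      using inv_rank_word(2)[OF fin_inv_id, of a] ae by (simp add: inv_expressions_def)
  next
    fix a assume a: "a \<in> {a. set a \<subseteq> {1..} \<and> rpath id (rev a) z}"
    then have f: "foldl inv_act id a = z" using rpath_foldl[of id "rev a" z] by simp
    then have "inv_rank z = inv_rank id + 2 * length a"
      using inv_rank_word(2)[OF fin_inv_id, of a] a by simp
    then have "length a \<le> length b" if "b \<in> inv_expressions z" for b using le[OF that] by simp
    then show "a \<in> inv_words z" using a f by (simp add: inv_words_def inv_expressions_def)
  qed
qed

lemma rel_inv_words_rpath:
  assumes y: "fin_inv y" "y 0 = 0" and z: "fin_inv z" "z 0 = 0"
  shows "rel_inv_words y z = {b. set b \<subseteq> {1..} \<and> rpath y (rev b) z}"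
proof -
  obtain c where c: "set c \<subseteq> {1..}" "rpath id c y" using rpath_exists[OF y] by blast
  have "rev c \<in> inv_words y" using c by (simp add: inv_words_rpath[OF y])
  from rel_inv_words_independent[OF this]
  have "b \<in> rel_inv_words y z \<longleftrightarrow> set b \<subseteq> {1..} \<and> (\<exists>w. rpath w (rev b) z \<and> rpath id c w)" for b
    using c(1) by (auto simp: inv_words_rpath[OF z] rpath_append)
  moreover have "w = y" if "rpath id c w" for w
    using rpath_foldl[OF that] rpath_foldl[OF c(2)] by simp
  ultimately show ?thesis using c(2) by blast
qed

lemma rel_inv_words_length:
  assumes "fin_inv y" "rpath y (rev b) z"
  shows "inv_rank z = inv_rank y + 2 * length b"
  using inv_rank_word(2)[OF assms(1), of b] rpath_foldl[OF assms(2)] assms(2) by simp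

text \<open>A word and a compatible sequence are processed from their ends, as a list of pairs (index,
  letter); \<open>(r, i)\<close> is the last factor \<open>h_i(x_r)\<close> which may still be used.\<close>

primrec cw :: "(nat \<Rightarrow> nat) \<Rightarrow> nat \<Rightarrow> nat \<Rightarrow> (nat \<times> nat) list \<Rightarrow> (nat \<Rightarrow> nat) \<Rightarrow> bool" where
  "cw y r i [] z \<longleftrightarrow> z = y"
| "cw y r i (q # p) z \<longleftrightarrow> 1 \<le> fst q \<and> 1 \<le> snd q \<and> (fst q < r \<or> fst q = r \<and> i \<le> snd q) \<and>
     inv_desc (snd q) z \<and> cw y (fst q) (snd q) p (inv_act z (snd q))"

text \<open>The combinatorial form of one factor 1 + x u_i: the pair (r, i) is used or not. It
  cannot be used twice in a row, since i is no descent after acting there.\<close>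

lemma cw_step:
  assumes "1 \<le> r" "1 \<le> i"
  shows "{p. cw y r i p z} = {p. cw y r (Suc i) p z} \<union>
    (if inv_desc i z then (#) (r, i) ` {p. cw y r (Suc i) p (inv_act z i)} else {})"
proof -
  have weaken: "cw y r i p z \<longleftrightarrow> cw y r (Suc i) p z" if "\<not> inv_desc i z" for p z
    using that by (cases p) (auto simp: Suc_le_eq le_less)
  have "cw y r i p z \<longleftrightarrow> cw y r (Suc i) p z \<or> (inv_desc i z \<and> (\<exists>p'. p = (r, i) # p' \<and> cw y r (Suc i) p' (inv_act z i)))" for p
  proof (cases p)
    case (Cons q p')
    obtain j l where q: "q = (j, l)" by force
    have nd: "\<not> inv_desc i (inv_act z i)" if "inv_desc i z"
      using that inv_act_descent[of z i] by (auto simp: inv_desc_def)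
    show ?thesis
    proof (cases "q = (r, i)")
      case True
      then show ?thesis using Cons q assms weaken[of "inv_act z i" p'] nd by auto
    next
      case False
      then show ?thesis using Cons q by auto
    qed
  qed simp
  then show ?thesis by auto
qed

definition wt_prod :: "(nat \<Rightarrow> real) \<Rightarrow> (nat \<times> nat) list \<Rightarrow> real" where
  "wt_prod x p = (\<Prod>q\<leftarrow>p. x (fst q))"

text \<open>The head of the list belongs to the outermost factor. So the outer induction removes the
  last row, and the inner one goes through its generators from the smallest up; from N on there is
  no descent.\<close>

lemma cw_rows:
  assumes "\<And>j. N < j \<Longrightarrow> z j = j" "1 \<le> N"
  shows "finite {p. cw y m 1 p z} \<and>
    (\<Sum>p\<in>{p. cw y m 1 p z}. wt_prod x p) = inv.full_rows N m x (delta y) z"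
  using assms(1)
proof (induction m arbitrary: z)
  case 0
  have "cw y 0 1 p z \<longleftrightarrow> p = [] \<and> z = y" for p by (cases p) auto
  then have "{p. cw y 0 1 p z} = (if z = y then {[]} else {})" by auto
  then show ?case by (simp add: inv.full_rows_def wt_prod_def)
next
  case (Suc m)
  let ?v = "inv.full_rows N m x (delta y)"
  have small: "l < N" if "inv_desc l z" "\<And>j. N < j \<Longrightarrow> z j = j" for l z
  proof (rule ccontr)
    assume "\<not> l < N"
    then have "z (Suc l) = Suc l" using that(2) by simp
    moreover have "z l \<le> Suc l"
    proof (rule ccontr)
      assume "\<not> z l \<le> Suc l"
      then have "z (z l) = z l" using that(2)[of "z l"] \<open>\<not> l < N\<close> by simp
      then show False using that(1) is_invD[of z l] \<open>\<not> z l \<le> Suc l\<close> by (auto simp: inv_desc_def)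
    qed
    ultimately show False using that(1) by (simp add: inv_desc_def)
  qed
  have step: "finite {p. cw y (Suc m) i p z} \<and>
      (\<Sum>p\<in>{p. cw y (Suc m) i p z}. wt_prod x p) = inv.B (N - i) i (x (Suc m)) ?v z"
    if "1 \<le> i" "i \<le> N" "\<And>j. N < j \<Longrightarrow> z j = j" for i z
    using that(2,1,3)
  proof (induction i arbitrary: z rule: inc_induct)
    case base
    have "cw y (Suc m) N p z \<longleftrightarrow> cw y m 1 p z" for p
    proof (cases p)
      case (Cons q p')
      have "inv_desc (snd q) z \<Longrightarrow> \<not> N \<le> snd q"
        using small[OF _ base.prems(2), of "snd q"] by simp
      then show ?thesis unfolding Cons by (auto simp: less_Suc_eq)
    qed simp
    then show ?case using Suc.IH[OF base.prems(2)] by simp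
  next
    case (step i)
    have NS: "N - i = Suc (N - Suc i)" using step.hyps by simp
    have IH: "finite {p. cw y (Suc m) (Suc i) p z}"
      "(\<Sum>p\<in>{p. cw y (Suc m) (Suc i) p z}. wt_prod x p) = inv.B (N - Suc i) (Suc i) (x (Suc m)) ?v z"
      if "\<And>j. N < j \<Longrightarrow> z j = j" for z
      using step.IH[OF _ that] by auto
    note eq = cw_step[of "Suc m" i y z]
    show ?case
    proof (cases "inv_desc i z")
      case False
      then show ?thesis using eq step.prems IH[OF step.prems(2)]
        by (simp add: NS inv.h_move)
    next
      case True
      have fx: "inv_act z i j = j" if "N < j" for j
        using that step.prems(2)[OF that] step.hyps True by (simp add: inv_act_apply inv_desc_def)
      let ?A = "{p. cw y (Suc m) (Suc i) p z}"
      let ?C = "{p. cw y (Suc m) (Suc i) p (inv_act z i)}"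
      have set: "{p. cw y (Suc m) i p z} = ?A \<union> (#) (Suc m, i) ` ?C"
        using eq step.prems True by simp
      have disj: "?A \<inter> (#) (Suc m, i) ` ?C = {}" by auto
      have "(\<Sum>p\<in>(#) (Suc m, i) ` ?C. wt_prod x p) = (\<Sum>p\<in>?C. x (Suc m) * wt_prod x p)"
        by (subst sum.reindex) (auto simp: wt_prod_def)
      also have "\<dots> = x (Suc m) * inv.B (N - Suc i) (Suc i) (x (Suc m)) ?v (inv_act z i)"
        using IH(2)[OF fx] by (simp add: sum_distrib_left[symmetric])
      finally have s: "(\<Sum>p\<in>(#) (Suc m, i) ` ?C. wt_prod x p)
        = x (Suc m) * inv.B (N - Suc i) (Suc i) (x (Suc m)) ?v (inv_act z i)" .
      show ?thesis
        unfolding set using IH[OF step.prems(2)] IH[OF fx] disj s True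
        by (simp add: sum.union_disjoint NS inv.h_move)
    qed
  qed
  have "inv.full_rows N (Suc m) x (delta y) = inv.B (N - 1) 1 (x (Suc m)) ?v"
    by (simp add: inv.full_rows_def inv.brows_append)
  then show ?case using step[of 1 z] Suc.prems assms(2) by simp
qed

lemma cw_iff:
  "cw y r i p z \<longleftrightarrow> rpath y (map snd p) z \<and> set (map snd p) \<subseteq> {1..} \<and> set (map fst p) \<subseteq> {1..}
    \<and> (\<forall>k. Suc k < length p \<longrightarrow> fst (p ! Suc k) < fst (p ! k)
        \<or> fst (p ! Suc k) = fst (p ! k) \<and> snd (p ! k) \<le> snd (p ! Suc k))
    \<and> (p \<noteq> [] \<longrightarrow> fst (hd p) < r \<or> fst (hd p) = r \<and> i \<le> snd (hd p))"
proof (induction p arbitrary: r i z)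
  case (Cons q p)
  have all_split: "(\<forall>k. R k) \<longleftrightarrow> R 0 \<and> (\<forall>k. R (Suc k))" for R :: "nat \<Rightarrow> bool"
    by (metis nat.exhaust)
  have "(\<forall>k. Suc k < length (q # p) \<longrightarrow> fst ((q # p) ! Suc k) < fst ((q # p) ! k)
        \<or> fst ((q # p) ! Suc k) = fst ((q # p) ! k) \<and> snd ((q # p) ! k) \<le> snd ((q # p) ! Suc k))
    \<longleftrightarrow> (p \<noteq> [] \<longrightarrow> fst (hd p) < fst q \<or> fst (hd p) = fst q \<and> snd q \<le> snd (hd p))
      \<and> (\<forall>k. Suc k < length p \<longrightarrow> fst (p ! Suc k) < fst (p ! k)
        \<or> fst (p ! Suc k) = fst (p ! k) \<and> snd (p ! k) \<le> snd (p ! Suc k))"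
    by (subst all_split) (auto simp: hd_conv_nth)
  then show ?case unfolding cw.simps(2) Cons.IH by auto
qed simp

section \<open>Tableaux of staircase shape\<close>

definition cells :: "nat \<Rightarrow> (nat \<Rightarrow> nat) \<Rightarrow> (nat \<times> nat) set" where
  "cells k \<mu> = {(r, c). r < k \<and> c < \<mu> r}"

text \<open>The partition fits into a square of side k, so that all beads lie at places 1 to
  2k.\<close>

definition is_part :: "nat \<Rightarrow> (nat \<Rightarrow> nat) \<Rightarrow> bool" where
  "is_part k \<mu> \<longleftrightarrow> (\<forall>r<k. \<mu> r \<le> k) \<and> (\<forall>r r'. r \<le> r' \<longrightarrow> r' < k \<longrightarrow> \<mu> r' \<le> \<mu> r)"

text \<open>Row \<open>r\<close> of the partition becomes a one at position \<open>\<mu> r + k - r\<close>, so that removing a cell moves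
  a one to the left.\<close>

definition beads :: "nat \<Rightarrow> (nat \<Rightarrow> nat) \<Rightarrow> nat \<Rightarrow> nat" where
  "beads k \<mu> i = (if 1 \<le> i \<and> i \<le> 2 * k then (if \<exists>r<k. i = \<mu> r + (k - r) then 1 else 0)
     else if even i then 1 else 0)"

definition corner :: "nat \<Rightarrow> (nat \<Rightarrow> nat) \<Rightarrow> nat \<Rightarrow> bool" where
  "corner k \<mu> r \<longleftrightarrow> r < k \<and> 0 < \<mu> r \<and> (Suc r < k \<longrightarrow> \<mu> (Suc r) < \<mu> r)"

lemma finite_cells [simp]: "finite (cells k \<mu>)"
proof -
  have "cells k \<mu> = Sigma {..<k} (\<lambda>r. {..<\<mu> r})" by (auto simp: cells_def)
  then show ?thesis by simp
qed

lemma bead_less: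
  assumes "is_part k \<mu>" "r < r'" "r' < k"
  shows "\<mu> r' + (k - r') < \<mu> r + (k - r)"
proof (rule add_le_less_mono)
  show "\<mu> r' \<le> \<mu> r" using assms by (simp add: is_part_def)
  show "k - r' < k - r" using assms(2,3) by simp
qed

text \<open>Shortening row r moves its bead from i + 1 to i. That place is free because the next row
  is strictly shorter, if there is one.\<close>

lemma beads_corner:
  assumes p: "is_part k \<mu>" and c: "corner k \<mu> r" and i: "i = \<mu> r + (k - r) - 1"
  shows "beads k \<mu> i = 0" "beads k \<mu> (Suc i) = 1" "1 \<le> i"
    "is_part k (\<mu>(r := \<mu> r - 1))" "seq_move i (beads k \<mu>) = beads k (\<mu>(r := \<mu> r - 1))"
proof -
  have r: "r < k" "0 < \<mu> r" "Suc r < k \<Longrightarrow> \<mu> (Suc r) < \<mu> r" using c by (auto simp: corner_def)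
  have le: "\<mu> r \<le> k" using p r by (simp add: is_part_def)
  have Si: "Suc i = \<mu> r + (k - r)" "Suc i \<le> 2 * k" "1 \<le> i" using r le i by auto
  show "1 \<le> i" by fact
  have other: "s \<noteq> r \<Longrightarrow> s < k \<Longrightarrow> \<mu> s + (k - s) \<noteq> Suc i \<and> \<mu> s + (k - s) \<noteq> i" for s
  proof -
    assume s: "s \<noteq> r" "s < k"
    show "\<mu> s + (k - s) \<noteq> Suc i \<and> \<mu> s + (k - s) \<noteq> i"
    proof (cases "s < r")
      case True
      then show ?thesis using bead_less[OF p True r(1)] Si by simp
    next
      case False
      then have "r < s" using s by simp
      then have "\<mu> s \<le> \<mu> (Suc r)" "Suc r < k" using p s by (auto simp: is_part_def)
      then show ?thesis using r(3) Si \<open>r < s\<close> s by auto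
    qed
  qed
  have nr: "\<mu> r + (k - r) \<noteq> i" using Si by simp
  have "\<nexists>s. s < k \<and> i = \<mu> s + (k - s)" using other nr by metis
  then show b0: "beads k \<mu> i = 0" using Si by (auto simp: beads_def)
  show b1: "beads k \<mu> (Suc i) = 1" using Si r by (auto simp: beads_def)
  show "is_part k (\<mu>(r := \<mu> r - 1))"
    unfolding is_part_def
  proof (intro conjI allI impI)
    fix s assume "s < k"
    then show "(\<mu>(r := \<mu> r - 1)) s \<le> k" using p le by (auto simp: is_part_def)
  next
    fix s s' assume s: "s \<le> s'" "s' < k"
    show "(\<mu>(r := \<mu> r - 1)) s' \<le> (\<mu>(r := \<mu> r - 1)) s"
    proof (cases "s = r \<and> s' \<noteq> r")
      case True
      then have "\<mu> s' \<le> \<mu> (Suc r)" "Suc r < k" using p s by (auto simp: is_part_def)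
      then show ?thesis using True r(3) by auto
    next
      case False
      have "\<mu> s' \<le> \<mu> s" using p s by (simp add: is_part_def)
      then show ?thesis using False by auto
    qed
  qed
  let ?\<nu> = "\<mu>(r := \<mu> r - 1)"
  have ex: "(\<exists>s<k. j = ?\<nu> s + (k - s)) \<longleftrightarrow> j = i \<or> j \<noteq> Suc i \<and> (\<exists>s<k. j = \<mu> s + (k - s))" for j
  proof -
    have "?\<nu> r + (k - r) = i" using r Si by simp
    then have "(\<exists>s<k. j = ?\<nu> s + (k - s)) \<longleftrightarrow> j = i \<or> (\<exists>s<k. s \<noteq> r \<and> j = \<mu> s + (k - s))"
      using r(1) by (metis fun_upd_other)
    moreover have "(\<exists>s<k. j = \<mu> s + (k - s)) \<longleftrightarrow> j = Suc i \<or> (\<exists>s<k. s \<noteq> r \<and> j = \<mu> s + (k - s))"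
      using r(1) Si(1) by metis
    moreover have "j \<noteq> Suc i" if "\<exists>s<k. s \<noteq> r \<and> j = \<mu> s + (k - s)"
      using that other by metis
    ultimately show ?thesis by auto
  qed
  show "seq_move i (beads k \<mu>) = beads k ?\<nu>"
  proof
    fix j
    consider "j = i" | "j = Suc i" | "j \<noteq> i" "j \<noteq> Suc i" by blast
    then show "seq_move i (beads k \<mu>) j = beads k ?\<nu> j"
    proof cases
      case 1
      have "beads k ?\<nu> i = 1" unfolding beads_def ex using Si by simp
      then show ?thesis using 1 b1 by simp
    next
      case 2
      have "beads k ?\<nu> (Suc i) = 0" unfolding beads_def ex using Si by simp
      then show ?thesis using 2 b0 by simp
    next
      case 3
      then have "beads k ?\<nu> j = beads k \<mu> j" unfolding beads_def ex by simp
      then show ?thesis using 3 by simp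
    qed
  qed
qed

text \<open>Conversely, a bead with a free place to its left belongs to a corner: if the next row
  were equally long, its bead would occupy that place.\<close>

lemma beads_no_corner:
  assumes p: "is_part k \<mu>" and i: "1 \<le> i" "i < 2 * k"
    and asc: "beads k \<mu> i < beads k \<mu> (Suc i)"
  obtains r where "corner k \<mu> r" "i = \<mu> r + (k - r) - 1"
proof -
  have "beads k \<mu> j = 0 \<or> beads k \<mu> j = 1" for j by (simp add: beads_def)
  then have b: "beads k \<mu> i = 0" "beads k \<mu> (Suc i) = 1" using asc by (metis less_one less_zeroE less_irrefl)+
  have "\<exists>r<k. Suc i = \<mu> r + (k - r)"
  proof (rule ccontr)
    assume "\<not> ?thesis"
    then have "beads k \<mu> (Suc i) = 0" using i unfolding beads_def by simp
    then show False using b(2) by simp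
  qed
  then obtain r where r: "r < k" "Suc i = \<mu> r + (k - r)" by blast
  have n: "i \<noteq> \<mu> s + (k - s)" if "s < k" for s
  proof
    assume "i = \<mu> s + (k - s)"
    then have "\<exists>r<k. i = \<mu> r + (k - r)" using that by blast
    then have "beads k \<mu> i = 1" using i by (simp add: beads_def)
    then show False using b(1) by simp
  qed
  have "\<mu> (Suc r) < \<mu> r" if "Suc r < k"
  proof -
    have "\<mu> (Suc r) \<le> \<mu> r" using p that by (simp add: is_part_def)
    moreover have "\<mu> (Suc r) \<noteq> \<mu> r" using n[OF that] r that by auto
    ultimately show ?thesis by simp
  qed
  moreover have "0 < \<mu> r"
  proof (rule ccontr)
    assume "\<not> 0 < \<mu> r"
    then have "\<mu> r = 0" "Suc r < k" using r i by auto
    then show False using \<open>Suc r < k \<Longrightarrow> \<mu> (Suc r) < \<mu> r\<close> by simp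
  qed
  ultimately have "corner k \<mu> r" using r by (simp add: corner_def)
  then show ?thesis using that r by simp
qed

lemma corner_unique:
  assumes "is_part k \<mu>" "r < k" "r' < k" "\<mu> r + (k - r) = \<mu> r' + (k - r')"
  shows "r = r'"
  using bead_less[OF assms(1), of r r'] bead_less[OF assms(1), of r' r] assms(2-4)
  by (metis less_irrefl linorder_neqE_nat)

section \<open>Semistandard tableaux by removal of corners\<close>

definition semistd :: "(nat \<times> nat) set \<Rightarrow> (nat \<times> nat \<Rightarrow> nat) \<Rightarrow> bool" where
  "semistd D T \<longleftrightarrow>
    (\<forall>r c c'. (r, c) \<in> D \<longrightarrow> (r, c') \<in> D \<longrightarrow> c < c' \<longrightarrow> T (r, c) \<le> T (r, c')) \<and>
    (\<forall>r r' c. (r, c) \<in> D \<longrightarrow> (r', c) \<in> D \<longrightarrow> r < r' \<longrightarrow> T (r, c) < T (r', c))"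

lemma semistd_subset:
  assumes "semistd D T" "E \<subseteq> D" "\<And>s. s \<in> E \<Longrightarrow> T' s = T s"
  shows "semistd E T'"
proof -
  have "T' (r, c) \<le> T' (r, c')" if "(r, c) \<in> E" "(r, c') \<in> E" "c < c'" for r c c'
    using assms(1) subsetD[OF assms(2) that(1)] subsetD[OF assms(2) that(2)] that(3)
    unfolding assms(3)[OF that(1)] assms(3)[OF that(2)] semistd_def by blast
  moreover have "T' (r, c) < T' (r', c)" if "(r, c) \<in> E" "(r', c) \<in> E" "r < r'" for r r' c
    using assms(1) subsetD[OF assms(2) that(1)] subsetD[OF assms(2) that(2)] that(3)
    unfolding assms(3)[OF that(1)] assms(3)[OF that(2)] semistd_def by blast
  ultimately show ?thesis by (auto simp: semistd_def)
qed

text \<open>Tableaux with entries up to \<open>m\<close>, where \<open>m\<close> is only allowed in cells of content up to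
  \<open>i - k\<close>.\<close>

definition tabs :: "nat \<Rightarrow> nat \<Rightarrow> nat \<Rightarrow> (nat \<Rightarrow> nat) \<Rightarrow> (nat \<times> nat \<Rightarrow> nat) set" where
  "tabs k m i \<mu> = {T \<in> cells k \<mu> \<rightarrow>\<^sub>E {1..m}. semistd (cells k \<mu>) T \<and>
     (\<forall>(r, c)\<in>cells k \<mu>. T (r, c) = m \<longrightarrow> c + (k - r) \<le> i)}"

definition tab_prod :: "(nat \<Rightarrow> real) \<Rightarrow> (nat \<times> nat) set \<Rightarrow> (nat \<times> nat \<Rightarrow> nat) \<Rightarrow> real" where
  "tab_prod x D T = (\<Prod>p\<in>D. x (T p))"

lemma finite_tabs: "finite (tabs k m i \<mu>)"
  by (rule finite_subset[of _ "cells k \<mu> \<rightarrow>\<^sub>E {1..m}"]) (auto simp: tabs_def intro: finite_PiE)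

lemma cells_remove:
  assumes "corner k \<mu> r"
  shows "cells k \<mu> = insert (r, \<mu> r - 1) (cells k (\<mu>(r := \<mu> r - 1)))"
    "(r, \<mu> r - 1) \<notin> cells k (\<mu>(r := \<mu> r - 1))"
  using assms by (auto simp: cells_def corner_def split: if_splits)

text \<open>A right neighbour would again contain m, but with larger content, and an entry below
  would exceed m.\<close>

lemma tabs_top_cell:
  assumes p: "is_part k \<mu>" and T: "T \<in> tabs k m i \<mu>" and rc: "(r, c) \<in> cells k \<mu>" "T (r, c) = m"
    "c + (k - r) = i"
  shows "corner k \<mu> r" "c = \<mu> r - 1"
proof -
  have ss: "semistd (cells k \<mu>) T" and le: "\<And>q. q \<in> cells k \<mu> \<Longrightarrow> T q \<le> m"
    and top: "\<And>r c. (r, c) \<in> cells k \<mu> \<Longrightarrow> T (r, c) = m \<Longrightarrow> c + (k - r) \<le> i"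
    using T by (auto simp: tabs_def)
  have "(r, Suc c) \<notin> cells k \<mu>"
  proof
    assume a: "(r, Suc c) \<in> cells k \<mu>"
    then have "T (r, c) \<le> T (r, Suc c)" using ss rc(1) by (simp add: semistd_def)
    then have "T (r, Suc c) = m" using le[OF a] rc(2) by simp
    then show False using top[OF a] rc(3) by simp
  qed
  then have c: "\<mu> r = Suc c" using rc(1) by (auto simp: cells_def)
  have "(Suc r, c) \<notin> cells k \<mu>"
  proof
    assume a: "(Suc r, c) \<in> cells k \<mu>"
    then have "T (r, c) < T (Suc r, c)" using ss rc(1) by (simp add: semistd_def)
    then show False using le[OF a] rc(2) by simp
  qed
  then show "corner k \<mu> r" using c rc(1) by (auto simp: corner_def cells_def not_less)
  show "c = \<mu> r - 1" using c by simp
qed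

lemma tabs_Suc_no_corner:
  assumes p: "is_part k \<mu>" and "\<And>r. corner k \<mu> r \<Longrightarrow> Suc i \<noteq> \<mu> r + (k - r) - 1"
  shows "tabs k m (Suc i) \<mu> = tabs k m i \<mu>"
proof
  show "tabs k m (Suc i) \<mu> \<subseteq> tabs k m i \<mu>"
  proof
    fix T assume T: "T \<in> tabs k m (Suc i) \<mu>"
    have "c + (k - r) \<le> i" if "(r, c) \<in> cells k \<mu>" "T (r, c) = m" for r c
    proof -
      have "c + (k - r) \<le> Suc i" using T that by (auto simp: tabs_def)
      moreover have "c + (k - r) \<noteq> Suc i"
      proof
        assume e: "c + (k - r) = Suc i"
        from tabs_top_cell[OF p T that e] have "corner k \<mu> r" "c = \<mu> r - 1" .
        then show False using assms(2)[of r] e by (auto simp: corner_def)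
      qed
      ultimately show ?thesis by simp
    qed
    then show "T \<in> tabs k m i \<mu>" using T by (auto simp: tabs_def)
  qed
  show "tabs k m i \<mu> \<subseteq> tabs k m (Suc i) \<mu>" by (auto simp: tabs_def)
qed

text \<open>The additional tableaux have m in the corner on the newly allowed diagonal; there is
  only one such corner, and removing it leaves a tableau obeying the old bound. This mirrors one
  factor 1 + x u acting on beads.\<close>

lemma tabs_Suc_corner:
  assumes p: "is_part k \<mu>" and c: "corner k \<mu> r" and i: "Suc i = \<mu> r + (k - r) - 1" and m: "1 \<le> m"
  defines "q \<equiv> (r, \<mu> r - 1)" and "\<nu> \<equiv> \<mu>(r := \<mu> r - 1)"
  shows "tabs k m (Suc i) \<mu> = tabs k m i \<mu> \<union> (\<lambda>T. T(q := m)) ` tabs k m i \<nu>"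
    "tabs k m i \<mu> \<inter> (\<lambda>T. T(q := m)) ` tabs k m i \<nu> = {}"
    "inj_on (\<lambda>T. T(q := m)) (tabs k m i \<nu>)"
proof -
  note D = cells_remove[OF c, folded q_def \<nu>_def]
  have r: "r < k" "0 < \<mu> r" "Suc r < k \<Longrightarrow> \<mu> (Suc r) < \<mu> r" using c by (auto simp: corner_def)
  have idx: "\<mu> r - 1 + (k - r) = Suc i" using i r by simp
  show "tabs k m i \<mu> \<inter> (\<lambda>T. T(q := m)) ` tabs k m i \<nu> = {}"
    using idx D by (auto simp: tabs_def q_def)
  show "inj_on (\<lambda>T. T(q := m)) (tabs k m i \<nu>)"
  proof (rule inj_onI)
    fix T T' assume T: "T \<in> tabs k m i \<nu>" "T' \<in> tabs k m i \<nu>" "T(q := m) = T'(q := m)"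
    have "T q = undefined" "T' q = undefined"
      using T(1,2) D(2) PiE_arb[of _ "cells k \<nu>" "\<lambda>_. {1..m}" q] by (auto simp: tabs_def simp del: split_paired_All)
    then show "T = T'" using T(3) by (metis fun_upd_triv fun_upd_upd)
  qed
  show "tabs k m (Suc i) \<mu> = tabs k m i \<mu> \<union> (\<lambda>T. T(q := m)) ` tabs k m i \<nu>"
  proof (intro set_eqI iffI)
    fix T assume T: "T \<in> tabs k m (Suc i) \<mu>"
    then have ss: "semistd (cells k \<mu>) T" and ext: "T \<in> cells k \<mu> \<rightarrow>\<^sub>E {1..m}"
      and top: "\<And>r c. (r, c) \<in> cells k \<mu> \<Longrightarrow> T (r, c) = m \<Longrightarrow> c + (k - r) \<le> Suc i"
      by (auto simp: tabs_def)
    have only: "(r', c') = q" if "(r', c') \<in> cells k \<mu>" "T (r', c') = m" "c' + (k - r') = Suc i" for r' c'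
    proof -
      from tabs_top_cell[OF p T that] have *: "corner k \<mu> r'" "c' = \<mu> r' - 1" .
      then have "\<mu> r' + (k - r') = \<mu> r + (k - r)" using that idx r by (auto simp: corner_def)
      then have "r' = r" using corner_unique[OF p, of r' r] * r by (simp add: corner_def)
      then show ?thesis using * by (simp add: q_def)
    qed
    show "T \<in> tabs k m i \<mu> \<union> (\<lambda>T. T(q := m)) ` tabs k m i \<nu>"
    proof (cases "T q = m")
      case False
      have "c' + (k - r') \<le> i" if "(r', c') \<in> cells k \<mu>" "T (r', c') = m" for r' c'
        using top[OF that] only[OF that] that(2) False by (cases "c' + (k - r') = Suc i") auto
      then have "T \<in> tabs k m i \<mu>" using ss ext by (auto simp: tabs_def)
      then show ?thesis ..
    next
      case True
      define T' where "T' = T(q := undefined)"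
      have T'eq: "T' s = T s" if "s \<in> cells k \<nu>" for s using that D(2) by (auto simp: T'_def)
      have sub: "cells k \<nu> \<subseteq> cells k \<mu>" using D(1) by blast
      have "T' \<in> cells k \<nu> \<rightarrow>\<^sub>E {1..m}"
        using ext D by (auto simp: T'_def PiE_def extensional_def)
      moreover have "semistd (cells k \<nu>) T'"
        by (rule semistd_subset[OF ss sub T'eq])
      moreover have "c' + (k - r') \<le> i" if "(r', c') \<in> cells k \<nu>" "T' (r', c') = m" for r' c'
      proof -
        have a: "(r', c') \<in> cells k \<mu>" "T (r', c') = m" using that sub T'eq by auto
        have "(r', c') \<noteq> q" using that(1) D(2) by auto
        then show ?thesis using top[OF a] only[OF a] by fastforce
      qed
      ultimately have "T' \<in> tabs k m i \<nu>" by (auto simp: tabs_def)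
      moreover have "T = T'(q := m)" unfolding T'_def fun_upd_upd True[symmetric] by simp
      ultimately show ?thesis by blast
    qed
  next
    fix T assume "T \<in> tabs k m i \<mu> \<union> (\<lambda>T. T(q := m)) ` tabs k m i \<nu>"
    then show "T \<in> tabs k m (Suc i) \<mu>"
    proof
      assume "T \<in> tabs k m i \<mu>"
      then show ?thesis by (auto simp: tabs_def)
    next
      assume "T \<in> (\<lambda>T. T(q := m)) ` tabs k m i \<nu>"
      then obtain T' where T': "T' \<in> tabs k m i \<nu>" "T = T'(q := m)" by blast
      then have ss: "semistd (cells k \<nu>) T'" and ext: "T' \<in> cells k \<nu> \<rightarrow>\<^sub>E {1..m}"
        and top: "\<And>r c. (r, c) \<in> cells k \<nu> \<Longrightarrow> T' (r, c) = m \<Longrightarrow> c + (k - r) \<le> i"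
        by (auto simp: tabs_def)
      have Tq: "T q = m" by (simp add: T')
      have Teq: "T s = T' s" if "s \<in> cells k \<nu>" for s using that D(2) T' by auto
      have le: "T' s \<le> m" if "s \<in> cells k \<nu>" for s using ext that by auto
      have "T \<in> cells k \<mu> \<rightarrow>\<^sub>E {1..m}"
        using ext m unfolding D(1) T'(2) by (auto simp: PiE_def extensional_def)
      moreover have "semistd (cells k \<mu>) T"
        unfolding semistd_def
      proof (intro conjI allI impI)
        fix r' a b assume ab: "(r', a) \<in> cells k \<mu>" "(r', b) \<in> cells k \<mu>" "a < b"
        have "(r', a) \<noteq> q" using ab by (auto simp: q_def cells_def)
        then have a: "(r', a) \<in> cells k \<nu>" using ab(1) D(1) by auto
        show "T (r', a) \<le> T (r', b)"
        proof (cases "(r', b) = q")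
          case True
          then show ?thesis using le[OF a] Teq[OF a] Tq by simp
        next
          case False
          then have b: "(r', b) \<in> cells k \<nu>" using ab(2) D(1) by auto
          show ?thesis using ss a b ab(3) Teq[OF a] Teq[OF b] by (simp add: semistd_def)
        qed
      next
        fix a b c' assume ab: "(a, c') \<in> cells k \<mu>" "(b, c') \<in> cells k \<mu>" "a < b"
        have "(a, c') \<noteq> q"
        proof
          assume q: "(a, c') = q"
          then have "Suc r < k" "\<mu> b \<le> \<mu> (Suc r)" "c' < \<mu> b"
            using ab p by (auto simp: q_def cells_def is_part_def)
          then show False using r(3) q by (auto simp: q_def)
        qed
        then have a: "(a, c') \<in> cells k \<nu>" using ab(1) D(1) by auto
        show "T (a, c') < T (b, c')"
        proof (cases "(b, c') = q")
          case True
          \<comment> \<open>A cell above the corner has larger content, so the bound forbids a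
            second entry m in this column.\<close>
          have "T' (a, c') \<noteq> m"
          proof
            assume "T' (a, c') = m"
            then have "c' + (k - a) \<le> i" by (rule top[OF a])
            then show False using True ab(3) idx r by (auto simp: q_def)
          qed
          then show ?thesis using le[OF a] Teq[OF a] Tq True by simp
        next
          case False
          then have b: "(b, c') \<in> cells k \<nu>" using ab(2) D(1) by auto
          show ?thesis using ss a b ab(3) Teq[OF a] Teq[OF b] by (simp add: semistd_def)
        qed
      qed
      moreover have "c' + (k - r') \<le> Suc i" if "(r', c') \<in> cells k \<mu>" "T (r', c') = m" for r' c'
      proof (cases "(r', c') = q")
        case True
        then show ?thesis using idx by (simp add: q_def)
      next
        case False
        then have "(r', c') \<in> cells k \<nu>" using that(1) D(1) by auto
        then show ?thesis using top[of r' c'] Teq[of "(r', c')"] that(2) by simp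
      qed
      ultimately show ?thesis by (auto simp: tabs_def)
    qed
  qed
qed

text \<open>The operator side of \<open>tabs k (Suc m) i\<close>: largest entries are removed first,
  the variable of \<open>Suc m\<close> uses only generators up to i, and \<open>block 1 k\<close> is
  the bead sequence of the empty partition.\<close>

definition bead_rows :: "nat \<Rightarrow> (nat \<Rightarrow> real) \<Rightarrow> nat \<Rightarrow> nat \<Rightarrow> (nat \<Rightarrow> nat) \<Rightarrow> real" where
  "bead_rows k x m i \<mu> = sq.brows (2 * k) (\<lambda>_. 1) x (rev [1..<Suc m])
     (sq.B i 1 (x (Suc m)) (delta (beads k \<mu>))) (block 1 k)"

lemma bead_rows_Suc:
  "bead_rows k x m (Suc i) \<mu> = bead_rows k x m i \<mu> + (if beads k \<mu> (Suc i) < beads k \<mu> (Suc (Suc i))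
    then x (Suc m) * sq.brows (2 * k) (\<lambda>_. 1) x (rev [1..<Suc m])
     (sq.B i 1 (x (Suc m)) (delta (seq_move (Suc i) (beads k \<mu>)))) (block 1 k) else 0)"
proof -
  let ?b = "beads k \<mu>" and ?y = "x (Suc m)"
  define F where "F v = sq.brows (2 * k) (\<lambda>_. 1) x (rev [1..<Suc m]) (sq.B i 1 ?y v)" for v
  have lin: "lin_op F" unfolding F_def by (rule lin_op_comp[OF sq.brows_lin sq.B_lin])
  have last: "sq.B (Suc c) k y v = sq.B c k y (sq.h (k + c) y v)" for c k y v
    by (induction c arbitrary: k) auto
  have "sq.h (Suc i) ?y (delta ?b) = (\<lambda>z. 1 * delta ?b z + ?y * seq_op (Suc i) (delta ?b) z)"
    by (simp add: sq.h_def)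
  then have h: "F (sq.h (Suc i) ?y (delta ?b)) = (\<lambda>z. 1 * F (delta ?b) z + ?y * F (seq_op (Suc i) (delta ?b)) z)"
    by (simp only: lin_opD[OF lin])
  have zero: "F (\<lambda>z. 0) = (\<lambda>z. 0)"
    using lin_opD[OF lin, of 0 "\<lambda>_. 0" 0 "\<lambda>_. 0"] by simp
  have "sq.B (Suc i) 1 ?y (delta ?b) = sq.B i 1 ?y (sq.h (Suc i) ?y (delta ?b))"
    using last[of i 1] by (simp only: plus_1_eq_Suc)
  then have "bead_rows k x m (Suc i) \<mu> = F (sq.h (Suc i) ?y (delta ?b)) (block 1 k)"
    by (simp only: bead_rows_def F_def)
  moreover have "bead_rows k x m i \<mu> = F (delta ?b) (block 1 k)"
    by (simp only: bead_rows_def F_def)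
  ultimately show ?thesis
    unfolding F_def[symmetric] h by (simp add: seq_op_delta zero)
qed

lemma beads_empty:
  assumes p: "is_part k \<mu>"
  shows "block 1 k = beads k \<mu> \<longleftrightarrow> cells k \<mu> = {}"
proof
  assume "cells k \<mu> = {}"
  then have z: "\<mu> r = 0" if "r < k" for r using that by (auto simp: cells_def)
  have "(\<exists>r<k. i = \<mu> r + (k - r)) \<longleftrightarrow> 1 \<le> i \<and> i \<le> k" for i
  proof
    assume "1 \<le> i \<and> i \<le> k"
    then show "\<exists>r<k. i = \<mu> r + (k - r)" by (intro exI[of _ "k - i"]) (auto simp: z)
  qed (auto simp: z)
  then show "block 1 k = beads k \<mu>" by (auto simp: fun_eq_iff beads_def block_def)
next
  assume e: "block 1 k = beads k \<mu>"
  show "cells k \<mu> = {}"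
  proof (cases "k = 0")
    case False
    then have "\<mu> 0 \<le> k" using p by (simp add: is_part_def)
    have "\<exists>r<k. \<mu> 0 + k = \<mu> r + (k - r)" by (rule exI[of _ 0]) (use False in simp)
    then have "beads k \<mu> (\<mu> 0 + k) = 1" using False \<open>\<mu> 0 \<le> k\<close> by (simp add: beads_def)
    then have b: "block 1 k (\<mu> 0 + k) = 1" using e by simp
    have "\<mu> 0 = 0"
    proof (rule ccontr)
      assume "\<mu> 0 \<noteq> 0"
      then have "block 1 k (\<mu> 0 + k) = 0" using \<open>\<mu> 0 \<le> k\<close> by (simp add: block_def)
      then show False using b by simp
    qed
    have "\<mu> r \<le> \<mu> 0" if "r < k" for r using p that by (simp add: is_part_def)
    then show ?thesis using \<open>\<mu> 0 = 0\<close> by (auto simp: cells_def)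
  qed (auto simp: cells_def)
qed

lemma tabs_bead_rows_step:
  assumes base: "\<And>\<mu>. is_part k \<mu> \<Longrightarrow>
      (\<Sum>T\<in>tabs k (Suc m) 0 \<mu>. tab_prod x (cells k \<mu>) T) = bead_rows k x m 0 \<mu>"
    and "i < 2 * k" "is_part k \<mu>"
  shows "(\<Sum>T\<in>tabs k (Suc m) i \<mu>. tab_prod x (cells k \<mu>) T) = bead_rows k x m i \<mu>"
  using assms(2,3)
proof (induction i arbitrary: \<mu>)
  case 0
  then show ?case by (intro base)
next
  case (Suc i)
  note p = Suc.prems(2)
  show ?case
  proof (cases "\<exists>r. corner k \<mu> r \<and> Suc i = \<mu> r + (k - r) - 1")
    case True
    then obtain r where r: "corner k \<mu> r" "Suc i = \<mu> r + (k - r) - 1" by blast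
    define q \<nu> where "q = (r, \<mu> r - 1)" and "\<nu> = \<mu>(r := \<mu> r - 1)"
    note bc = beads_corner[OF p r, folded \<nu>_def]
    note D = cells_remove[OF r(1), folded q_def \<nu>_def]
    note t = tabs_Suc_corner[OF p r, of "Suc m", folded q_def \<nu>_def]
    have "(\<Sum>T\<in>(\<lambda>T. T(q := Suc m)) ` tabs k (Suc m) i \<nu>. tab_prod x (cells k \<mu>) T)
        = (\<Sum>T\<in>tabs k (Suc m) i \<nu>. x (Suc m) * tab_prod x (cells k \<nu>) T)"
    proof (subst sum.reindex[OF t(3)])
      have "tab_prod x (cells k \<mu>) (T(q := Suc m)) = x (Suc m) * tab_prod x (cells k \<nu>) T" for T
      proof -
        have "(\<Prod>s\<in>cells k \<nu>. x ((T(q := Suc m)) s)) = (\<Prod>s\<in>cells k \<nu>. x (T s))"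
          using D(2) by (intro prod.cong) auto
        then show ?thesis unfolding tab_prod_def D(1) using D(2) by simp
      qed
      then show "(\<Sum>T\<in>tabs k (Suc m) i \<nu>. ((tab_prod x (cells k \<mu>)) \<circ> (\<lambda>T. T(q := Suc m))) T)
        = (\<Sum>T\<in>tabs k (Suc m) i \<nu>. x (Suc m) * tab_prod x (cells k \<nu>) T)" by simp
    qed simp_all
    also have "\<dots> = x (Suc m) * bead_rows k x m i \<nu>"
      using Suc.IH[OF _ bc(4)] Suc.prems(1) by (simp add: sum_distrib_left[symmetric])
    finally have s: "(\<Sum>T\<in>(\<lambda>T. T(q := Suc m)) ` tabs k (Suc m) i \<nu>. tab_prod x (cells k \<mu>) T)
        = x (Suc m) * bead_rows k x m i \<nu>" .
    have "(\<Sum>T\<in>tabs k (Suc m) (Suc i) \<mu>. tab_prod x (cells k \<mu>) T)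
        = bead_rows k x m i \<mu> + x (Suc m) * bead_rows k x m i \<nu>"
      using t Suc.IH[OF _ p] Suc.prems(1) s by (simp add: sum.union_disjoint finite_tabs)
    also have "\<dots> = bead_rows k x m (Suc i) \<mu>"
      unfolding bead_rows_Suc bc(1,2,5) bead_rows_def[of k x m i \<nu>] by simp
    finally show ?thesis .
  next
    case False
    then have "tabs k (Suc m) (Suc i) \<mu> = tabs k (Suc m) i \<mu>"
      by (intro tabs_Suc_no_corner[OF p]) blast
    moreover have "\<not> beads k \<mu> (Suc i) < beads k \<mu> (Suc (Suc i))"
    proof
      assume "beads k \<mu> (Suc i) < beads k \<mu> (Suc (Suc i))"
      then obtain r where "corner k \<mu> r" "Suc i = \<mu> r + (k - r) - 1"
        using beads_no_corner[OF p _ Suc.prems(1)] by auto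
      then show False using False by blast
    qed
    ultimately show ?thesis
      using Suc.IH[OF _ p] Suc.prems(1) by (simp add: bead_rows_Suc)
  qed
qed

lemma tabs_empty: "cells k \<mu> = {} \<Longrightarrow> tabs k m i \<mu> = {\<lambda>_. undefined}"
  by (auto simp: tabs_def semistd_def)

text \<open>The outer induction lowers the largest entry: i = 0 forbids it altogether, because every
  cell has positive shifted content, while i = 2k - 1 is no restriction on the next smaller
  one.\<close>

lemma tabs_bead_rows:
  assumes "is_part k \<mu>" "i < 2 * k"
  shows "(\<Sum>T\<in>tabs k (Suc m) i \<mu>. tab_prod x (cells k \<mu>) T) = bead_rows k x m i \<mu>"
  using assms
proof (induction m arbitrary: i \<mu>)
  case 0
  show ?case
  proof (rule tabs_bead_rows_step[OF _ 0(2,1)])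
    fix \<mu> assume p: "is_part k \<mu>"
    have rows: "bead_rows k x 0 0 \<mu> = delta (beads k \<mu>) (block 1 k)"
      by (simp add: bead_rows_def)
    show "(\<Sum>T\<in>tabs k (Suc 0) 0 \<mu>. tab_prod x (cells k \<mu>) T) = bead_rows k x 0 0 \<mu>"
    proof (cases "cells k \<mu> = {}")
      case True
      then show ?thesis using beads_empty[OF p] rows by (simp add: tabs_empty tab_prod_def)
    next
      case False
      then obtain r c where rc: "(r, c) \<in> cells k \<mu>" by auto
      then have "T \<notin> tabs k (Suc 0) 0 \<mu>" for T
      proof (intro notI)
        assume T: "T \<in> tabs k (Suc 0) 0 \<mu>"
        then have "T (r, c) = Suc 0" using rc by (force simp: tabs_def)
        then have "c + (k - r) \<le> 0" using T rc by (auto simp: tabs_def)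
        then show False using rc by (auto simp: cells_def)
      qed
      then have "tabs k (Suc 0) 0 \<mu> = {}" by blast
      then show ?thesis using False beads_empty[OF p] rows by simp
    qed
  qed
next
  case (Suc m)
  show ?case
  proof (rule tabs_bead_rows_step[OF _ Suc.prems(2,1)])
    fix \<mu> assume p: "is_part k \<mu>"
    have k: "0 < k" using Suc.prems(2) by (cases k) auto
    have bound: "c + (k - r) \<le> 2 * k - 1" if "(r, c) \<in> cells k \<mu>" for r c
    proof -
      have "c < k" using that p by (auto simp: cells_def is_part_def intro: less_le_trans)
      then show ?thesis by simp
    qed
    have ne: "T s \<noteq> Suc (Suc m)" if "T \<in> tabs k (Suc (Suc m)) 0 \<mu>" "s \<in> cells k \<mu>" for T s
      using that by (cases s) (auto simp: tabs_def cells_def)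
    have "tabs k (Suc (Suc m)) 0 \<mu> = tabs k (Suc m) (2 * k - 1) \<mu>"
    proof (intro set_eqI iffI)
      fix T assume T: "T \<in> tabs k (Suc (Suc m)) 0 \<mu>"
      then have ext: "T \<in> cells k \<mu> \<rightarrow>\<^sub>E {1..Suc (Suc m)}" by (simp add: tabs_def)
      have "T s \<in> {1..Suc m}" if "s \<in> cells k \<mu>" for s
        using PiE_mem[OF ext that] ne[OF T that] by auto
      then have "T \<in> cells k \<mu> \<rightarrow>\<^sub>E {1..Suc m}" using ext by (auto simp: PiE_def)
      then show "T \<in> tabs k (Suc m) (2 * k - 1) \<mu>" using T bound by (auto simp: tabs_def)
    next
      fix T assume T: "T \<in> tabs k (Suc m) (2 * k - 1) \<mu>"
      then have ext: "T \<in> cells k \<mu> \<rightarrow>\<^sub>E {1..Suc m}" by (simp add: tabs_def)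
      have le: "T s \<le> Suc m" if "s \<in> cells k \<mu>" for s using PiE_mem[OF ext that] by simp
      have "T \<in> cells k \<mu> \<rightarrow>\<^sub>E {1..Suc (Suc m)}"
        by (rule subsetD[OF PiE_mono ext]) auto
      moreover have "T (r, c) \<noteq> Suc (Suc m)" if "(r, c) \<in> cells k \<mu>" for r c using le[OF that] by simp
      ultimately show "T \<in> tabs k (Suc (Suc m)) 0 \<mu>" using T by (auto simp: tabs_def)
    qed
    moreover have "bead_rows k x (Suc m) 0 \<mu> = bead_rows k x m (2 * k - 1) \<mu>"
      by (simp add: bead_rows_def)
    ultimately show "(\<Sum>T\<in>tabs k (Suc (Suc m)) 0 \<mu>. tab_prod x (cells k \<mu>) T) = bead_rows k x (Suc m) 0 \<mu>"
      using Suc.IH[OF p, of "2 * k - 1"] k by simp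
  qed
qed

text \<open>Row r has its bead at 2 (k - r), so exactly the even places are occupied. This is why
  \<open>beads\<close> and \<open>block\<close> are defined to alternate outside their
  window.\<close>

lemma beads_staircase: "beads k (\<lambda>r. k - r) = block 0 0"
proof
  fix i
  have "(\<exists>r<k. i = (k - r) + (k - r)) \<longleftrightarrow> even i" if "1 \<le> i" "i \<le> 2 * k"
  proof
    assume "even i"
    then obtain d where "i = 2 * d" by (auto elim: evenE)
    then show "\<exists>r<k. i = (k - r) + (k - r)" using that by (intro exI[of _ "k - d"]) auto
  qed auto
  then show "beads k (\<lambda>r. k - r) i = block 0 0 i" by (auto simp: beads_def block_def)
qed

definition staircase_tabs :: "nat \<Rightarrow> nat \<Rightarrow> (nat \<times> nat \<Rightarrow> nat) set" where
  "staircase_tabs k m = {T \<in> cells k (\<lambda>r. k - r) \<rightarrow>\<^sub>E {1..m}. semistd (cells k (\<lambda>r. k - r)) T}"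

lemma staircase_tabs_long:
  assumes x: "generic m x" and m: "2 * k \<le> m"
  shows "(\<Sum>T\<in>staircase_tabs k m. tab_prod x (cells k (\<lambda>r. k - r)) T) = stanley_long (Suc k) m x"
proof (cases "k = 0")
  case True
  then have c: "cells k (\<lambda>r. k - r) = {}" by (auto simp: cells_def)
  then have "staircase_tabs k m = {\<lambda>_. undefined}" by (auto simp: staircase_tabs_def semistd_def)
  moreover have "sq.full_rows (2 * k) m x (delta (block 0 0)) (block 1 k) = 1"
  proof -
    have "block 1 0 = block 0 0" by (auto simp: block_def fun_eq_iff)
    then show ?thesis using True by (simp add: sq.full_rows_def sq.brows_trivial)
  qed
  ultimately show ?thesis using c block_full_rows_long[OF x m] by (simp add: tab_prod_def)
next
  case False
  define \<mu> where "\<mu> r = k - r" for r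
  obtain m' where m': "m = Suc m'" using m False by (cases m) auto
  have p: "is_part k \<mu>" by (auto simp: is_part_def \<mu>_def)
  have "c + (k - r) \<le> 2 * k - 1" if "(r, c) \<in> cells k \<mu>" for r c
    using that by (auto simp: cells_def \<mu>_def)
  then have "staircase_tabs k m = tabs k (Suc m') (2 * k - 1) \<mu>"
    unfolding m' by (auto simp: staircase_tabs_def tabs_def \<mu>_def[abs_def])
  then have "(\<Sum>T\<in>staircase_tabs k m. tab_prod x (cells k \<mu>) T) = bead_rows k x m' (2 * k - 1) \<mu>"
    using tabs_bead_rows[OF p, of "2 * k - 1" x m'] False by simp
  also have "\<dots> = sq.brows (2 * k) (\<lambda>_. 1) x (rev [1..<Suc (Suc m')]) (delta (beads k \<mu>)) (block 1 k)"
    by (simp add: bead_rows_def)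
  also have "\<dots> = sq.full_rows (2 * k) m x (delta (beads k \<mu>)) (block 1 k)"
    unfolding sq.full_rows_def m' by (rule fun_cong[OF brows_mset]) simp
  also have "beads k \<mu> = block 0 0" unfolding \<mu>_def[abs_def] by (rule beads_staircase)
  finally show ?thesis using block_full_rows_long[OF x m]
    by (simp add: \<mu>_def[abs_def] del: seq_move_apply)
qed

section \<open>Evaluation of power series\<close>

definition monoms :: "nat \<Rightarrow> nat \<Rightarrow> nat multiset set" where
  "monoms m d = {M. set_mset M \<subseteq> {1..m} \<and> size M \<le> d}"

definition mono_val :: "(nat \<Rightarrow> real) \<Rightarrow> nat multiset \<Rightarrow> real" where
  "mono_val x M = (\<Prod>i\<in>#M. x i)"

text \<open>The cut-off to finitely many variables and bounded degree makes the value at a real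
  point a finite sum; by \<open>meval_mono\<close> the choice of a valid degree bound does not
  matter.\<close>

definition meval :: "nat \<Rightarrow> nat \<Rightarrow> mseries \<Rightarrow> (nat \<Rightarrow> real) \<Rightarrow> real" where
  "meval m d F x = (\<Sum>M\<in>monoms m d. of_int (mcoeff F M) * mono_val x M)"

definition degree_le :: "nat \<Rightarrow> mseries \<Rightarrow> bool" where
  "degree_le d F \<longleftrightarrow> (\<forall>M. mcoeff F M \<noteq> 0 \<longrightarrow> size M \<le> d)"

lemma finite_monoms [simp]: "finite (monoms m d)"
proof (rule finite_subset)
  show "monoms m d \<subseteq> mset ` {xs. set xs \<subseteq> {1..m} \<and> length xs \<le> d}"
  proof
    fix M assume M: "M \<in> monoms m d"
    obtain xs where "mset xs = M" using ex_mset by blast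
    then show "M \<in> mset ` {xs. set xs \<subseteq> {1..m} \<and> length xs \<le> d}"
      using M by (intro image_eqI[of _ _ xs]) (auto simp: monoms_def)
  qed
  show "finite (mset ` {xs. set xs \<subseteq> {1..m} \<and> length xs \<le> d})"
    by (intro finite_imageI finite_lists_length_le) simp
qed

lemma meval_mono:
  assumes "degree_le d F" "d \<le> D"
  shows "meval m D F x = meval m d F x"
  unfolding meval_def
  by (rule sum.mono_neutral_right, rule finite_monoms)
    (use assms in \<open>auto simp: monoms_def degree_le_def\<close>)

lemma mcoeff_weight_series: "mcoeff (weight_series X wt) M = int (card {t \<in> X. wt t = M})"
  by (simp add: weight_series_def MSeries_inverse)

lemma meval_weight_series:
  assumes "finite {t \<in> X. wt t \<in> monoms m d}"
  shows "meval m d (weight_series X wt) x = (\<Sum>t\<in>{t \<in> X. wt t \<in> monoms m d}. mono_val x (wt t))"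
proof -
  let ?X = "{t \<in> X. wt t \<in> monoms m d}"
  have "meval m d (weight_series X wt) x = (\<Sum>M\<in>monoms m d. \<Sum>t\<in>{t \<in> ?X. wt t = M}. mono_val x (wt t))"
    unfolding meval_def
  proof (rule sum.cong[OF refl])
    fix M assume "M \<in> monoms m d"
    then have "{t \<in> ?X. wt t = M} = {t \<in> X. wt t = M}" by auto
    then show "real_of_int (mcoeff (weight_series X wt) M) * mono_val x M
        = (\<Sum>t\<in>{t \<in> ?X. wt t = M}. mono_val x (wt t))"
      by (simp add: mcoeff_weight_series)
  qed
  also have "\<dots> = (\<Sum>t\<in>?X. mono_val x (wt t))"
    by (rule sum.group) (use assms in auto)
  finally show ?thesis .
qed

lemma mcoeff_sum: "mcoeff (\<Sum>a\<in>A. f a) M = (\<Sum>a\<in>A. mcoeff (f a) M)"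
  by (induction A rule: infinite_finite_induct) (simp_all add: mcoeff_simps)

lemma meval_sum: "meval m d (\<Sum>a\<in>A. f a) x = (\<Sum>a\<in>A. meval m d (f a) x)"
  unfolding meval_def mcoeff_sum of_int_sum sum_distrib_right by (rule sum.swap)

lemma mono_val_add: "mono_val x (A + B) = mono_val x A * mono_val x B"
  by (simp add: mono_val_def)

lemma meval_mult:
  assumes F: "degree_le d F" and G: "degree_le e G"
  shows "meval m (d + e) (F * G) x = meval m d F x * meval m e G x"
proof -
  let ?S = "monoms m d \<times> monoms m e"
  let ?h = "\<lambda>(A, B). of_int (mcoeff F A) * mono_val x A * (of_int (mcoeff G B) * mono_val x B)"
  have "meval m (d + e) (F * G) x = (\<Sum>M\<in>monoms m (d + e). \<Sum>p\<in>{p \<in> ?S. fst p + snd p = M}. ?h p)"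
    unfolding meval_def
  proof (rule sum.cong[OF refl])
    fix M assume M: "M \<in> monoms m (d + e)"
    have "of_int (mcoeff (F * G) M) * mono_val x M = (\<Sum>p\<in>msplits M. ?h p)"
      unfolding times_mseries.rep_eq of_int_sum sum_distrib_right
      by (rule sum.cong[OF refl]) (auto simp: msplits_def mono_val_add)
    also have "\<dots> = (\<Sum>p\<in>{p \<in> ?S. fst p + snd p = M}. ?h p)"
    proof (rule sum.mono_neutral_right)
      show "{p \<in> ?S. fst p + snd p = M} \<subseteq> msplits M" by (auto simp: msplits_def)
      show "\<forall>p\<in>msplits M - {p \<in> ?S. fst p + snd p = M}. ?h p = 0"
      proof
        fix p assume p: "p \<in> msplits M - {p \<in> ?S. fst p + snd p = M}"
        obtain A B where AB: "p = (A, B)" by force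
        have sub: "A + B = M" "set_mset A \<subseteq> {1..m}" "set_mset B \<subseteq> {1..m}"
          using p AB M by (auto simp: msplits_def monoms_def)
        then have "\<not> (size A \<le> d \<and> size B \<le> e)" using p AB by (auto simp: monoms_def)
        then show "?h p = 0" using F G AB by (auto simp: degree_le_def)
      qed
    qed simp
    finally show "of_int (mcoeff (F * G) M) * mono_val x M = (\<Sum>p\<in>{p \<in> ?S. fst p + snd p = M}. ?h p)" .
  qed
  also have "\<dots> = (\<Sum>p\<in>?S. ?h p)"
  proof (rule sum.group)
    show "(\<lambda>p. fst p + snd p) ` ?S \<subseteq> monoms m (d + e)"
      by (auto simp: monoms_def subset_iff intro!: add_mono)
  qed simp_all
  also have "\<dots> = meval m d F x * meval m e G x"
    by (simp add: meval_def sum_product sum.cartesian_product)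
  finally show ?thesis .
qed

lemma degree_le_mult:
  assumes F: "degree_le d F" and G: "degree_le e G"
  shows "degree_le (d + e) (F * G)"
  unfolding degree_le_def
proof (intro allI impI)
  fix M assume "mcoeff (F * G) M \<noteq> 0"
  then obtain p where "p \<in> msplits M" "(case p of (A, B) \<Rightarrow> mcoeff F A * mcoeff G B) \<noteq> 0"
    unfolding times_mseries.rep_eq by (rule sum.not_neutral_contains_not_neutral)
  then show "size M \<le> d + e"
    using F G by (auto simp: degree_le_def msplits_def intro!: add_mono)
qed

lemma sum_mset_count_mult:
  fixes f :: "nat \<Rightarrow> nat"
  shows "set_mset M \<subseteq> {..<n} \<Longrightarrow> (\<Sum>i\<in>#M. f i) = (\<Sum>i<n. count M i * f i)"
proof (induction M)
  case (add j M)
  have "(\<Sum>i<n. count (add_mset j M) i * f i) = (\<Sum>i<n. count M i * f i + (if i = j then f i else 0))"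
    by (rule sum.cong) auto
  then show ?case using add by (simp add: sum.distrib)
qed simp

lemma digits_less:
  fixes f :: "nat \<Rightarrow> nat"
  shows "(\<And>i. i < n \<Longrightarrow> f i < b) \<Longrightarrow> (\<Sum>i<n. f i * b ^ i) < b ^ n"
proof (induction n)
  case (Suc n)
  have "(\<Sum>i<n. f i * b ^ i) < b ^ n" using Suc by simp
  moreover have "Suc (f n) * b ^ n \<le> b * b ^ n"
    using Suc.prems[of n] by (intro mult_right_mono) auto
  ultimately show ?case by simp
qed simp

lemma digits_unique:
  fixes f g :: "nat \<Rightarrow> nat"
  assumes "(\<Sum>i<n. f i * b ^ i) = (\<Sum>i<n. g i * b ^ i)"
    and "\<And>i. i < n \<Longrightarrow> f i < b" "\<And>i. i < n \<Longrightarrow> g i < b"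
  shows "i < n \<Longrightarrow> f i = g i"
  using assms
proof (induction n arbitrary: i)
  case (Suc n)
  have lt: "(\<Sum>i<n. f i * b ^ i) < b ^ n" "(\<Sum>i<n. g i * b ^ i) < b ^ n"
    using Suc.prems by (auto intro!: digits_less)
  then have pos: "b ^ n \<noteq> 0" by (metis not_less_zero)
  have "((\<Sum>i<n. f i * b ^ i) + f n * b ^ n) div b ^ n = f n"
    "((\<Sum>i<n. g i * b ^ i) + g n * b ^ n) div b ^ n = g n"
    using lt pos by simp_all
  then have fg: "f n = g n" using Suc.prems(2) by simp
  then have "(\<Sum>i<n. f i * b ^ i) = (\<Sum>i<n. g i * b ^ i)" using Suc.prems(2) by simp
  then show ?case using Suc.IH[of i] Suc.prems fg by (cases "i = n") auto
qed simp

text \<open>Substituting \<open>t ^ (d + 1) ^ i\<close> for the variable \<open>x_i\<close> separates all monomials of degree at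
  most \<open>d\<close>.\<close>

lemma meval_eq_imp:
  assumes eq: "\<And>x. generic m x \<Longrightarrow> meval m d F x = meval m d G x" and M: "M \<in> monoms m d"
  shows "mcoeff F M = mcoeff G M"
proof -
  \<comment> \<open>The base exceeds all multiplicities, which are at most d, and is at least 2 even
    for d = 0, so that the powers of b are distinct.\<close>
  define b where "b = d + 2"
  define ex where "ex M = (\<Sum>i\<in>#M. b ^ i)" for M :: "nat multiset"
  define c where "c M = real_of_int (mcoeff F M - mcoeff G M)" for M
  have digits: "ex M = (\<Sum>i<Suc m. count M i * b ^ i)" if "M \<in> monoms m d" for M
  proof -
    have "set_mset M \<subseteq> {..<Suc m}" using that by (auto simp: monoms_def)
    then show ?thesis unfolding ex_def by (rule sum_mset_count_mult)
  qed
  have inj: "inj_on ex (monoms m d)"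
  proof (rule inj_onI)
    fix A B assume A: "A \<in> monoms m d" and B: "B \<in> monoms m d" and "ex A = ex B"
    then have s: "(\<Sum>i<Suc m. count A i * b ^ i) = (\<Sum>i<Suc m. count B i * b ^ i)"
      by (simp only: digits)
    have small: "count C i < b" if "C \<in> monoms m d" for C i
    proof -
      have "count C i \<le> size C" by (rule count_le_size)
      then show ?thesis using that by (simp add: monoms_def b_def)
    qed
    show "A = B"
    proof (rule multiset_eqI)
      fix i show "count A i = count B i"
      proof (cases "i < Suc m")
        case True
        then show ?thesis by (rule digits_unique[OF s small[OF A] small[OF B]])
      next
        case False
        then have "i \<notin># A" "i \<notin># B" using A B by (auto simp: monoms_def)
        then show ?thesis by (simp add: not_in_iff)
      qed
    qed
  qed
  define p where "p = (\<Sum>M\<in>monoms m d. monom (c M) (ex M))"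
  have "poly p t = 0" if t: "t > 1" for t
  proof -
    define x where "x i = t ^ (b ^ i)" for i
    have "generic m x"
    proof -
      have "inj x"
      proof (rule injI)
        fix i j assume "x i = x j"
        then have "b ^ i = b ^ j" using t by (simp add: x_def)
        then show "i = j" by (simp add: b_def)
      qed
      then show ?thesis using t by (auto simp: generic_def x_def intro: inj_on_subset)
    qed
    then have "meval m d F x - meval m d G x = 0" using eq by simp
    moreover have "mono_val x M = t ^ ex M" for M
      unfolding mono_val_def ex_def x_def by (induction M) (simp_all add: power_add)
    ultimately show ?thesis
      by (simp add: p_def poly_sum poly_monom meval_def c_def sum_subtractf[symmetric] algebra_simps)
  qed
  then have "{1<..} \<subseteq> {t. poly p t = 0}" by auto
  then have "infinite {t. poly p t = 0}"
    using infinite_Ioi[of "1 :: real"] finite_subset by blast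
  then have "p = 0" using poly_roots_finite by blast
  then have "0 = coeff p (ex M)" by simp
  also have "\<dots> = (\<Sum>A\<in>monoms m d. if A = M then c A else 0)"
    unfolding p_def coeff_sum
    by (rule sum.cong[OF refl]) (use inj M in \<open>auto simp: inj_on_def\<close>)
  also have "\<dots> = c M" using M by simp
  finally show ?thesis by (simp add: c_def)
qed

lemma mseries_eq_by_meval:
  assumes "degree_le d F" "degree_le d G"
    and pos: "\<And>M. mcoeff F M \<noteq> 0 \<Longrightarrow> 0 \<notin># M" "\<And>M. mcoeff G M \<noteq> 0 \<Longrightarrow> 0 \<notin># M"
    and eq: "\<And>m x. m0 \<le> m \<Longrightarrow> generic m x \<Longrightarrow> meval m d F x = meval m d G x"
  shows "F = G"
proof (rule mseries_eqI)
  fix M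
  show "mcoeff F M = mcoeff G M"
  proof (cases "size M \<le> d \<and> 0 \<notin># M")
    case True
    define m where "m = max m0 (Max (insert 0 (set_mset M)))"
    have "i \<le> m" if "i \<in># M" for i using that by (auto simp: m_def intro: Max_ge max.coboundedI2)
    moreover have "1 \<le> i" if "i \<in># M" for i using that True by (cases i) auto
    ultimately have "M \<in> monoms m d" using True by (auto simp: monoms_def)
    then show ?thesis by (rule meval_eq_imp[rotated]) (use eq in \<open>auto simp: m_def\<close>)
  next
    case False
    have "mcoeff F M = 0" using False assms(1) pos(1)[of M] by (auto simp: degree_le_def)
    moreover have "mcoeff G M = 0" using False assms(2) pos(2)[of M] by (auto simp: degree_le_def)
    ultimately show ?thesis by simp
  qed
qed

section \<open>Stanley series as coefficients of products of rows\<close>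

lemma inv_desc_small:
  assumes "inv_desc l z" "\<And>j. N < j \<Longrightarrow> z j = j"
  shows "l < N" "N < j \<Longrightarrow> inv_act z l j = j"
proof -
  have z: "is_inv z" using assms(1) by (simp add: inv_desc_def)
  show l: "l < N"
  proof (rule ccontr)
    assume "\<not> l < N"
    then have "z (Suc l) = Suc l" using assms(2) by simp
    moreover have "z l \<le> Suc l"
    proof (rule ccontr)
      assume "\<not> z l \<le> Suc l"
      then show False using assms(2)[of "z l"] \<open>\<not> l < N\<close> is_invD[OF z, of l] by simp
    qed
    ultimately show False using assms(1) by (simp add: inv_desc_def)
  qed
  show "inv_act z l j = j" if "N < j"
    using that l assms(2)[OF that] by (simp add: inv_act_apply[OF z])
qed

lemma rpath_letters:
  "rpath y c z \<Longrightarrow> (\<And>j. N < j \<Longrightarrow> z j = j) \<Longrightarrow> set c \<subseteq> {..<N}"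
proof (induction c arbitrary: z)
  case (Cons i c)
  then have d: "inv_desc i z" "rpath y c (inv_act z i)" by auto
  show ?case using inv_desc_small[OF d(1) Cons.prems(2)] Cons.IH[OF d(2)] by simp
qed simp

lemma compatible_seqs_iff:
  assumes "length I = length a"
  defines "p \<equiv> zip (rev I) (rev a)"
  shows "I \<in> compatible_seqs a \<longleftrightarrow> set I \<subseteq> {1..} \<and>
    (\<forall>k. Suc k < length p \<longrightarrow> fst (p ! Suc k) < fst (p ! k)
        \<or> fst (p ! Suc k) = fst (p ! k) \<and> snd (p ! k) \<le> snd (p ! Suc k))"
proof -
  let ?n = "length a"
  define R where "R j \<longleftrightarrow> I ! j < I ! Suc j \<or> I ! j = I ! Suc j \<and> a ! Suc j \<le> a ! j" for j
  have n: "length p = ?n" by (simp add: p_def assms(1))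
  have pk: "p ! k = (I ! (?n - Suc k), a ! (?n - Suc k))" if "k < ?n" for k
    using that by (simp add: p_def assms(1) rev_nth)
  have "(\<forall>k. Suc k < length p \<longrightarrow> fst (p ! Suc k) < fst (p ! k)
        \<or> fst (p ! Suc k) = fst (p ! k) \<and> snd (p ! k) \<le> snd (p ! Suc k))
      \<longleftrightarrow> (\<forall>k. Suc k < ?n \<longrightarrow> R (?n - Suc (Suc k)))"
  proof -
    have "Suc (?n - Suc (Suc k)) = ?n - Suc k" if "Suc k < ?n" for k using that by simp
    then show ?thesis using n pk by (auto simp: R_def)
  qed
  also have "\<dots> \<longleftrightarrow> (\<forall>j. Suc j < ?n \<longrightarrow> R j)"
  proof
    assume *: "\<forall>k. Suc k < ?n \<longrightarrow> R (?n - Suc (Suc k))"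
    show "\<forall>j. Suc j < ?n \<longrightarrow> R j"
    proof (intro allI impI)
      fix j assume "Suc j < ?n"
      then have "Suc (?n - Suc (Suc j)) < ?n" "?n - Suc (Suc (?n - Suc (Suc j))) = j" by auto
      then show "R j" using * by metis
    qed
  qed auto
  also have "set I \<subseteq> {1..} \<and> \<dots> \<longleftrightarrow> I \<in> compatible_seqs a"
    unfolding compatible_seqs_def sorted_iff_nth_Suc R_def using assms(1) by (auto simp: le_less)
  finally show ?thesis by blast
qed

context
  fixes y z :: "nat \<Rightarrow> nat" and N :: nat
  assumes y: "fin_inv y" "y 0 = 0" and z: "fin_inv z" "z 0 = 0" and N: "\<forall>j>N. z j = j" "1 \<le> N"
begin

lemma rel_words_length:
  assumes "a \<in> rel_inv_words y z" "b \<in> rel_inv_words y z"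
  shows "length a = length b"
proof -
  have "inv_rank z = inv_rank y + 2 * length a" "inv_rank z = inv_rank y + 2 * length b"
    using assms by (auto simp: rel_inv_words_rpath[OF y z] intro!: rel_inv_words_length[OF y(1)])
  then show ?thesis by simp
qed

lemma finite_rel_words: "finite (rel_inv_words y z)"
proof (cases "rel_inv_words y z = {}")
  case False
  then obtain b where b: "b \<in> rel_inv_words y z" by blast
  have "rel_inv_words y z \<subseteq> {a. set a \<subseteq> {..<N} \<and> length a = length b}"
  proof
    fix a assume a: "a \<in> rel_inv_words y z"
    then have "rpath y (rev a) z" by (simp add: rel_inv_words_rpath[OF y z])
    from rpath_letters[OF this] N(1) have "set a \<subseteq> {..<N}" by simp
    then show "a \<in> {a. set a \<subseteq> {..<N} \<and> length a = length b}"
      using rel_words_length[OF a b] by simp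
  qed
  then show ?thesis by (rule finite_subset) (rule finite_lists_length_eq, simp)
qed simp

text \<open>Zipping a word with a compatible sequence, both reversed, gives exactly the lists
  described by \<open>cw\<close>: strict increase of the indices is required where the word
  ascends.\<close>

lemma meval_rel_inv_stanley:
  assumes D: "\<And>a. a \<in> rel_inv_words y z \<Longrightarrow> length a \<le> D"
  shows "meval m D (rel_inv_stanley y z) x = inv.full_rows N m x (delta y) z"
proof -
  let ?R = "rel_inv_words y z"
  let ?C = "\<lambda>a. {I \<in> compatible_seqs a. mset I \<in> monoms m D}"
  have fin: "finite (?C a)" for a
    by (rule finite_subset[OF _ finite_lists_length_eq[of "{1..m}" "length a"]])
      (auto simp: compatible_seqs_def monoms_def)
  have "meval m D (rel_inv_stanley y z) x = (\<Sum>a\<in>?R. \<Sum>I\<in>?C a. mono_val x (mset I))"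
    unfolding rel_inv_stanley_def meval_sum using fin by (simp add: meval_weight_series)
  also have "\<dots> = (\<Sum>(a, I)\<in>Sigma ?R ?C. mono_val x (mset I))"
    by (rule sum.Sigma) (use fin finite_rel_words in auto)
  also have "\<dots> = (\<Sum>p\<in>{p. cw y m 1 p z}. wt_prod x p)"
  proof (rule sum.reindex_bij_witness[where
        i = "\<lambda>p. (rev (map snd p), rev (map fst p))" and j = "\<lambda>(a, I). zip (rev I) (rev a)"])
    fix q assume "q \<in> Sigma ?R ?C"
    then obtain a I where q: "q = (a, I)" and a: "a \<in> ?R" and I: "I \<in> compatible_seqs a"
      and m: "set I \<subseteq> {1..m}" by (auto simp: monoms_def)
    have len: "length I = length a" using I by (simp add: compatible_seqs_def)
    show "(case case q of (a, I) \<Rightarrow> zip (rev I) (rev a) of p \<Rightarrow> (rev (map snd p), rev (map fst p))) = q"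
      using len by (simp add: q)
    define p where "p = zip (rev I) (rev a)"
    have p: "map fst p = rev I" "map snd p = rev a" using len by (simp_all add: p_def)
    have "fst (hd p) \<in> {1..m} \<and> 1 \<le> snd (hd p)" if "p \<noteq> []"
    proof -
      have "fst (hd p) \<in> set (map fst p)" "snd (hd p) \<in> set (map snd p)" using that by auto
      then show ?thesis using m a unfolding p by (auto simp: rel_inv_words_rpath[OF y z])
    qed
    then have "cw y m 1 p z"
      unfolding cw_iff p using a I compatible_seqs_iff[OF len] m
      by (auto simp: p_def rel_inv_words_rpath[OF y z] le_less)
    then show "(case q of (a, I) \<Rightarrow> zip (rev I) (rev a)) \<in> {p. cw y m 1 p z}"
      by (simp add: q p_def)
    show "wt_prod x (case q of (a, I) \<Rightarrow> zip (rev I) (rev a)) = (case q of (a, I) \<Rightarrow> mono_val x (mset I))"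
    proof -
      have "wt_prod x p = prod_list (map x (rev I))"
        unfolding wt_prod_def by (simp add: p(1)[symmetric] o_def)
      also have "\<dots> = mono_val x (mset I)"
        by (simp add: mono_val_def prod_mset_prod_list[symmetric] rev_map del: prod_mset_prod_list)
      finally show ?thesis by (simp add: q p_def)
    qed
  next
    fix p assume "p \<in> {p. cw y m 1 p z}"
    then have cw: "cw y m 1 p z" by simp
    define a I where "a = rev (map snd p)" and "I = rev (map fst p)"
    have len: "length I = length a" by (simp add: a_def I_def)
    have pz: "zip (rev I) (rev a) = p" by (simp add: a_def I_def zip_map_fst_snd)
    show "(case (rev (map snd p), rev (map fst p)) of (a, I) \<Rightarrow> zip (rev I) (rev a)) = p"
      by (simp add: zip_map_fst_snd)
    have a: "a \<in> ?R" using cw unfolding cw_iff by (simp add: rel_inv_words_rpath[OF y z] a_def)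
    have I: "I \<in> compatible_seqs a"
      unfolding compatible_seqs_iff[OF len] pz using cw unfolding cw_iff by (simp add: I_def)
    have "set I \<subseteq> {1..m}"
    proof (cases "p = []")
      case False
      then have "I \<noteq> []" "last I = fst (hd p)" by (simp_all add: I_def last_rev hd_map)
      moreover have "fst (hd p) \<le> m" using cw False unfolding cw_iff by auto
      moreover have "sorted I" "set I \<subseteq> {1..}" using I by (auto simp: compatible_seqs_def)
      ultimately show ?thesis
        by (cases I rule: rev_cases) (auto simp: sorted_append subset_iff intro: le_trans)
    qed (simp add: I_def)
    moreover have "length I \<le> D" using D[OF a] len by simp
    ultimately show "(rev (map snd p), rev (map fst p)) \<in> Sigma ?R ?C"
      using a I by (simp add: monoms_def a_def I_def)
  qed
  also have "\<dots> = inv.full_rows N m x (delta y) z"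
    using cw_rows[of N z y m x] N by simp
  finally show ?thesis .
qed

lemma mcoeff_rel_inv_stanley:
  "mcoeff (rel_inv_stanley y z) M = (\<Sum>a\<in>rel_inv_words y z. int (card {I \<in> compatible_seqs a. mset I = M}))"
  by (simp add: rel_inv_stanley_def mcoeff_sum mcoeff_weight_series)

lemma mcoeff_rel_inv_stanley_nz:
  assumes "mcoeff (rel_inv_stanley y z) M \<noteq> 0"
  shows "0 \<notin># M" "\<exists>a\<in>rel_inv_words y z. size M = length a"
proof -
  from assms obtain a where a: "a \<in> rel_inv_words y z"
    "int (card {I \<in> compatible_seqs a. mset I = M}) \<noteq> 0"
    unfolding mcoeff_rel_inv_stanley by (rule sum.not_neutral_contains_not_neutral)
  then have "{I \<in> compatible_seqs a. mset I = M} \<noteq> {}" by (metis card.empty of_nat_0)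
  then obtain I where I: "I \<in> compatible_seqs a" "mset I = M" by blast
  show "0 \<notin># M" using I by (auto simp: compatible_seqs_def)
  show "\<exists>a\<in>rel_inv_words y z. size M = length a"
    using a(1) I by (intro bexI[of _ a]) (auto simp: compatible_seqs_def)
qed

text \<open>A word of length L has exactly one compatible sequence with the entries 1, ..., L,
  namely the strictly increasing one.\<close>

lemma mcoeff_rel_inv_stanley_squarefree:
  assumes "\<And>a. a \<in> rel_inv_words y z \<Longrightarrow> length a = L"
  shows "mcoeff (rel_inv_stanley y z) (mset_set {1..L}) = int (card (rel_inv_words y z))"
proof -
  have m: "mset [1..<Suc L] = mset_set {1..L}"
    by (simp only: mset_upt atLeastLessThanSuc_atLeastAtMost)
  have "{I \<in> compatible_seqs a. mset I = mset_set {1..L}} = {[1..<Suc L]}" if a: "a \<in> rel_inv_words y z" for a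
  proof (intro set_eqI iffI)
    fix I assume "I \<in> {I \<in> compatible_seqs a. mset I = mset_set {1..L}}"
    then have "sorted I" "mset I = mset_set {1..L}" by (auto simp: compatible_seqs_def)
    then have "I = [1..<Suc L]"
      using m sorted_upt properties_for_sort by metis
    then show "I \<in> {[1..<Suc L]}" by simp
  next
    fix I assume "I \<in> {[1..<Suc L]}"
    then have I: "I = [1..<Suc L]" by simp
    have "I ! j < I ! Suc j" if "Suc j < L" for j using that I by (simp del: upt_Suc)
    then have "I \<in> compatible_seqs a"
      using assms[OF a] I by (auto simp: compatible_seqs_def simp del: upt_Suc)
    then show "I \<in> {I \<in> compatible_seqs a. mset I = mset_set {1..L}}"
      unfolding I using m by blast
  qed
  then show ?thesis by (simp add: mcoeff_rel_inv_stanley)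
qed

end

section \<open>Coefficients of Schur functions and counting\<close>

lemma length_staircase: "length (staircase (Suc k)) = k"
  by (simp add: staircase_def)

lemma nth_staircase: "r < k \<Longrightarrow> staircase (Suc k) ! r = k - r"
  by (simp add: staircase_def rev_nth del: upt_Suc)

lemma diagram_staircase: "diagram (staircase (Suc k)) = cells k (\<lambda>r. k - r)"
  by (auto simp: diagram_def cells_def length_staircase nth_staircase)

lemma card_cells_staircase: "card (cells k (\<lambda>r. k - r)) = Suc k choose 2"
proof -
  have "cells k (\<lambda>r. k - r) = Sigma {..<k} (\<lambda>r. {..<k - r})" by (auto simp: cells_def)
  then have "card (cells k (\<lambda>r. k - r)) = (\<Sum>r<k. k - r)" by simp
  also have "\<dots> = Suc k choose 2"
  proof (induction k)
    case (Suc k)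
    have "(\<Sum>r<Suc k. Suc k - r) = Suc k + (\<Sum>r<k. k - r)"
      by (subst sum.lessThan_Suc_shift) simp
    then show ?case using Suc by (simp add: numeral_2_eq_2)
  qed simp
  finally show ?thesis .
qed

lemma sum_list_staircase: "sum_list (staircase (Suc k)) = Suc k choose 2"
proof -
  have "sum_list (staircase (Suc k)) = sum_list [1..<Suc k]"
    by (simp only: staircase_def sum_list_rev)
  also have "\<dots> = Suc k choose 2"
    by (induction k) (simp_all add: numeral_2_eq_2)
  finally show ?thesis .
qed

lemma ssyt_semistd:
  "ssyt (staircase (Suc k)) = {T \<in> cells k (\<lambda>r. k - r) \<rightarrow>\<^sub>E {1..}. semistd (cells k (\<lambda>r. k - r)) T}"
  unfolding ssyt_def diagram_staircase semistd_def by blast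

lemma meval_schur:
  "meval m (Suc k choose 2) (schur (staircase (Suc k))) x
    = (\<Sum>T\<in>staircase_tabs k m. tab_prod x (cells k (\<lambda>r. k - r)) T)"
proof -
  define D where "D = cells k (\<lambda>r. k - r)"
  define wt where "wt T = image_mset T (mset_set D)" for T :: "nat \<times> nat \<Rightarrow> nat"
  have fD: "finite D" by (simp add: D_def)
  have "size (wt T) = Suc k choose 2" for T
    using card_cells_staircase[of k] by (simp add: wt_def D_def)
  then have X: "{T \<in> ssyt (staircase (Suc k)). wt T \<in> monoms m (Suc k choose 2)} = staircase_tabs k m"
    unfolding ssyt_semistd staircase_tabs_def D_def[symmetric] using fD
    by (auto simp: monoms_def wt_def PiE_iff)
  have "finite (staircase_tabs k m)"
    by (rule finite_subset[of _ "cells k (\<lambda>r. k - r) \<rightarrow>\<^sub>E {1..m}"])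
      (auto simp: staircase_tabs_def intro: finite_PiE)
  then have "meval m (Suc k choose 2) (schur (staircase (Suc k))) x
      = (\<Sum>T\<in>staircase_tabs k m. mono_val x (wt T))"
    using meval_weight_series[where X = "ssyt (staircase (Suc k))" and wt = wt and m = m
        and d = "Suc k choose 2" and x = x]
    unfolding schur_def diagram_staircase D_def[symmetric] wt_def[symmetric, abs_def] X by blast
  also have "\<dots> = (\<Sum>T\<in>staircase_tabs k m. tab_prod x D T)"
    by (simp add: mono_val_def wt_def tab_prod_def prod_unfold_prod_mset image_mset.compositionality o_def)
  finally show ?thesis by (simp add: D_def)
qed

lemma mcoeff_schur_nz:
  assumes "mcoeff (schur (staircase (Suc k))) M \<noteq> 0"
  shows "size M = Suc k choose 2" "0 \<notin># M"
proof -
  have "{T \<in> ssyt (staircase (Suc k)). image_mset T (mset_set (cells k (\<lambda>r. k - r))) = M} \<noteq> {}"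
    using assms unfolding schur_def mcoeff_weight_series diagram_staircase by (metis card.empty of_nat_0)
  then obtain T where T: "T \<in> ssyt (staircase (Suc k))"
    "M = image_mset T (mset_set (cells k (\<lambda>r. k - r)))" by blast
  show "size M = Suc k choose 2" using T(2) card_cells_staircase[of k] by simp
  have "T p \<ge> 1" if "p \<in> cells k (\<lambda>r. k - r)" for p
    using T(1) that unfolding ssyt_semistd by auto
  then show "0 \<notin># M" using T(2) by force
qed

lemma degree_le_schur: "degree_le (Suc k choose 2) (schur (staircase (Suc k)))"
  using mcoeff_schur_nz(1) by (auto simp: degree_le_def)

text \<open>Relabelling by the increasing bijection onto the set of entries turns standard into
  semistandard tableaux with distinct entries.\<close>

lemma mcoeff_schur_squarefree:
  assumes S: "finite S" "0 \<notin> S"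
  shows "mcoeff (schur (staircase (Suc k))) (mset_set S)
    = (if card S = Suc k choose 2 then int (num_syt (staircase (Suc k))) else 0)"
proof (cases "card S = Suc k choose 2")
  case False
  then show ?thesis using mcoeff_schur_nz(1)[of k "mset_set S"] by auto
next
  case True
  define n where "n = Suc k choose 2"
  define D where "D = cells k (\<lambda>r. k - r)"
  have D: "finite D" "card D = n" using card_cells_staircase by (simp_all add: D_def n_def)
  obtain h where h: "bij_betw h {..<card S} S" "strict_mono_on {..<card S} h"
    using ex_bij_betw_strict_mono_card[OF S(1)] by blast
  define e where "e i = h (i - 1)" for i
  have e: "bij_betw e {1..n} S"
  proof -
    have "bij_betw (\<lambda>i. i - 1) {1..n} {..<n}"
      by (rule bij_betwI[where g = Suc]) auto
    from bij_betw_trans[OF this h(1)[unfolded True n_def[symmetric]]] show ?thesis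
      by (simp add: e_def[abs_def] o_def)
  qed
  have mono: "e i < e j \<longleftrightarrow> i < j" if "i \<in> {1..n}" "j \<in> {1..n}" for i j
  proof -
    have *: "e i < e j" if "i < j" "i \<in> {1..n}" "j \<in> {1..n}" for i j
      unfolding e_def by (rule strict_mono_onD[OF h(2)]) (use that True in \<open>auto simp: n_def\<close>)
    show ?thesis using *[of i j] *[of j i] that by (metis less_asym linorder_neqE_nat)
  qed
  define e' where "e' = inv_into {1..n} e"
  have e': "bij_betw e' S {1..n}" unfolding e'_def by (rule bij_betw_inv_into[OF e])
  have ee': "e (e' s) = s" if "s \<in> S" for s
    unfolding e'_def by (rule bij_betw_inv_into_right[OF e that])
  have e'e: "e' (e i) = i" if "i \<in> {1..n}" for i
    unfolding e'_def by (rule bij_betw_inv_into_left[OF e that])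
  have mono': "e' s < e' t \<longleftrightarrow> s < t" if "s \<in> S" "t \<in> S" for s t
    using mono[of "e' s" "e' t"] that ee' bij_betwE[OF e'] by auto
  define X where "X = {T \<in> ssyt (staircase (Suc k)). image_mset T (mset_set D) = mset_set S}"
  have syt: "syt (staircase (Suc k)) = {T \<in> extensional D. bij_betw T D {1..n} \<and>
    (\<forall>r c c'. (r, c) \<in> D \<longrightarrow> (r, c') \<in> D \<longrightarrow> c < c' \<longrightarrow> T (r, c) < T (r, c')) \<and>
    (\<forall>r r' c. (r, c) \<in> D \<longrightarrow> (r', c) \<in> D \<longrightarrow> r < r' \<longrightarrow> T (r, c) < T (r', c))}"
    unfolding syt_def diagram_staircase sum_list_staircase D_def n_def by blast
  have X_iff: "T \<in> X \<longleftrightarrow> T \<in> extensional D \<and> bij_betw T D S \<and>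
    (\<forall>r c c'. (r, c) \<in> D \<longrightarrow> (r, c') \<in> D \<longrightarrow> c < c' \<longrightarrow> T (r, c) < T (r, c')) \<and>
    (\<forall>r r' c. (r, c) \<in> D \<longrightarrow> (r', c) \<in> D \<longrightarrow> r < r' \<longrightarrow> T (r, c) < T (r', c))" for T
  proof
    assume T: "T \<in> X"
    then have ss: "T \<in> D \<rightarrow>\<^sub>E {1..}" "semistd D T" and im: "image_mset T (mset_set D) = mset_set S"
      unfolding X_def ssyt_semistd D_def[symmetric] by auto
    have "set_mset (image_mset T (mset_set D)) = set_mset (mset_set S)" by (simp only: im)
    then have img: "T ` D = S" using D(1) S(1) by simp
    \<comment> \<open>T maps D onto a set of the same size, so it is injective; this makes the weak
      row inequalities strict.\<close>
    then have inj: "inj_on T D" using D True by (intro eq_card_imp_inj_on) (simp_all add: n_def)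
    have "T (r, c) < T (r, c')" if "(r, c) \<in> D" "(r, c') \<in> D" "c < c'" for r c c'
    proof -
      have "T (r, c) \<le> T (r, c')" using ss(2) that unfolding semistd_def by blast
      moreover have "T (r, c) \<noteq> T (r, c')" using inj_onD[OF inj _ that(1,2)] that(3) by auto
      ultimately show ?thesis by simp
    qed
    then show "T \<in> extensional D \<and> bij_betw T D S \<and>
      (\<forall>r c c'. (r, c) \<in> D \<longrightarrow> (r, c') \<in> D \<longrightarrow> c < c' \<longrightarrow> T (r, c) < T (r, c')) \<and>
      (\<forall>r r' c. (r, c) \<in> D \<longrightarrow> (r', c) \<in> D \<longrightarrow> r < r' \<longrightarrow> T (r, c) < T (r', c))"
      using ss img inj unfolding PiE_def semistd_def bij_betw_def by blast
  next
    assume T: "T \<in> extensional D \<and> bij_betw T D S \<and>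
      (\<forall>r c c'. (r, c) \<in> D \<longrightarrow> (r, c') \<in> D \<longrightarrow> c < c' \<longrightarrow> T (r, c) < T (r, c')) \<and>
      (\<forall>r r' c. (r, c) \<in> D \<longrightarrow> (r', c) \<in> D \<longrightarrow> r < r' \<longrightarrow> T (r, c) < T (r', c))"
    then have b: "bij_betw T D S" and ss: "semistd D T"
      unfolding semistd_def by (blast, meson less_imp_le)
    have "T p \<in> {1..}" if "p \<in> D" for p
    proof -
      have "T p \<in> S" using b that by (auto simp: bij_betw_def)
      then show ?thesis using S(2) by (cases "T p") auto
    qed
    then have "T \<in> D \<rightarrow>\<^sub>E {1..}" using T unfolding PiE_def by blast
    moreover have "image_mset T (mset_set D) = mset_set S"
      using b by (simp add: image_mset_mset_set bij_betw_def)
    ultimately show "T \<in> X" unfolding X_def ssyt_semistd D_def[symmetric] using ss by blast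
  qed
  have "bij_betw (\<lambda>T. restrict (e \<circ> T) D) (syt (staircase (Suc k))) X"
  proof (rule bij_betwI[where g = "\<lambda>T. restrict (e' \<circ> T) D"])
    show "(\<lambda>T. restrict (e \<circ> T) D) \<in> syt (staircase (Suc k)) \<rightarrow> X"
    proof
      fix T assume T: "T \<in> syt (staircase (Suc k))"
      then have b: "bij_betw T D {1..n}" by (simp add: syt)
      have "bij_betw (restrict (e \<circ> T) D) D S"
        using bij_betw_trans[OF b e] by (subst bij_betw_restrict_eq) auto
      moreover have "e (T p) < e (T p') \<longleftrightarrow> T p < T p'" if "p \<in> D" "p' \<in> D" for p p'
        using mono bij_betwE[OF b] that by blast
      ultimately show "restrict (e \<circ> T) D \<in> X"
        using T unfolding X_iff syt by simp
    qed
    show "(\<lambda>T. restrict (e' \<circ> T) D) \<in> X \<rightarrow> syt (staircase (Suc k))"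
    proof
      fix T assume T: "T \<in> X"
      then have b: "bij_betw T D S" by (simp add: X_iff)
      have "bij_betw (restrict (e' \<circ> T) D) D {1..n}"
        using bij_betw_trans[OF b e'] by (subst bij_betw_restrict_eq) auto
      moreover have "e' (T p) < e' (T p') \<longleftrightarrow> T p < T p'" if "p \<in> D" "p' \<in> D" for p p'
        using mono' bij_betwE[OF b] that by blast
      ultimately show "restrict (e' \<circ> T) D \<in> syt (staircase (Suc k))"
        using T unfolding X_iff syt by simp
    qed
    show "restrict (e' \<circ> restrict (e \<circ> T) D) D = T" if "T \<in> syt (staircase (Suc k))" for T
    proof
      fix p
      have T: "bij_betw T D {1..n}" "T \<in> extensional D" using that by (simp_all only: syt mem_Collect_eq)
      show "restrict (e' \<circ> restrict (e \<circ> T) D) D p = T p"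
      proof (cases "p \<in> D")
        case True
        then have "T p \<in> {1..n}" using T(1) by (auto simp only: bij_betw_def)
        then show ?thesis using True e'e by (simp only: restrict_apply o_apply if_True)
      next
        case False
        then show ?thesis using extensional_arb[OF T(2) False] by (simp only: restrict_apply if_False)
      qed
    qed
    show "restrict (e \<circ> restrict (e' \<circ> T) D) D = T" if "T \<in> X" for T
    proof
      fix p
      have T: "bij_betw T D S" "T \<in> extensional D" using that by (simp_all only: X_iff)
      show "restrict (e \<circ> restrict (e' \<circ> T) D) D p = T p"
      proof (cases "p \<in> D")
        case True
        then have "T p \<in> S" using T(1) by (auto simp only: bij_betw_def)
        then show ?thesis using True ee' by (simp only: restrict_apply o_apply if_True)
      next
        case False
        then show ?thesis using extensional_arb[OF T(2) False] by (simp only: restrict_apply if_False)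
      qed
    qed
  qed
  then have "card (syt (staircase (Suc k))) = card X" by (rule bij_betw_same_card)
  then show ?thesis
    using True by (simp add: schur_def mcoeff_weight_series diagram_staircase X_def D_def num_syt_def)
qed

section \<open>Squarefree coefficients of products\<close>

lemma msplits_mset_set:
  assumes "finite S"
  shows "msplits (mset_set S) = (\<lambda>T. (mset_set T, mset_set (S - T))) ` Pow S"
proof (intro set_eqI iffI)
  fix p assume "p \<in> msplits (mset_set S)"
  then obtain A B where p: "p = (A, B)" "A + B = mset_set S" by (auto simp: msplits_def)
  have le: "count A i + count B i = (if i \<in> S then 1 else 0)" for i
    using p(2) assms by (metis count_mset_set(1) count_mset_set(3) count_union)
  have sub: "set_mset A \<subseteq> S" using le by (force split: if_splits)
  have A: "A = mset_set (set_mset A)"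
  proof (rule multiset_eqI)
    fix i show "count A i = count (mset_set (set_mset A)) i"
    proof (cases "i \<in># A")
      case True
      then obtain c where "count A i = Suc c" by (metis count_eq_zero_iff not0_implies_Suc)
      then have "count A i = 1" using le[of i] by (simp split: if_splits)
      then show ?thesis using True by simp
    qed (simp add: not_in_iff)
  qed
  have B: "B = mset_set (S - set_mset A)"
  proof (rule multiset_eqI)
    fix i show "count B i = count (mset_set (S - set_mset A)) i"
    proof (cases "i \<in># A")
      case True
      then obtain c where "count A i = Suc c" by (metis count_eq_zero_iff not0_implies_Suc)
      then have "count B i = 0" using le[of i] by (simp split: if_splits)
      then show ?thesis using True assms by simp
    next
      case False
      then have "count B i = (if i \<in> S then 1 else 0)" using le[of i] by (simp add: not_in_iff)
      then show ?thesis using False assms by (auto simp: count_mset_set')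
    qed
  qed
  show "p \<in> (\<lambda>T. (mset_set T, mset_set (S - T))) ` Pow S"
    using A B sub p(1) by blast
next
  fix p assume "p \<in> (\<lambda>T. (mset_set T, mset_set (S - T))) ` Pow S"
  then obtain T where T: "T \<subseteq> S" "p = (mset_set T, mset_set (S - T))" by blast
  have "mset_set T + mset_set (S - T) = mset_set S"
    using T(1) assms by (metis Diff_disjoint Un_Diff_cancel finite_Diff finite_subset mset_set_Union sup.absorb2)
  then show "p \<in> msplits (mset_set S)" using T(2) by (simp add: msplits_def)
qed

text \<open>A squarefree monomial splits by choosing the set of variables for the first factor.
  Homogeneity forces its size to be d, and each choice contributes the same product of tableau
  counts.\<close>

lemma mcoeff_schur_mult_squarefree:
  fixes k k' :: nat
  defines "d \<equiv> Suc k choose 2" and "d' \<equiv> Suc k' choose 2"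
  shows "mcoeff (schur (staircase (Suc k)) * schur (staircase (Suc k'))) (mset_set {1..d + d'})
    = int (((d + d') choose d) * num_syt (staircase (Suc k)) * num_syt (staircase (Suc k')))"
proof -
  let ?S = "{1..d + d'}" and ?f = "int (num_syt (staircase (Suc k)))"
    and ?g = "int (num_syt (staircase (Suc k')))"
  have inj: "inj_on (\<lambda>T. (mset_set T, mset_set (?S - T))) (Pow ?S)"
  proof (rule inj_onI)
    fix T T' assume T: "T \<in> Pow ?S" "T' \<in> Pow ?S" "(mset_set T, mset_set (?S - T)) = (mset_set T', mset_set (?S - T'))"
    then have "finite T" "finite T'" by (auto intro: finite_subset)
    then show "T = T'" using T(3) by (metis finite_set_mset_mset_set prod.inject)
  qed
  have "mcoeff (schur (staircase (Suc k)) * schur (staircase (Suc k'))) (mset_set ?S)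
      = (\<Sum>T\<in>Pow ?S. mcoeff (schur (staircase (Suc k))) (mset_set T)
          * mcoeff (schur (staircase (Suc k'))) (mset_set (?S - T)))"
    unfolding times_mseries.rep_eq msplits_mset_set[OF finite_atLeastAtMost]
    by (subst sum.reindex[OF inj]) simp
  also have "\<dots> = (\<Sum>T\<in>Pow ?S. if card T = d then ?f * ?g else 0)"
  proof (rule sum.cong[OF refl])
    fix T assume T: "T \<in> Pow ?S"
    then have fT: "finite T" by (auto intro: finite_subset)
    have c: "card (?S - T) = d + d' - card T" using T fT by (simp add: card_Diff_subset)
    have le: "card T \<le> d + d'" using T card_mono[of ?S T] by simp
    have z: "0 \<notin> T" using T by auto
    show "mcoeff (schur (staircase (Suc k))) (mset_set T)
          * mcoeff (schur (staircase (Suc k'))) (mset_set (?S - T))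
        = (if card T = d then ?f * ?g else 0)"
      using mcoeff_schur_squarefree[OF fT z, of k] mcoeff_schur_squarefree[of "?S - T" k'] c le
      by (simp add: d_def[symmetric] d'_def[symmetric])
  qed
  also have "\<dots> = (\<Sum>T\<in>{T. T \<subseteq> ?S \<and> card T = d}. ?f * ?g)"
    by (rule sum.mono_neutral_cong_right) auto
  also have "\<dots> = int ((d + d') choose d) * (?f * ?g)"
    using n_subsets[of ?S d] by simp
  finally show ?thesis by simp
qed

section \<open>The longest permutation and the conclusion\<close>

lemma longest_perm_reversal: "longest_perm n = reversal id 1 n"
  by (auto simp: longest_perm_def reversal_def fun_eq_iff)

lemma longest_perm_reversal_fpf: "longest_perm (2 * n) = reversal (fpf_min n) 1 (2 * n)"
  by (auto simp: longest_perm_def reversal_def fpf_min_def fun_eq_iff)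

lemma fin_inv_longest_perm: "fin_inv (longest_perm n)"
proof -
  have "is_inv (longest_perm n)" by (auto simp: is_inv_def longest_perm_def fun_eq_iff)
  moreover have "longest_perm n j = j" if "n < j" for j using that by (simp add: longest_perm_def)
  ultimately show ?thesis by (auto simp: fin_inv_def)
qed

lemma fin_inv_fpf_min: "fin_inv (fpf_min n)"
proof -
  have "fpf_min n j = j" if "2 * n < j" for j using that by (simp add: fpf_min_def)
  then show ?thesis using is_inv_fpf_min by (auto simp: fin_inv_def)
qed

text \<open>The size of the words need not be known in advance: comparing the coefficients of squarefree
  monomials shows that it is the degree of the product.\<close>

lemma rel_inv_stanley_product:
  fixes y z :: "nat \<Rightarrow> nat" and N k k' :: nat
  assumes y: "fin_inv y" "y 0 = 0" and z: "fin_inv z" "z 0 = 0" and N: "\<forall>j>N. z j = j" "1 \<le> N"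
    and rows: "\<forall>m x. m0 \<le> m \<longrightarrow> generic m x \<longrightarrow>
      inv.full_rows N m x (delta y) z = stanley_long (Suc k) m x * stanley_long (Suc k') m x"
  defines "d \<equiv> Suc k choose 2" and "d' \<equiv> Suc k' choose 2"
  shows "rel_inv_stanley y z = schur (staircase (Suc k)) * schur (staircase (Suc k'))"
    and "card (rel_inv_words y z)
      = ((d + d') choose d) * num_syt (staircase (Suc k)) * num_syt (staircase (Suc k'))"
proof -
  let ?F = "rel_inv_stanley y z" and ?G = "schur (staircase (Suc k)) * schur (staircase (Suc k'))"
  let ?R = "rel_inv_words y z"
  note ctx = y z N
  note nz = mcoeff_rel_inv_stanley_nz[OF ctx]
  obtain L where L: "\<And>a. a \<in> ?R \<Longrightarrow> length a = L"
    using rel_words_length[OF ctx] by metis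
  \<comment> \<open>A truncation degree valid for both sides, as long as L is not known to be d +
    d'.\<close>
  define E where "E = max L (d + d')"
  have F: "degree_le E ?F"
    unfolding degree_le_def using nz(2) L by (fastforce simp: E_def)
  have G0: "degree_le (d + d') ?G"
    unfolding d_def d'_def by (intro degree_le_mult degree_le_schur)
  then have G: "degree_le E ?G" by (auto simp: degree_le_def E_def le_max_iff_disj)
  show eq: "?F = ?G"
  proof (rule mseries_eq_by_meval[OF F G])
    show "0 \<notin># M" if "mcoeff ?F M \<noteq> 0" for M using nz(1)[OF that] .
    show "0 \<notin># M" if nonzero: "mcoeff ?G M \<noteq> 0" for M
    proof -
      obtain p where "p \<in> msplits M" "(case p of (A, B) \<Rightarrow>
          mcoeff (schur (staircase (Suc k))) A * mcoeff (schur (staircase (Suc k'))) B) \<noteq> 0"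
        using nonzero unfolding times_mseries.rep_eq by (rule sum.not_neutral_contains_not_neutral)
      then show ?thesis using mcoeff_schur_nz(2) by (auto simp: msplits_def)
    qed
    fix m x assume m: "max m0 (2 * k + 2 * k') \<le> m" and x: "generic m x"
    have "meval m E ?G x = meval m (d + d') ?G x"
      by (rule meval_mono[OF G0]) (simp add: E_def)
    also have "\<dots> = stanley_long (Suc k) m x * stanley_long (Suc k') m x"
      using meval_mult[OF degree_le_schur degree_le_schur, of m k k' x] m
      by (simp add: d_def d'_def meval_schur staircase_tabs_long[OF x])
    also have "\<dots> = inv.full_rows N m x (delta y) z" using rows m x by simp
    also have "\<dots> = meval m E ?F x"
      by (rule meval_rel_inv_stanley[OF ctx, symmetric]) (use L in \<open>simp add: E_def\<close>)
    finally show "meval m E ?F x = meval m E ?G x" by simp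
  qed
  have sq: "mcoeff ?F (mset_set {1..L}) = int (card ?R)"
    by (rule mcoeff_rel_inv_stanley_squarefree[OF ctx L])
  have prod: "mcoeff ?F (mset_set {1..d + d'})
      = int (((d + d') choose d) * num_syt (staircase (Suc k)) * num_syt (staircase (Suc k')))"
    unfolding eq d_def d'_def by (rule mcoeff_schur_mult_squarefree)
  show "card ?R = ((d + d') choose d) * num_syt (staircase (Suc k)) * num_syt (staircase (Suc k'))"
  proof (cases "L = d + d'")
    case True
    then show ?thesis using sq prod by (metis of_nat_eq_iff)
  next
    case False
    \<comment> \<open>Different degrees would make both squarefree coefficients vanish, and then
      both sides of the claim are 0.\<close>
    have "mcoeff ?F (mset_set {1..d + d'}) = 0"
    proof (rule ccontr)
      assume "mcoeff ?F (mset_set {1..d + d'}) \<noteq> 0"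
      then obtain a where "a \<in> ?R" "d + d' = length a" using nz(2) by fastforce
      then show False using False L by simp
    qed
    moreover have "mcoeff ?F (mset_set {1..L}) = 0"
    proof (rule ccontr)
      assume *: "mcoeff ?F (mset_set {1..L}) \<noteq> 0"
      then obtain p where "p \<in> msplits (mset_set {1..L})" "(case p of (A, B) \<Rightarrow>
          mcoeff (schur (staircase (Suc k))) A * mcoeff (schur (staircase (Suc k'))) B) \<noteq> 0"
        unfolding eq times_mseries.rep_eq by (rule sum.not_neutral_contains_not_neutral)
      then obtain A B where "A + B = mset_set {1..L}" "size A = d" "size B = d'"
        using mcoeff_schur_nz(1) by (auto simp: msplits_def d_def d'_def)
      then have "size (mset_set {1..L}) = d + d'" by (metis size_union)
      then show False using False by simp
    qed
    ultimately show ?thesis using sq prod by simp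
  qed
qed

theorem theorem1p4:
  fixes n p q P Q N :: nat
  assumes "n \<ge> 1"
    and "p = nat \<lceil>(real n + 1) / 2\<rceil>"
    and "q = nat \<lfloor>(real n + 1) / 2\<rfloor>"
    and "P = p choose 2"
    and "Q = q choose 2"
    and "N = n choose 2"
  shows "inv_stanley (longest_perm n) = schur (staircase p) * schur (staircase q)
    \<and> fpf_inv_stanley n (longest_perm (2 * n)) = (schur (staircase n))\<^sup>2
    \<and> card (inv_words (longest_perm n))
        = ((P + Q) choose P) * num_syt (staircase p) * num_syt (staircase q)
    \<and> card (fpf_inv_words n (longest_perm (2 * n)))
        = ((2 * N) choose N) * (num_syt (staircase n))\<^sup>2"
proof -
  have "p = Suc (n div 2) \<and> q = n - n div 2"
  proof (cases "even n")
    case True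
    then obtain l where "n = 2 * l" by (rule evenE)
    then show ?thesis using assms(2,3) by (simp add: add_divide_distrib) linarith
  next
    case False
    then obtain l where "n = 2 * l + 1" by (rule oddE)
    then show ?thesis using assms(2,3) by (simp add: add_divide_distrib) linarith
  qed
  then have p: "p = Suc (n div 2)" and q: "q = n - n div 2" by auto
  have "0 < q" using q assms(1) by simp
  then obtain k where k: "q = Suc k" by (metis gr0_implies_Suc)
  obtain l where l: "n = Suc l" using assms(1) by (cases n) auto
  have z0: "longest_perm i 0 = 0" for i by (simp add: longest_perm_def)
  have zN: "\<forall>j>i. longest_perm i j = j" for i by (simp add: longest_perm_def)
  have v0: "fpf_min n 0 = 0" by (simp add: fpf_min_def)
  have rows: "\<forall>m x. n \<le> m \<longrightarrow> generic m x \<longrightarrow> inv.full_rows n m x (delta id) (longest_perm n)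
      = stanley_long (Suc (n div 2)) m x * stanley_long (Suc k) m x"
    unfolding longest_perm_reversal k[symmetric] q using inv_full_rows_long assms(1) by blast
  have "inv_stanley (longest_perm n) = schur (staircase p) * schur (staircase q)"
    "card (rel_inv_words id (longest_perm n))
        = ((P + Q) choose P) * num_syt (staircase p) * num_syt (staircase q)"
    using rel_inv_stanley_product[OF fin_inv_id id_apply fin_inv_longest_perm z0 zN assms(1) rows]
    unfolding inv_stanley_def assms(4,5) p k by blast+
  moreover have rows': "\<forall>m x. 2 * n \<le> m \<longrightarrow> generic m x \<longrightarrow>
      inv.full_rows (2 * n) m x (delta (fpf_min n)) (longest_perm (2 * n))
      = stanley_long (Suc l) m x * stanley_long (Suc l) m x"
    unfolding longest_perm_reversal_fpf l[symmetric] power2_eq_square[symmetric]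
    using fpf_full_rows_long assms(1) by blast
  have "1 \<le> 2 * n" using assms(1) by simp
  note fpf = rel_inv_stanley_product[OF fin_inv_fpf_min v0 fin_inv_longest_perm z0 zN this rows']
  ultimately show ?thesis
    using fpf unfolding fpf_inv_stanley_def fpf_inv_words_def assms(6) rel_inv_words_id
    by (simp only: l power2_eq_square mult_2 mult.assoc simp_thms)
qed

end
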